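(* Let $\boldsymbol{n}=(n_1,\dots,n_r)$ and $\boldsymbol{d}=(d_1,\dots,d_r)$ be two $r$-tuples of positive integers, with $n_1\leq\dots\leq n_r$ and $d=d_1+\dots+d_r\geq 3$. Let $SV^{\boldsymbol{n}}_{\boldsymbol{d}}\subset\mathbb{P}^N$ be the product $\mathbb{P}^{n_1}\times\dots\times\mathbb{P}^{n_r}$ embedded by the complete linear system $\big|\mathcal{O}_{\mathbb{P}^{n_1}\times\dots\times\mathbb{P}^{n_r}}(d_1,\dots,d_r)\big|$. Write $d-1=2^{\lambda_1}+\dots+2^{\lambda_s}+\epsilon$ with $\lambda_1>\lambda_2>\dots>\lambda_s\geq 1$ and $\epsilon\in\{0,1\}$. Then $SV^{\boldsymbol{n}}_{\boldsymbol{d}}$ is not $h$-defective for every $$h\leq n_1\big((n_1+1)^{\lambda_1-1}+\dots+(n_1+1)^{\lambda_s-1}\big)+1.$$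
   Context: The base field is $\mathbb{C}$. For a non-degenerate variety $X\subset\mathbb{P}^N$, $\mathbb{S}ec_h(X)$ is the closure of the union of the linear spans of $h$ points of $X$, and $X$ is $h$-defective if $\dim\mathbb{S}ec_h(X)<\min\{h\dim X+h-1,N\}$. *)

theory Defs
  imports
    "HOL-Analysis.Abstract_Topology"
    "HOL-Library.Extended_Nat"
    "HOL-Library.Function_Algebras"
    "HOL-Library.Poly_Mapping"
    Complex_Main
begin

section \<open>Projective space\<close>

text \<open>
  For a finite non-empty index set \<open>I\<close>, the space \<open>\<complex>\<^sup>I\<close> consists of the functions that vanish outside
  \<open>I\<close>, and \<open>proj_space I\<close> is the set of its one-dimensional subspaces, i.e. projective space of
  dimension \<open>card I - 1\<close> with homogeneous coordinates indexed by \<open>I\<close>.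
\<close>

global_interpretation cvec: vector_space "\<lambda>(c::complex) (v::'i \<Rightarrow> complex) i. c * v i"
  by standard (auto simp: fun_eq_iff algebra_simps)

type_synonym 'i point = "('i \<Rightarrow> complex) set"

definition cvecs :: "'i set \<Rightarrow> ('i \<Rightarrow> complex) set" where
  "cvecs I = {v. \<forall>i. i \<notin> I \<longrightarrow> v i = 0}"

definition pt :: "('i \<Rightarrow> complex) \<Rightarrow> 'i point" where
  "pt v = cvec.span {v}"

definition proj_space :: "'i set \<Rightarrow> 'i point set" where
  "proj_space I = pt ` (cvecs I - {0})"

definition lin_span :: "'i set \<Rightarrow> 'i point set \<Rightarrow> 'i point set" where
  "lin_span I S = {p \<in> proj_space I. p \<subseteq> cvec.span (\<Union>S)}"


section \<open>Zariski topology\<close>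

text \<open>Polynomials in the variables \<open>'i\<close> are finitely supported maps from exponents to coefficients.\<close>

type_synonym 'i cpoly = "('i \<Rightarrow>\<^sub>0 nat) \<Rightarrow>\<^sub>0 complex"

definition mon_eval :: "('i \<Rightarrow>\<^sub>0 nat) \<Rightarrow> ('i \<Rightarrow> complex) \<Rightarrow> complex" where
  "mon_eval m v = (\<Prod>i\<in>Poly_Mapping.keys m. v i ^ Poly_Mapping.lookup m i)"

definition poly_eval :: "'i cpoly \<Rightarrow> ('i \<Rightarrow> complex) \<Rightarrow> complex" where
  "poly_eval F v = (\<Sum>m\<in>Poly_Mapping.keys F. Poly_Mapping.lookup F m * mon_eval m v)"

definition mon_deg :: "('i \<Rightarrow>\<^sub>0 nat) \<Rightarrow> nat" where
  "mon_deg m = (\<Sum>i\<in>Poly_Mapping.keys m. Poly_Mapping.lookup m i)"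

definition hom_polys :: "'i set \<Rightarrow> 'i cpoly set" where
  "hom_polys I = {F. \<exists>k. \<forall>m\<in>Poly_Mapping.keys F. Poly_Mapping.keys m \<subseteq> I \<and> mon_deg m = k}"

definition zero_locus :: "'i set \<Rightarrow> 'i cpoly set \<Rightarrow> 'i point set" where
  "zero_locus I S = {p \<in> proj_space I. \<forall>F\<in>S. \<forall>v\<in>p. poly_eval F v = 0}"

definition zariski :: "'i set \<Rightarrow> 'i point topology" where
  "zariski I = topology (\<lambda>U. \<exists>S \<subseteq> hom_polys I. U = proj_space I - zero_locus I S)"

lemma mon_eval_superset:
  assumes "finite A" "Poly_Mapping.keys m \<subseteq> A"
  shows "mon_eval m v = (\<Prod>i\<in>A. v i ^ Poly_Mapping.lookup m i)"
  unfolding mon_eval_def using assms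
  by (intro prod.mono_neutral_left) (auto simp: in_keys_iff)

lemma mon_eval_add: "mon_eval (m + m') v = mon_eval m v * mon_eval m' v"
proof -
  let ?A = "Poly_Mapping.keys m \<union> Poly_Mapping.keys m'"
  have "Poly_Mapping.keys (m + m') \<subseteq> ?A" by (rule keys_add)
  then show ?thesis
    by (simp add: mon_eval_superset[of ?A] lookup_add power_add prod.distrib)
qed

lemma mon_eval_scale: "mon_eval m (\<lambda>i. c * v i) = c ^ mon_deg m * mon_eval m v"
  by (simp add: mon_eval_def mon_deg_def power_mult_distrib prod.distrib power_sum)

lemma mon_deg_superset:
  assumes "finite A" "Poly_Mapping.keys m \<subseteq> A"
  shows "mon_deg m = (\<Sum>i\<in>A. Poly_Mapping.lookup m i)"
  unfolding mon_deg_def using assms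
  by (intro sum.mono_neutral_left) (auto simp: in_keys_iff)

lemma mon_deg_add: "mon_deg (m + m') = mon_deg m + mon_deg m'"
proof -
  let ?A = "Poly_Mapping.keys m \<union> Poly_Mapping.keys m'"
  have "Poly_Mapping.keys (m + m') \<subseteq> ?A" by (rule keys_add)
  then show ?thesis
    by (simp add: mon_deg_superset[of ?A] lookup_add sum.distrib)
qed

lemma poly_eval_superset:
  assumes "finite A" "Poly_Mapping.keys F \<subseteq> A"
  shows "poly_eval F v = (\<Sum>m\<in>A. Poly_Mapping.lookup F m * mon_eval m v)"
  unfolding poly_eval_def using assms
  by (intro sum.mono_neutral_left) (auto simp: in_keys_iff)

lemma poly_eval_zero [simp]: "poly_eval 0 v = 0"
  by (simp add: poly_eval_def)

lemma poly_eval_single: "poly_eval (Poly_Mapping.single m a) v = a * mon_eval m v"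
  by (simp add: poly_eval_def)

lemma poly_eval_one [simp]: "poly_eval 1 v = 1"
  using poly_eval_single[of 0 1 v] by (simp add: mon_eval_def)

lemma poly_eval_add: "poly_eval (F + G) v = poly_eval F v + poly_eval G v"
proof -
  let ?A = "Poly_Mapping.keys F \<union> Poly_Mapping.keys G"
  have "Poly_Mapping.keys (F + G) \<subseteq> ?A" by (rule keys_add)
  then show ?thesis
    by (simp add: poly_eval_superset[of ?A] lookup_add ring_distribs sum.distrib)
qed

lemma poly_eval_sum: "poly_eval (\<Sum>x\<in>A. F x) v = (\<Sum>x\<in>A. poly_eval (F x) v)"
  by (induction A rule: infinite_finite_induct) (simp_all add: poly_eval_add)

lemma cpoly_sum_single:
  "(F :: 'i cpoly) = (\<Sum>m\<in>Poly_Mapping.keys F. Poly_Mapping.single m (Poly_Mapping.lookup F m))"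
  by (rule poly_mapping_eqI)
     (auto simp: lookup_sum lookup_single when_def in_keys_iff)

lemma poly_eval_mult: "poly_eval (F * G) v = poly_eval F v * poly_eval G v"
proof -
  have "F * G = (\<Sum>m\<in>Poly_Mapping.keys F. Poly_Mapping.single m (Poly_Mapping.lookup F m)) *
      (\<Sum>m\<in>Poly_Mapping.keys G. Poly_Mapping.single m (Poly_Mapping.lookup G m))"
    by (rule arg_cong2[where f = "(*)"]; rule cpoly_sum_single)
  also have "\<dots> = (\<Sum>m\<in>Poly_Mapping.keys F. \<Sum>m'\<in>Poly_Mapping.keys G.
      Poly_Mapping.single (m + m') (Poly_Mapping.lookup F m * Poly_Mapping.lookup G m'))"
    by (simp only: sum_product mult_single)
  finally have "F * G = (\<Sum>m\<in>Poly_Mapping.keys F. \<Sum>m'\<in>Poly_Mapping.keys G.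
      Poly_Mapping.single (m + m') (Poly_Mapping.lookup F m * Poly_Mapping.lookup G m'))" .
  then have "poly_eval (F * G) v = (\<Sum>m\<in>Poly_Mapping.keys F. \<Sum>m'\<in>Poly_Mapping.keys G.
      Poly_Mapping.lookup F m * mon_eval m v * (Poly_Mapping.lookup G m' * mon_eval m' v))"
    by (simp add: poly_eval_sum poly_eval_single mon_eval_add mult_ac)
  then show ?thesis
    by (simp add: poly_eval_def sum_product)
qed

lemma hom_polys_mult:
  assumes "F \<in> hom_polys I" "G \<in> hom_polys I"
  shows "F * G \<in> hom_polys I"
proof -
  from assms obtain k l where
    k: "\<And>m. m \<in> Poly_Mapping.keys F \<Longrightarrow> Poly_Mapping.keys m \<subseteq> I \<and> mon_deg m = k" and
    l: "\<And>m. m \<in> Poly_Mapping.keys G \<Longrightarrow> Poly_Mapping.keys m \<subseteq> I \<and> mon_deg m = l"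
    unfolding hom_polys_def by blast
  have "Poly_Mapping.keys m \<subseteq> I \<and> mon_deg m = k + l" if m: "m \<in> Poly_Mapping.keys (F * G)" for m
  proof -
    obtain a b where ab: "a \<in> Poly_Mapping.keys F" "b \<in> Poly_Mapping.keys G" "m = a + b"
      using m keys_mult[of F G] by blast
    then show ?thesis
      using k[OF ab(1)] l[OF ab(2)] keys_add[of a b] by (auto simp: mon_deg_add)
  qed
  then show ?thesis
    unfolding hom_polys_def by blast
qed

lemma poly_eval_scale_eq_0:
  assumes "F \<in> hom_polys I" "poly_eval F v = 0"
  shows "poly_eval F (\<lambda>i. c * v i) = 0"
proof -
  obtain k where k: "\<And>m. m \<in> Poly_Mapping.keys F \<Longrightarrow> mon_deg m = k"
    using assms(1) unfolding hom_polys_def by blast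
  have "poly_eval F (\<lambda>i. c * v i) = c ^ k * poly_eval F v"
    unfolding poly_eval_def sum_distrib_left
    by (intro sum.cong refl) (simp add: mon_eval_scale k)
  then show ?thesis using assms(2) by simp
qed

lemma pt_eq: "pt v = range (\<lambda>c i. c * v i)"
  unfolding pt_def by (rule cvec.span_singleton)

lemma vanish_pt_iff:
  assumes "F \<in> hom_polys I"
  shows "(\<forall>w\<in>pt v. poly_eval F w = 0) \<longleftrightarrow> poly_eval F v = 0"
proof
  have "v \<in> pt v" unfolding pt_def by (rule cvec.span_base) simp
  then show "\<forall>w\<in>pt v. poly_eval F w = 0 \<Longrightarrow> poly_eval F v = 0" by blast
qed (auto simp: pt_eq poly_eval_scale_eq_0[OF assms])

lemma pt_in_zero_locus_iff:
  assumes "S \<subseteq> hom_polys I"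
  shows "pt v \<in> zero_locus I S \<longleftrightarrow> pt v \<in> proj_space I \<and> (\<forall>F\<in>S. poly_eval F v = 0)"
proof -
  have "(\<forall>w\<in>pt v. poly_eval F w = 0) \<longleftrightarrow> poly_eval F v = 0" if "F \<in> S" for F
    using vanish_pt_iff assms that by blast
  then show ?thesis
    unfolding zero_locus_def by blast
qed

lemma zero_locus_Un:
  assumes "S \<subseteq> hom_polys I" "T \<subseteq> hom_polys I"
  shows "zero_locus I S \<union> zero_locus I T = zero_locus I {F * G |F G. F \<in> S \<and> G \<in> T}"
    (is "_ = zero_locus I ?P")
proof -
  have P: "?P \<subseteq> hom_polys I"
    using assms hom_polys_mult by blast
  have "(\<forall>H\<in>?P. poly_eval H v = 0) \<longleftrightarrow>
      (\<forall>F\<in>S. \<forall>G\<in>T. poly_eval F v = 0 \<or> poly_eval G v = 0)" for v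
  proof -
    have "(\<forall>H\<in>?P. poly_eval H v = 0) \<longleftrightarrow> (\<forall>F\<in>S. \<forall>G\<in>T. poly_eval (F * G) v = 0)"
      by blast
    then show ?thesis
      by (simp only: poly_eval_mult mult_eq_0_iff)
  qed
  then have "pt v \<in> zero_locus I S \<union> zero_locus I T \<longleftrightarrow> pt v \<in> zero_locus I ?P" for v
    unfolding Un_iff pt_in_zero_locus_iff[OF assms(1)] pt_in_zero_locus_iff[OF assms(2)]
      pt_in_zero_locus_iff[OF P]
    by blast
  moreover have "zero_locus I S \<union> zero_locus I T \<subseteq> range pt" "zero_locus I ?P \<subseteq> range pt"
    by (auto simp: zero_locus_def proj_space_def)
  ultimately show ?thesis by blast
qed

lemma istopology_zariski:
  "istopology (\<lambda>U. \<exists>S \<subseteq> hom_polys I. U = proj_space I - zero_locus I S)"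
  unfolding istopology_def
proof (intro conjI allI impI)
  fix U V
  assume "\<exists>S \<subseteq> hom_polys I. U = proj_space I - zero_locus I S"
    and "\<exists>S \<subseteq> hom_polys I. V = proj_space I - zero_locus I S"
  then obtain S T where S: "S \<subseteq> hom_polys I" "U = proj_space I - zero_locus I S"
    and T: "T \<subseteq> hom_polys I" "V = proj_space I - zero_locus I T" by blast
  have "{F * G |F G. F \<in> S \<and> G \<in> T} \<subseteq> hom_polys I"
    using S(1) T(1) hom_polys_mult by blast
  moreover have "U \<inter> V = proj_space I - zero_locus I {F * G |F G. F \<in> S \<and> G \<in> T}"
    unfolding S(2) T(2) zero_locus_Un[OF S(1) T(1), symmetric] by blast
  ultimately show "\<exists>S \<subseteq> hom_polys I. U \<inter> V = proj_space I - zero_locus I S" by blast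
next
  fix \<U>
  assume "\<forall>U\<in>\<U>. \<exists>S \<subseteq> hom_polys I. U = proj_space I - zero_locus I S"
  from bchoice[OF this] obtain S where
    *: "\<forall>U\<in>\<U>. S U \<subseteq> hom_polys I \<and> U = proj_space I - zero_locus I (S U)" ..
  have S: "S U \<subseteq> hom_polys I" if "U \<in> \<U>" for U
    using bspec[OF * that] by (rule conjunct1)
  have S': "U = proj_space I - zero_locus I (S U)" if "U \<in> \<U>" for U
    using bspec[OF * that] by (rule conjunct2)
  have "\<Union>\<U> = (\<Union>U\<in>\<U>. proj_space I - zero_locus I (S U))"
  proof -
    have "(\<Union>U\<in>\<U>. U) = (\<Union>U\<in>\<U>. proj_space I - zero_locus I (S U))"
      by (rule SUP_cong[OF refl S'])
    then show ?thesis by simp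
  qed
  also have "\<dots> = proj_space I - zero_locus I (\<Union>U\<in>\<U>. S U)"
    by (auto simp: zero_locus_def)
  finally have "\<Union>\<U> = proj_space I - zero_locus I (\<Union>U\<in>\<U>. S U)" .
  moreover have "(\<Union>U\<in>\<U>. S U) \<subseteq> hom_polys I"
    using S by (rule UN_least)
  ultimately show "\<exists>S \<subseteq> hom_polys I. \<Union>\<U> = proj_space I - zero_locus I S"
    by (intro exI conjI)
qed

lemma openin_zariski_iff:
  "openin (zariski I) U \<longleftrightarrow> (\<exists>S \<subseteq> hom_polys I. U = proj_space I - zero_locus I S)"
  by (simp add: zariski_def topology_inverse'[OF istopology_zariski])

lemma topspace_zariski [simp]:
  fixes I :: "'i set"
  shows "topspace (zariski I) = proj_space I"
proof -
  have "v \<in> pt v" for v :: "'i \<Rightarrow> complex"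
    unfolding pt_def by (rule cvec.span_base) simp
  then have "zero_locus I {1 :: 'i cpoly} = {}"
    by (auto simp: zero_locus_def proj_space_def)
  moreover have "(1 :: 'i cpoly) \<in> hom_polys I"
    by (simp add: hom_polys_def)
  ultimately have "openin (zariski I) (proj_space I)"
    unfolding openin_zariski_iff by (intro exI[of _ "{1}"]) auto
  moreover have "U \<subseteq> proj_space I" if "openin (zariski I) U" for U
    using that unfolding openin_zariski_iff by blast
  ultimately show ?thesis
    unfolding topspace_def by blast
qed

lemma closedin_zariski_iff:
  "closedin (zariski I) Z \<longleftrightarrow> (\<exists>S \<subseteq> hom_polys I. Z = zero_locus I S)"
proof -
  have *: "zero_locus I S \<subseteq> proj_space I" for S by (auto simp: zero_locus_def)
  show ?thesis
  proof
    assume "closedin (zariski I) Z"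
    then obtain S where "Z \<subseteq> proj_space I" "S \<subseteq> hom_polys I"
      "proj_space I - Z = proj_space I - zero_locus I S"
      unfolding closedin_def openin_zariski_iff topspace_zariski by blast
    moreover from this have "Z = zero_locus I S" using *[of S] by blast
    ultimately show "\<exists>S \<subseteq> hom_polys I. Z = zero_locus I S" by blast
  next
    assume "\<exists>S \<subseteq> hom_polys I. Z = zero_locus I S"
    then show "closedin (zariski I) Z"
      unfolding closedin_def openin_zariski_iff topspace_zariski using * by blast
  qed
qed


section \<open>Dimension\<close>

definition irreducible_space :: "'a topology \<Rightarrow> bool" where
  "irreducible_space T \<longleftrightarrow> topspace T \<noteq> {} \<and>
     (\<forall>A B. closedin T A \<and> closedin T B \<and> A \<union> B = topspace T
        \<longrightarrow> A = topspace T \<or> B = topspace T)"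

definition irreduciblein :: "'a topology \<Rightarrow> 'a set \<Rightarrow> bool" where
  "irreduciblein T Z \<longleftrightarrow> Z \<subseteq> topspace T \<and> irreducible_space (subtopology T Z)"

text \<open>
  The Krull dimension of a topological space; by \<open>Sup {} = 0\<close> in \<^typ>\<open>enat\<close>, the empty space has
  dimension \<open>0\<close> here.
\<close>

definition krull_dim :: "'a topology \<Rightarrow> enat" where
  "krull_dim T = Sup {enat k |k. \<exists>Z.
     (\<forall>i\<le>k. closedin T (Z i) \<and> irreduciblein T (Z i)) \<and> (\<forall>i<k. Z i \<subset> Z (Suc i))}"

definition proj_dim :: "'i set \<Rightarrow> 'i point set \<Rightarrow> enat" where
  "proj_dim I X = krull_dim (subtopology (zariski I) X)"


section \<open>Secant varieties and defectivity\<close>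

definition secant :: "'i set \<Rightarrow> nat \<Rightarrow> 'i point set \<Rightarrow> 'i point set" where
  "secant I h X =
     zariski I closure_of (\<Union>{lin_span I S |S. S \<subseteq> X \<and> finite S \<and> card S = h})"

text \<open>
  The subtraction in \<open>h dim X + h - 1\<close> is truncated only for \<open>h = 0\<close>, where the secant variety is
  empty; in that case the condition below is false, in accordance with \<open>-1 < -1\<close> being false.
\<close>

definition defective :: "'i set \<Rightarrow> 'i point set \<Rightarrow> nat \<Rightarrow> bool" where
  "defective I X h \<longleftrightarrow>
     proj_dim I (secant I h X) < min (enat h * proj_dim I X + enat h - 1) (enat (card I - 1))"


section \<open>Segre-Veronese varieties\<close>

text \<open>
  The monomials \<open>\<Prod>i. \<Prod>j. x\<^sub>i\<^sub>j ^ a i j\<close> with exponents \<open>a \<in> multi_exps r n d\<close> form a basis of the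
  forms of multidegree \<open>d\<close> on the product of the projective spaces with homogeneous coordinates
  \<open>x\<^sub>i\<^sub>0, \<dots>, x\<^sub>i\<^sub>n\<^sub>i\<close> for \<open>i = 1, \<dots>, r\<close>, i.e. of the global sections of \<open>O(d\<^sub>1, \<dots>, d\<^sub>r)\<close>.
\<close>

definition multi_exps :: "nat \<Rightarrow> (nat \<Rightarrow> nat) \<Rightarrow> (nat \<Rightarrow> nat) \<Rightarrow> (nat \<Rightarrow> nat \<Rightarrow> nat) set" where
  "multi_exps r n d = {a. (\<forall>i j. \<not> (i \<in> {1..r} \<and> j \<in> {0..n i}) \<longrightarrow> a i j = 0) \<and>
     (\<forall>i\<in>{1..r}. (\<Sum>j=0..n i. a i j) = d i)}"

definition sv_vec :: "nat \<Rightarrow> (nat \<Rightarrow> nat) \<Rightarrow> (nat \<Rightarrow> nat) \<Rightarrow> (nat \<Rightarrow> nat \<Rightarrow> complex)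
    \<Rightarrow> (nat \<Rightarrow> nat \<Rightarrow> nat) \<Rightarrow> complex" where
  "sv_vec r n d x a =
     (if a \<in> multi_exps r n d then \<Prod>i=1..r. \<Prod>j=0..n i. x i j ^ a i j else 0)"

text \<open>
  A point of the product is given by representatives \<open>x i\<close> of its components in
  \<open>proj_space {0..n i}\<close>; rescaling them only rescales \<open>sv_vec r n d x\<close>.
\<close>

definition segre_veronese ::
    "nat \<Rightarrow> (nat \<Rightarrow> nat) \<Rightarrow> (nat \<Rightarrow> nat) \<Rightarrow> (nat \<Rightarrow> nat \<Rightarrow> nat) point set" where
  "segre_veronese r n d =
     {pt (sv_vec r n d x) |x. \<forall>i\<in>{1..r}. x i \<in> cvecs {0..n i} - {0}}"

end

theory Submission
  imports Defs "HOL-Computational_Algebra.Polynomial"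
begin

text \<open>
  Write \<open>N = n\<^sub>1\<close> and \<open>D = d\<^sub>1 + \<dots> + d\<^sub>r\<close>. The proof reduces the dimension of the secant variety to an
  interpolation problem for forms of degree \<open>D\<close> in \<open>N + 1\<close> variables and solves that problem.

  \<^emph>\<open>From dimension to interpolation.\<close> The dimension is a Krull dimension, i.e. it is defined by chains of
  irreducible closed sets, and it is compared with numbers of independent forms. A chain of length
  \<open>k\<close> produces \<open>(e + 1)\<^sup>k\<close> independent forms of degree \<open>K e\<close> on its largest member (\<open>chain_forms\<close>), and
  the Segre-Veronese variety does not carry more of them than a polynomial in \<open>e\<close> of degree
  \<open>n\<^sub>1 + \<dots> + n\<^sub>r\<close> allows (\<open>proj_dim_segre_veronese_le\<close>). Conversely, a polynomial map whose derivative
  at a point is injective has an image whose closure is of at least the dimension of its domain: the images of the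
  coordinate subspaces have closures that form a strict chain, again by a count of monomials
  (\<open>proj_dim_ge\<close>). For the natural parametrisation of the secant variety this is one half of
  Terracini's lemma (\<open>secant_dim_ge\<close>): the dimension is as large as expected if multiforms of
  multidegree \<open>d\<close> can be prescribed, at \<open>h\<close> points, their values and their derivatives in all
  directions except one for each factor, where Euler's relation leaves no choice.

  \<^emph>\<open>From the product to projective space.\<close> The \<open>h\<close> points are taken on the diagonal of \<open>\<P>\<^sup>N\<close> in the
  product. A multiform restricts to a form of degree \<open>D\<close> on the diagonal, and the sum over the factors
  of its partial derivatives is the gradient of this form. How the gradient is distributed over the
  factors can be changed at will by adding multiforms that vanish on the diagonal, namely products of
  forms of degree \<open>D - 2\<close> with \<open>2 \<times> 2\<close> minors (\<open>diagonal_interpolation\<close>). So it is enough to find \<open>h\<close>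
  points of \<open>\<P>\<^sup>N\<close> at which forms of degree \<open>D\<close> have arbitrary gradients (\<open>gradients_indep N D h\<close>) and forms of
  degree \<open>D - 2\<close> have arbitrary values.

  \<^emph>\<open>The interpolation problem.\<close> With \<open>m = 2\<^bsup>\<lambda>\<^sub>1-1\<^esup> + \<dots> + 2\<^bsup>\<lambda>\<^sub>s-1\<^esup>\<close> the degree \<open>D\<close> is \<open>2 m + 1\<close> or \<open>2 m + 2\<close>, and
  the bound of the theorem is \<open>N S + 1\<close>, where \<open>S\<close> arises when the binary digits of \<open>m\<close> are read
  in base \<open>N + 1\<close> (\<open>rebase\<close>). A point \<open>q\<close> can be added to points with arbitrary gradients when some
  form \<open>G\<close> of degree \<open>D - 1\<close> is singular at them and does not vanish at \<open>q\<close>, because the products of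
  \<open>G\<close> with linear forms then correct the gradient at \<open>q\<close> (\<open>jets_insert_point\<close>). Such a \<open>G\<close> exists if the
  forms of degree \<open>D - 1\<close> outnumber the conditions, or as the square of a form of half the degree. An
  induction over the binary digits of \<open>m\<close> shows that this reaches the bound, except when \<open>N \<ge> 2\<close>
  and \<open>D = 5\<close>, when \<open>2 \<le> N \<le> 4\<close> and \<open>D = 9\<close>, and when \<open>N = 2\<close> and \<open>D = 17\<close>. There the form is written as a polynomial in
  one variable, and a degeneration by a torus sends each point to one of its coefficients, which
  leaves interpolation problems with one variable fewer (\<open>jets_of_layers\<close>).

  \<^emph>\<open>The exception.\<close> For \<open>N = 2\<close>, \<open>D = 9\<close>, \<open>h = 19\<close> the gradients at \<open>19\<close> points of the plane would be \<open>57\<close>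
  conditions on the \<open>55\<close> monomials of degree \<open>9\<close>. If \<open>r = 1\<close> the secant variety only has to fill \<open>\<P>\<^sup>5\<^sup>4\<close>,
  and if \<open>r \<ge> 2\<close> the nineteenth point can be chosen off the diagonal.
\<close>

section \<open>Linear algebra\<close>

text \<open>
  The determinant of such a matrix is a polynomial in \<open>t\<close> with constant term \<open>1\<close>. So a linear system
  that is solvable in the limit \<open>t = 0\<close> of a degeneration is solvable for almost all \<open>t\<close>.
\<close>

lemma poly_matrix_invertible_cofinite:
  fixes A :: "'m \<Rightarrow> 'm \<Rightarrow> complex poly"
  assumes "finite M"
    and "\<And>m m'. m \<in> M \<Longrightarrow> m' \<in> M \<Longrightarrow> poly (A m m') 0 = (if m = m' then 1 else 0)"
  shows "finite {t. \<not> (\<forall>b. \<exists>x. \<forall>m\<in>M. (\<Sum>m'\<in>M. poly (A m m') t * x m') = b m)}"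
  using assms
proof (induction M arbitrary: A rule: finite_induct)
  case empty
  then show ?case by simp
next
  case (insert k M)
  define B where "B m m' = A k k * A m m' - A m k * A k m'" for m m'
  have B0: "poly (B m m') 0 = (if m = m' then 1 else 0)" if "m \<in> M" "m' \<in> M" for m m'
    using that insert.hyps insert.prems by (auto simp: B_def)
  have fin1: "finite {t. \<not> (\<forall>b. \<exists>x. \<forall>m\<in>M. (\<Sum>m'\<in>M. poly (B m m') t * x m') = b m)}"
    by (rule insert.IH[OF B0])
  have "A k k \<noteq> 0"
    using insert.prems[of k k] by auto
  then have fin2: "finite {t. poly (A k k) t = 0}"
    by (rule poly_roots_finite)
  have "\<exists>x. \<forall>m\<in>insert k M. (\<Sum>m'\<in>insert k M. poly (A m m') t * x m') = b m"
    if t: "poly (A k k) t \<noteq> 0"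
      and sol: "\<forall>b. \<exists>x. \<forall>m\<in>M. (\<Sum>m'\<in>M. poly (B m m') t * x m') = b m" for t b
  proof -
    let ?a = "poly (A k k) t"
    obtain x where x: "\<forall>m\<in>M. (\<Sum>m'\<in>M. poly (B m m') t * x m') = ?a * b m - poly (A m k) t * b k"
      using spec[OF sol, of "\<lambda>m. ?a * b m - poly (A m k) t * b k"] by blast
    define s where "s = (\<Sum>m'\<in>M. poly (A k m') t * x m')"
    define y where "y = x(k := (b k - s) / ?a)"
    have sumy: "(\<Sum>m'\<in>insert k M. poly (A m m') t * y m')
        = poly (A m k) t * ((b k - s) / ?a) + (\<Sum>m'\<in>M. poly (A m m') t * x m')" for m
    proof -
      have "(\<Sum>m'\<in>M. poly (A m m') t * y m') = (\<Sum>m'\<in>M. poly (A m m') t * x m')"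
        using insert.hyps by (intro sum.cong) (auto simp: y_def)
      then show ?thesis using insert.hyps by (simp add: y_def)
    qed
    have "(\<Sum>m'\<in>insert k M. poly (A m m') t * y m') = b m" if "m \<in> insert k M" for m
    proof (cases "m = k")
      case True
      then show ?thesis using t unfolding sumy True s_def[symmetric] by simp
    next
      case False
      with that have m: "m \<in> M" by simp
      define z where "z = (\<Sum>m'\<in>M. poly (A m m') t * x m')"
      have "(\<Sum>m'\<in>M. poly (B m m') t * x m') = ?a * z - poly (A m k) t * s"
        unfolding z_def s_def sum_distrib_left sum_subtractf[symmetric]
        by (intro sum.cong) (auto simp: B_def algebra_simps)
      then have "?a * z - poly (A m k) t * s = ?a * b m - poly (A m k) t * b k"
        using bspec[OF x m] by simp
      then have "?a * (poly (A m k) t * ((b k - s) / ?a) + z) = ?a * b m"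
        using t by (simp add: field_simps)
      then have "poly (A m k) t * ((b k - s) / ?a) + z = b m"
        using t by (metis mult_left_cancel)
      then show ?thesis unfolding sumy z_def[symmetric] .
    qed
    then show ?thesis by blast
  qed
  then have "{t. \<not> (\<forall>b. \<exists>x. \<forall>m\<in>insert k M. (\<Sum>m'\<in>insert k M. poly (A m m') t * x m') = b m)}
     \<subseteq> {t. \<not> (\<forall>b. \<exists>x. \<forall>m\<in>M. (\<Sum>m'\<in>M. poly (B m m') t * x m') = b m)} \<union> {t. poly (A k k) t = 0}"
    by blast
  then show ?case
    using finite_subset[OF _ finite_UnI[OF fin1 fin2]] by blast
qed

lemma sum_apply: "(\<Sum>a\<in>A. f a) x = (\<Sum>a\<in>A. f a x)"
  by (induction A rule: infinite_finite_induct) auto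

lemma dependent_of_card_less:
  fixes g :: "'a \<Rightarrow> 'x \<Rightarrow> complex"
  assumes "finite A" "finite T" "card T < card A" "\<And>a. a \<in> A \<Longrightarrow> g a \<in> cvec.span T"
  shows "\<exists>c. (\<exists>a\<in>A. c a \<noteq> 0) \<and> (\<forall>x. (\<Sum>a\<in>A. c a * g a x) = 0)"
proof (cases "inj_on g A")
  case False
  then obtain a b where ab: "a \<in> A" "b \<in> A" "a \<noteq> b" "g a = g b"
    by (auto simp: inj_on_def)
  define c where "c y = (if y = a then 1 else if y = b then -1 else (0::complex))" for y
  have "(\<Sum>y\<in>A. c y * g y x) = 0" for x
  proof -
    have "(\<Sum>y\<in>A. c y * g y x) = (\<Sum>y\<in>{a, b}. c y * g y x)"
      using assms(1) ab by (intro sum.mono_neutral_right) (auto simp: c_def)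
    then show ?thesis using ab by (simp add: c_def)
  qed
  moreover have "c a \<noteq> 0" by (simp add: c_def)
  ultimately show ?thesis using ab by blast
next
  case True
  have "cvec.dependent (g ` A)"
  proof (rule ccontr)
    assume "\<not> cvec.dependent (g ` A)"
    moreover have "g ` A \<subseteq> cvec.span T" using assms(4) by blast
    ultimately have "card (g ` A) \<le> card T"
      using cvec.independent_span_bound[OF assms(2)] by blast
    then show False using assms(3) card_image[OF True] by simp
  qed
  then obtain u where u: "\<exists>v\<in>g ` A. u v \<noteq> 0" "(\<Sum>v\<in>g ` A. (\<lambda>i. u v * v i)) = 0"
    using cvec.dependent_finite[of "g ` A"] assms(1) by blast
  have "(\<Sum>a\<in>A. u (g a) * g a x) = 0" for x
  proof -
    have "(\<Sum>a\<in>A. u (g a) * g a x) = (\<Sum>v\<in>g ` A. u v * v x)"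
      by (simp add: sum.reindex[OF True])
    also have "\<dots> = (\<Sum>v\<in>g ` A. (\<lambda>i. u v * v i)) x"
      by (simp add: sum_apply)
    finally show ?thesis by (simp add: u(2))
  qed
  then show ?thesis using u(1) by (intro exI[of _ "\<lambda>a. u (g a)"]) auto
qed

section \<open>Polynomial functions\<close>

text \<open>
  Polynomials are represented by the functions that they define, which is faithful over the complex
  numbers and gives values and derivatives without a detour through coefficients.
\<close>

inductive_set polyfun :: "'v set \<Rightarrow> (('v \<Rightarrow> complex) \<Rightarrow> complex) set" for V where
  const: "(\<lambda>x. c) \<in> polyfun V"
| var: "v \<in> V \<Longrightarrow> (\<lambda>x. x v) \<in> polyfun V"
| add: "F \<in> polyfun V \<Longrightarrow> G \<in> polyfun V \<Longrightarrow> (\<lambda>x. F x + G x) \<in> polyfun V"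
| mult: "F \<in> polyfun V \<Longrightarrow> G \<in> polyfun V \<Longrightarrow> (\<lambda>x. F x * G x) \<in> polyfun V"

lemma polyfun_sum: "(\<And>a. a \<in> A \<Longrightarrow> F a \<in> polyfun V) \<Longrightarrow> (\<lambda>x. \<Sum>a\<in>A. F a x) \<in> polyfun V"
  by (induction A rule: infinite_finite_induct) (auto intro: polyfun.intros)

lemma polyfun_prod: "(\<And>a. a \<in> A \<Longrightarrow> F a \<in> polyfun V) \<Longrightarrow> (\<lambda>x. \<Prod>a\<in>A. F a x) \<in> polyfun V"
  by (induction A rule: infinite_finite_induct) (auto intro: polyfun.intros)

lemma polyfun_power: "F \<in> polyfun V \<Longrightarrow> (\<lambda>x. F x ^ k) \<in> polyfun V"
  by (induction k) (auto intro: polyfun.intros)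

lemma polyfun_mono: "F \<in> polyfun V \<Longrightarrow> V \<subseteq> W \<Longrightarrow> F \<in> polyfun W"
  by (induction rule: polyfun.induct) (auto intro: polyfun.intros)

lemma polyfun_comp:
  assumes "F \<in> polyfun V" "\<And>v. v \<in> V \<Longrightarrow> (\<lambda>x. f x v) \<in> polyfun W"
  shows "(\<lambda>x. F (f x)) \<in> polyfun W"
  using assms(1) by induction (auto intro: polyfun.intros assms(2))

lemma polyfun_local:
  assumes "F \<in> polyfun V" "\<And>v. v \<in> V \<Longrightarrow> x v = y v"
  shows "F x = F y"
  using assms(1) by induction (auto simp: assms(2))

text \<open>
  The partial derivative with respect to the coordinate \<open>v\<close>; only polynomial functions are differentiated, so
  the description always denotes the derivative.
\<close>

definition pd :: "'v \<Rightarrow> (('v \<Rightarrow> complex) \<Rightarrow> complex) \<Rightarrow> ('v \<Rightarrow> complex) \<Rightarrow> complex" where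
  "pd v F x = (THE D. ((\<lambda>t. F (x(v := t))) has_field_derivative D) (at (x v)))"

lemma pd_eqI: "((\<lambda>t. F (x(v := t))) has_field_derivative D) (at (x v)) \<Longrightarrow> pd v F x = D"
  unfolding pd_def by (blast intro: DERIV_unique)

lemma pd_const [simp]: "pd v (\<lambda>x. c) x = 0"
  by (rule pd_eqI) simp

lemma pd_var: "pd v (\<lambda>x. x w) x = (if v = w then 1 else 0)"
  by (rule pd_eqI) (auto simp: fun_upd_def)

lemma polyfun_has_pd:
  assumes "F \<in> polyfun V"
  shows "((\<lambda>t. F (x(v := t))) has_field_derivative pd v F x) (at (x v))"
proof -
  have "\<exists>D. ((\<lambda>t. F (x(v := t))) has_field_derivative D) (at (x v))"
    using assms
  proof induction
    case (const c)
    then show ?case by (auto intro: exI[of _ 0])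
  next
    case (var w)
    show ?case by (rule exI[of _ "if v = w then 1 else 0"]) (auto simp: fun_upd_def)
  next
    case (add F G)
    then obtain D E where "((\<lambda>t. F (x(v := t))) has_field_derivative D) (at (x v))"
      "((\<lambda>t. G (x(v := t))) has_field_derivative E) (at (x v))"
      by (auto simp del: fun_upd_apply)
    then show ?case by (intro exI, rule DERIV_add)
  next
    case (mult F G)
    then obtain D E where "((\<lambda>t. F (x(v := t))) has_field_derivative D) (at (x v))"
      "((\<lambda>t. G (x(v := t))) has_field_derivative E) (at (x v))"
      by (auto simp del: fun_upd_apply)
    then show ?case by (intro exI, rule DERIV_mult)
  qed
  then obtain D where D: "((\<lambda>t. F (x(v := t))) has_field_derivative D) (at (x v))" by (elim exE)
  show ?thesis unfolding pd_eqI[OF D] by (rule D)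
qed

lemma pd_add: "F \<in> polyfun V \<Longrightarrow> G \<in> polyfun W \<Longrightarrow> pd v (\<lambda>x. F x + G x) x = pd v F x + pd v G x"
  by (intro pd_eqI DERIV_add polyfun_has_pd)

lemma pd_mult:
  assumes "F \<in> polyfun V" "G \<in> polyfun W"
  shows "pd v (\<lambda>x. F x * G x) x = pd v F x * G x + F x * pd v G x"
  using DERIV_mult[OF polyfun_has_pd[OF assms(1), of x v] polyfun_has_pd[OF assms(2), of x v]]
  by (intro pd_eqI) (simp add: algebra_simps)

lemma pd_cmult: "F \<in> polyfun V \<Longrightarrow> pd v (\<lambda>x. c * F x) x = c * pd v F x"
  using pd_mult[OF polyfun.const[of c V]] by fastforce

lemma pd_sum:
  "(\<And>a. a \<in> A \<Longrightarrow> F a \<in> polyfun V) \<Longrightarrow> pd v (\<lambda>x. \<Sum>a\<in>A. F a x) x = (\<Sum>a\<in>A. pd v (F a) x)"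
proof (induction A rule: infinite_finite_induct)
  case (insert a A)
  then show ?case using pd_add[of "F a" V "\<lambda>x. \<Sum>a\<in>A. F a x" V] by (simp add: polyfun_sum)
qed auto

lemma pd_outside: "F \<in> polyfun V \<Longrightarrow> v \<notin> V \<Longrightarrow> pd v F x = 0"
  by (induction rule: polyfun.induct) (auto simp: pd_add pd_mult pd_var)

lemma polyfun_pd: "F \<in> polyfun V \<Longrightarrow> pd v F \<in> polyfun V"
proof (induction rule: polyfun.induct)
  case (const c)
  have "pd v (\<lambda>x. c) = (\<lambda>x. 0)" by (rule ext) simp
  then show ?case by (simp add: polyfun.const)
next
  case (var w)
  have "pd v (\<lambda>x. x w) = (\<lambda>x. if v = w then 1 else 0)" by (rule ext) (simp add: pd_var)
  then show ?case by (simp add: polyfun.const)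
next
  case (add F G)
  then have "pd v (\<lambda>x. F x + G x) = (\<lambda>x. pd v F x + pd v G x)" by (intro ext pd_add)
  then show ?case using add by (simp add: polyfun.add)
next
  case (mult F G)
  then have "pd v (\<lambda>x. F x * G x) = (\<lambda>x. pd v F x * G x + F x * pd v G x)" by (intro ext pd_mult)
  then show ?case using mult by (simp add: polyfun.intros)
qed

lemma polyfun_line:
  assumes "F \<in> polyfun V" "finite V"
  shows "\<exists>p. (\<forall>t. F (\<lambda>v. x v + t * w v) = poly p t) \<and> coeff p 1 = (\<Sum>v\<in>V. w v * pd v F x)"
  using assms(1)
proof induction
  case (const c)
  show ?case by (rule exI[of _ "[:c:]"]) simp
next
  case (var v)
  then show ?case using assms(2)
    by (intro exI[of _ "[:x v, w v:]"]) (auto simp: pd_var if_distrib cong: if_cong)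
next
  case (add F G)
  then obtain p q where "\<forall>t. F (\<lambda>v. x v + t * w v) = poly p t" "coeff p 1 = (\<Sum>v\<in>V. w v * pd v F x)"
     "\<forall>t. G (\<lambda>v. x v + t * w v) = poly q t" "coeff q 1 = (\<Sum>v\<in>V. w v * pd v G x)" by blast
  then show ?case using add.hyps
    by (intro exI[of _ "p + q"]) (simp add: pd_add algebra_simps sum.distrib)
next
  case (mult F G)
  then obtain p q where pq: "\<forall>t. F (\<lambda>v. x v + t * w v) = poly p t" "coeff p 1 = (\<Sum>v\<in>V. w v * pd v F x)"
     "\<forall>t. G (\<lambda>v. x v + t * w v) = poly q t" "coeff q 1 = (\<Sum>v\<in>V. w v * pd v G x)" by blast
  have "F x = coeff p 0" "G x = coeff q 0"
    using spec[OF pq(1), of 0] spec[OF pq(3), of 0] by (simp_all add: poly_0_coeff_0)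
  moreover have "coeff (p * q) 1 = coeff p 0 * coeff q 1 + coeff p 1 * coeff q 0"
    by (simp add: coeff_mult)
  ultimately have "coeff (p * q) 1 = (\<Sum>v\<in>V. w v * pd v (\<lambda>x. F x * G x) x)"
    using mult.hyps pq by (simp add: pd_mult algebra_simps sum.distrib sum_distrib_left)
  then show ?case using pq by (intro exI[of _ "p * q"]) simp
qed

lemma polyfun_line':
  assumes "F \<in> polyfun V"
  shows "\<exists>p. \<forall>t. F (\<lambda>v. x v + t * w v) = poly p t"
  using assms
proof induction
  case (const c)
  show ?case by (rule exI[of _ "[:c:]"]) simp
next
  case (var v)
  show ?case by (intro exI[of _ "[:x v, w v:]"]) simp
next
  case (add F G)
  then show ?case by (metis poly_add)
next
  case (mult F G)
  then show ?case by (metis poly_mult)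
qed

lemma polyfun_line_nonzero:
  assumes "F \<in> polyfun V" "F x \<noteq> 0"
  shows "finite {t. F (\<lambda>v. x v + t * (y v - x v)) = 0}"
proof -
  obtain p where p: "\<And>t. F (\<lambda>v. x v + t * (y v - x v)) = poly p t"
    using polyfun_line'[OF assms(1), of x "\<lambda>v. y v - x v"] by auto
  have "p \<noteq> 0" using p[of 0] assms(2) by auto
  then show ?thesis unfolding p by (rule poly_roots_finite)
qed

text \<open>
  Both non-vanishing sets are dense on the line through \<open>x\<close> and \<open>y\<close>, so they meet on it. The explicit point on
  the line matters: it stays in every linear subspace that contains \<open>x\<close> and \<open>y\<close>.
\<close>

lemma polyfun_common_nonzero:
  assumes "F \<in> polyfun V" "G \<in> polyfun W" "F x \<noteq> 0" "G y \<noteq> 0"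
  shows "\<exists>t. F (\<lambda>v. x v + t * (y v - x v)) \<noteq> 0 \<and> G (\<lambda>v. x v + t * (y v - x v)) \<noteq> 0"
proof -
  have fin1: "finite {t. F (\<lambda>v. x v + t * (y v - x v)) = 0}"
    using polyfun_line_nonzero[of F V x y] assms by blast
  have "finite {t. G (\<lambda>v. y v + t * (x v - y v)) = 0}"
    using polyfun_line_nonzero[of G W y x] assms by blast
  then have "finite ((\<lambda>t. 1 - t) ` {t. G (\<lambda>v. y v + t * (x v - y v)) = 0})" by simp
  moreover have "{t. G (\<lambda>v. x v + t * (y v - x v)) = 0} \<subseteq> (\<lambda>t. 1 - t) ` {t. G (\<lambda>v. y v + t * (x v - y v)) = 0}"
  proof
    fix t assume t: "t \<in> {t. G (\<lambda>v. x v + t * (y v - x v)) = 0}"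
    have "(\<lambda>v. y v + (1 - t) * (x v - y v)) = (\<lambda>v. x v + t * (y v - x v))"
      by (simp add: fun_eq_iff algebra_simps)
    then have "1 - t \<in> {t. G (\<lambda>v. y v + t * (x v - y v)) = 0}" using t by simp
    then show "t \<in> (\<lambda>t. 1 - t) ` {t. G (\<lambda>v. y v + t * (x v - y v)) = 0}"
      by (intro image_eqI[of _ _ "1 - t"]) auto
  qed
  ultimately have "finite ({t. F (\<lambda>v. x v + t * (y v - x v)) = 0} \<union> {t. G (\<lambda>v. x v + t * (y v - x v)) = 0})"
    using fin1 finite_subset by blast
  then obtain t where "t \<notin> {t. F (\<lambda>v. x v + t * (y v - x v)) = 0} \<union> {t. G (\<lambda>v. x v + t * (y v - x v)) = 0}"
    using ex_new_if_finite[OF infinite_UNIV_char_0] by blast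
  then show ?thesis by blast
qed

section \<open>Graded forms\<close>

text \<open>
  Forms that are homogeneous for a grading \<open>dg\<close> of the variables by a commutative monoid: by \<open>nat\<close> for
  ordinary forms, by functions into \<open>nat\<close> for multiforms.
\<close>

inductive gform :: "('v \<Rightarrow> 'g::comm_monoid_add) \<Rightarrow> 'v set \<Rightarrow> 'g \<Rightarrow> (('v \<Rightarrow> complex) \<Rightarrow> complex) \<Rightarrow> bool"
  for dg V where
  const: "gform dg V 0 (\<lambda>x. c)"
| var: "v \<in> V \<Longrightarrow> gform dg V (dg v) (\<lambda>x. x v)"
| add: "gform dg V g F \<Longrightarrow> gform dg V g G \<Longrightarrow> gform dg V g (\<lambda>x. F x + G x)"
| mult: "gform dg V g F \<Longrightarrow> gform dg V h G \<Longrightarrow> gform dg V (g + h) (\<lambda>x. F x * G x)"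

lemma gform_polyfun: "gform dg V g F \<Longrightarrow> F \<in> polyfun V"
  by (induction rule: gform.induct) (auto intro: polyfun.intros)

lemma gform_mono: "gform dg V g F \<Longrightarrow> V \<subseteq> W \<Longrightarrow> gform dg W g F"
  by (induction rule: gform.induct) (auto intro: gform.intros)

lemma gform_cmult: "gform dg V g F \<Longrightarrow> gform dg V g (\<lambda>x. c * F x)"
  using gform.mult[OF gform.const, of dg V g F c] by simp

lemma gform_minus: "gform dg V g F \<Longrightarrow> gform dg V g G \<Longrightarrow> gform dg V g (\<lambda>x. F x - G x)"
  using gform.add[OF _ gform_cmult[of dg V g G "-1"], of F] by simp

lemma gform_sum:
  assumes "gform dg V g H" "\<And>a. a \<in> A \<Longrightarrow> gform dg V g (F a)"
  shows "gform dg V g (\<lambda>x. \<Sum>a\<in>A. F a x)"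
proof -
  have z: "gform dg V g (\<lambda>x. 0)" using gform_cmult[OF assms(1), of 0] by simp
  show ?thesis using assms(2)
    by (induction A rule: infinite_finite_induct) (auto intro: gform.add z)
qed

lemma gform_prod:
  "(\<And>a. a \<in> A \<Longrightarrow> gform dg V (g a) (F a)) \<Longrightarrow> gform dg V (\<Sum>a\<in>A. g a) (\<lambda>x. \<Prod>a\<in>A. F a x)"
  by (induction A rule: infinite_finite_induct) (auto intro: gform.intros)

text \<open>
  Euler's relation for every additive function \<open>\<omega>\<close> of the degree; for multiforms, evaluation of the
  multidegree at a factor gives one relation per factor.
\<close>

lemma gform_euler:
  fixes \<omega> :: "'g::comm_monoid_add \<Rightarrow> nat"
  assumes "gform dg V g F" "finite V" "\<omega> 0 = 0" "\<And>a b. \<omega> (a + b) = \<omega> a + \<omega> b"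
  shows "(\<Sum>v\<in>V. of_nat (\<omega> (dg v)) * x v * pd v F x) = of_nat (\<omega> g) * F x"
  using assms(1)
proof induction
  case (const c)
  then show ?case by (simp add: assms(3))
next
  case (var v)
  then show ?case using assms(2) by (simp add: pd_var if_distrib cong: if_cong)
next
  case (add g F G)
  then show ?case
    by (simp add: pd_add[OF gform_polyfun gform_polyfun] algebra_simps sum.distrib)
next
  case (mult g F h G)
  have "(\<Sum>v\<in>V. of_nat (\<omega> (dg v)) * x v * pd v (\<lambda>x. F x * G x) x)
     = (\<Sum>v\<in>V. of_nat (\<omega> (dg v)) * x v * pd v F x) * G x + F x * (\<Sum>v\<in>V. of_nat (\<omega> (dg v)) * x v * pd v G x)"
    by (simp add: pd_mult[OF gform_polyfun[OF mult.hyps(1)] gform_polyfun[OF mult.hyps(2)]]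
      sum_distrib_left sum_distrib_right sum.distrib algebra_simps)
  then show ?case unfolding mult.IH by (simp add: assms(4) algebra_simps)
qed

section \<open>Independence of monomials\<close>

definition mon :: "'v set \<Rightarrow> ('v \<Rightarrow> nat) \<Rightarrow> ('v \<Rightarrow> complex) \<Rightarrow> complex" where
  "mon V a x = (\<Prod>v\<in>V. x v ^ a v)"

lemma gform_power: "gform dg V g F \<Longrightarrow> gform dg V (\<Sum>i<k. g) (\<lambda>x. F x ^ k)"
  using gform_prod[of "{..<k}" dg V "\<lambda>_. g" "\<lambda>_. F"] by simp

lemma mon_gform: "finite V \<Longrightarrow> gform dg V (\<Sum>v\<in>V. \<Sum>i<a v. dg v) (mon V a)"
  unfolding mon_def by (intro gform_prod gform_power gform.var)

lemma mon_independent: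
  assumes "finite V" "finite A" "\<And>a v. a \<in> A \<Longrightarrow> v \<notin> V \<Longrightarrow> a v = 0"
    and "\<And>x. (\<Sum>a\<in>A. c a * mon V a x) = 0" "a \<in> A"
  shows "c a = 0"
  using assms
proof (induction V arbitrary: A c a rule: finite_induct)
  case empty
  have "b = a" if "b \<in> A" for b
    using empty.prems(2)[OF that] empty.prems(2)[OF empty.prems(4)] by (auto simp: fun_eq_iff)
  then have "A = {a}" using empty.prems(4) by blast
  then show ?case using empty.prems(3) by (simp add: mon_def)
next
  case (insert v V)
  define B where "B k = {b \<in> A. b v = k}" for k
  define c' where "c' k b = c (b(v := k))" for k b
  define N where "N = Max ((\<lambda>b. b v) ` A)"
  have N: "b v \<le> N" if "b \<in> A" for b
    unfolding N_def using insert.prems(1) that by simp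
  define k where "k = a v"
  have sum0: "(\<Sum>b\<in>B j. c b * mon V b x) = 0" if j: "j \<le> N" for j x
  proof -
    define p where "p = (\<Sum>i\<le>N. Polynomial.monom (\<Sum>b\<in>B i. c b * mon V b x) i)"
    have "poly p s = 0" for s
    proof -
      have "mon (insert v V) b (x(v := s)) = s ^ b v * mon V b x" for b
      proof -
        have "(\<Prod>w\<in>V. (x(v := s)) w ^ b w) = (\<Prod>w\<in>V. x w ^ b w)"
          using insert.hyps by (intro prod.cong) auto
        then show ?thesis using insert.hyps by (simp add: mon_def)
      qed
      then have "(\<Sum>b\<in>A. c b * (s ^ b v * mon V b x)) = 0"
        using insert.prems(3)[of "x(v := s)"] by (simp del: fun_upd_apply)
      moreover have "(\<Sum>b\<in>A. c b * (s ^ b v * mon V b x))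
          = (\<Sum>i\<le>N. \<Sum>b\<in>{b \<in> A. b v = i}. c b * (s ^ b v * mon V b x))"
        using N insert.prems(1) by (intro sum.group[symmetric]) auto
      moreover have "\<dots> = (\<Sum>i\<le>N. s ^ i * (\<Sum>b\<in>B i. c b * mon V b x))"
        unfolding sum_distrib_left B_def by (intro sum.cong) auto
      ultimately show ?thesis
        by (simp add: p_def poly_sum poly_monom mult.commute)
    qed
    then have "p = 0" using poly_all_0_iff_0 by blast
    then have "coeff p j = 0" by simp
    then show ?thesis using j by (simp add: p_def coeff_sum if_distrib cong: if_cong)
  qed
  let ?A = "(\<lambda>b. b(v := 0)) ` B k"
  have inj: "inj_on (\<lambda>b. b(v := 0)) (B k)"
  proof (rule inj_onI)
    fix b b' assume *: "b \<in> B k" "b' \<in> B k" "b(v := 0) = b'(v := 0)"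
    have "b = (b(v := 0))(v := k)" "b' = (b'(v := 0))(v := k)" using *(1,2) by (auto simp: B_def)
    then show "b = b'" using *(3) by metis
  qed
  have "c' k (a(v := 0)) = 0"
  proof (rule insert.IH[of ?A])
    show "finite ?A" using insert.prems(1) by (simp add: B_def)
    show "b w = 0" if "b \<in> ?A" "w \<notin> V" for b w
      using that insert.prems(2) by (auto simp: B_def)
    show "a(v := 0) \<in> ?A" using insert.prems(4) by (simp add: B_def k_def)
    fix x
    have "(\<Sum>b\<in>?A. c' k b * mon V b x) = (\<Sum>b\<in>B k. c b * mon V b x)"
      unfolding sum.reindex[OF inj] o_def
    proof (rule sum.cong)
      fix b assume b: "b \<in> B k"
      have "mon V (b(v := 0)) x = mon V b x"
        unfolding mon_def using insert.hyps by (intro prod.cong) auto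
      moreover have "b(v := k) = b" using b by (auto simp: B_def)
      ultimately show "c' k (b(v := 0)) * mon V (b(v := 0)) x = c b * mon V b x"
        by (simp add: c'_def)
    qed simp
    then show "(\<Sum>b\<in>?A. c' k b * mon V b x) = 0"
      using sum0[of k x] N[OF insert.prems(4)] by (simp add: k_def)
  qed
  then show ?case by (simp add: c'_def k_def)
qed

definition exps :: "nat \<Rightarrow> nat \<Rightarrow> (nat \<Rightarrow> nat) set" where
  "exps n e = {a. (\<forall>j>n. a j = 0) \<and> (\<Sum>j\<le>n. a j) = e}"

lemma exps_0: "exps 0 e = {\<lambda>j. if j = 0 then e else 0}"
  by (auto simp: exps_def fun_eq_iff)

lemma exps_Suc: "exps (Suc n) e = (\<Union>k\<le>e. (\<lambda>a. a(Suc n := k)) ` exps n (e - k))"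
proof (rule set_eqI, rule iffI)
  fix a assume a: "a \<in> exps (Suc n) e"
  have s: "(\<Sum>j\<le>n. (a(Suc n := 0)) j) = (\<Sum>j\<le>n. a j)" by (intro sum.cong) auto
  have "a(Suc n := 0) \<in> exps n (e - a (Suc n))"
    using a s by (auto simp: exps_def)
  moreover have "a = (a(Suc n := 0))(Suc n := a (Suc n))" by simp
  moreover have "a (Suc n) \<le> e" using a by (auto simp: exps_def)
  ultimately show "a \<in> (\<Union>k\<le>e. (\<lambda>a. a(Suc n := k)) ` exps n (e - k))" by blast
next
  fix a assume "a \<in> (\<Union>k\<le>e. (\<lambda>a. a(Suc n := k)) ` exps n (e - k))"
  then obtain k b where *: "k \<le> e" "b \<in> exps n (e - k)" "a = b(Suc n := k)" by blast
  have "(\<Sum>j\<le>n. (b(Suc n := k)) j) = (\<Sum>j\<le>n. b j)" by (intro sum.cong) auto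
  then show "a \<in> exps (Suc n) e" using * by (auto simp: exps_def)
qed

lemma inj_on_exps: "inj_on (\<lambda>a. a(Suc n := k)) (exps n e)"
proof (rule inj_onI)
  fix a b assume *: "a \<in> exps n e" "b \<in> exps n e" "a(Suc n := k) = b(Suc n := k)"
  have "a = (a(Suc n := k))(Suc n := 0)" "b = (b(Suc n := k))(Suc n := 0)"
    using *(1,2) by (auto simp: exps_def)
  then show "a = b" using *(3) by metis
qed

lemma finite_exps: "finite (exps n e)"
  by (induction n arbitrary: e) (simp_all add: exps_0 exps_Suc)

lemma card_exps: "card (exps n e) = (n + e) choose n"
proof (induction n arbitrary: e)
  case 0
  then show ?case by (simp add: exps_0)
next
  case (Suc n)
  have "card (exps (Suc n) e) = (\<Sum>k\<le>e. card ((\<lambda>a. a(Suc n := k)) ` exps n (e - k)))"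
    unfolding exps_Suc
  proof (rule card_UN_disjoint)
    show "\<forall>i\<in>{..e}. \<forall>j\<in>{..e}. i \<noteq> j \<longrightarrow>
      (\<lambda>a. a(Suc n := i)) ` exps n (e - i) \<inter> (\<lambda>a. a(Suc n := j)) ` exps n (e - j) = {}"
      by (auto dest!: fun_cong[of _ _ "Suc n"])
  qed (simp_all add: finite_exps)
  also have "\<dots> = (\<Sum>k\<le>e. (n + (e - k)) choose n)"
    by (simp add: card_image[OF inj_on_exps] Suc)
  also have "\<dots> = (\<Sum>k\<le>e. (n + k) choose n)"
    by (rule sum.reindex_bij_witness[of _ "\<lambda>k. e - k" "\<lambda>k. e - k"]) auto
  also have "\<dots> = (\<Sum>k\<le>e. (n + k) choose k)"
  proof (rule sum.cong)
    fix k
    show "(n + k) choose n = (n + k) choose k" using binomial_symmetric[of n "n + k"] by simp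
  qed simp
  also have "\<dots> = Suc (n + e) choose e"
    by (rule sum_choose_lower)
  also have "\<dots> = (Suc n + e) choose Suc n"
    using binomial_symmetric[of e "Suc n + e"] by simp
  finally show ?case .
qed

text \<open>
  Ordinary forms in the variables \<open>x\<^sub>0, \<dots>, x\<^sub>n\<close>.
\<close>

abbreviation form :: "nat \<Rightarrow> nat \<Rightarrow> ((nat \<Rightarrow> complex) \<Rightarrow> complex) \<Rightarrow> bool" where
  "form n \<equiv> gform (\<lambda>_. 1) {..n}"

lemma form_mon: "a \<in> exps n e \<Longrightarrow> form n e (mon {..n} a)"
  using mon_gform[of "{..n}" "\<lambda>_. 1::nat" a] by (simp add: exps_def)

lemma form_nonempty: "\<exists>F. form n e F"
proof -
  have "(\<lambda>j. if j = 0 then e else 0) \<in> exps n e"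
    by (auto simp: exps_def)
  then show ?thesis using form_mon by blast
qed

lemma form_sum: "(\<And>a. a \<in> A \<Longrightarrow> form n e (F a)) \<Longrightarrow> form n e (\<lambda>x. \<Sum>a\<in>A. F a x)"
  using form_nonempty gform_sum by metis

lemma form_linear: "form n 1 (\<lambda>x. \<Sum>j\<le>n. l j * x j)"
  using gform.var[of _ "{..n}" "\<lambda>_. 1::nat"]
  by (intro form_sum gform_cmult) auto

lemma form_euler: "form n e F \<Longrightarrow> (\<Sum>j\<le>n. x j * pd j F x) = of_nat e * F x"
  using gform_euler[of "\<lambda>_. 1" "{..n}" e F "\<lambda>g. g" x] by simp

lemma form_combination: "form n e (\<lambda>x. \<Sum>a\<in>exps n e. c a * mon {..n} a x)"
  apply (rule form_sum)
  apply (rule gform_cmult)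
  apply (erule form_mon)
  done

text \<open>
  The linear functionals \<open>L m\<close> are fewer than the monomials of degree \<open>e\<close>, so they vanish together on a
  nonzero combination of monomials, which is a nonzero function because monomials are independent.
\<close>

lemma form_vanishing:
  assumes "finite M" "card M < (n + e) choose n"
    and L: "\<And>m c. m \<in> M \<Longrightarrow> L m (\<lambda>x. \<Sum>a\<in>exps n e. c a * mon {..n} a x)
       = (\<Sum>a\<in>exps n e. c a * L m (mon {..n} a))"
  shows "\<exists>F x. form n e F \<and> F x \<noteq> 0 \<and> (\<forall>m\<in>M. L m F = 0)"
proof -
  define u where "u m m' = (if m' = m then 1 else (0::complex))" for m m' :: 'a
  define g where "g a m = (if m \<in> M then L m (mon {..n} a) else 0)" for a m
  have "g a \<in> cvec.span (u ` M)" for a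
  proof -
    have "g a = (\<Sum>m\<in>M. (\<lambda>i. L m (mon {..n} a) * u m i))"
      using assms(1) by (auto simp: fun_eq_iff sum_apply g_def u_def if_distrib cong: if_cong)
    also have "\<dots> \<in> cvec.span (u ` M)"
      by (intro cvec.span_sum cvec.span_scale cvec.span_base imageI)
    finally show ?thesis .
  qed
  moreover have "card (u ` M) < card (exps n e)"
    unfolding card_exps using card_image_le[OF assms(1), of u] assms(2) by linarith
  ultimately have "\<exists>c. (\<exists>a\<in>exps n e. c a \<noteq> 0) \<and> (\<forall>m. (\<Sum>a\<in>exps n e. c a * g a m) = 0)"
    by (intro dependent_of_card_less[of "exps n e" "u ` M" g] finite_exps finite_imageI assms(1))
  then obtain c where "(\<exists>a\<in>exps n e. c a \<noteq> 0) \<and> (\<forall>m. (\<Sum>a\<in>exps n e. c a * g a m) = 0)"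
    by (rule exE)
  note c = conjunct1[OF this] conjunct2[OF this, THEN spec]
  define F where "F x = (\<Sum>a\<in>exps n e. c a * mon {..n} a x)" for x
  have "form n e F"
    unfolding F_def[abs_def] by (rule form_combination)
  moreover have "\<exists>x. F x \<noteq> 0"
  proof (rule ccontr)
    assume "\<not> (\<exists>x. F x \<noteq> 0)"
    then have F0: "(\<Sum>a\<in>exps n e. c a * mon {..n} a x) = 0" for x by (simp add: F_def)
    have "c a = 0" if "a \<in> exps n e" for a
      by (rule mon_independent[OF finite_atMost finite_exps _ F0 that]) (simp add: exps_def)
    then show False using c(1) by blast
  qed
  moreover have "L m F = 0" if "m \<in> M" for m
    using L[OF that, of c] c(2)[of m] that by (simp add: F_def[abs_def] g_def)
  ultimately show ?thesis by blast
qed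

section \<open>Interpolation of values and derivatives\<close>

text \<open>
  The index \<open>(i, j)\<close> with \<open>j \<le> n\<close> stands for the \<open>j\<close>-th partial derivative at the point \<open>p i\<close>, and
  \<open>(i, n + 1)\<close> for the value there.
\<close>

definition jet :: "nat \<Rightarrow> ('i \<Rightarrow> nat \<Rightarrow> complex) \<Rightarrow> 'i \<times> nat \<Rightarrow> ((nat \<Rightarrow> complex) \<Rightarrow> complex) \<Rightarrow> complex" where
  "jet n p m F = (if snd m \<le> n then pd (snd m) F (p (fst m)) else F (p (fst m)))"

text \<open>
  The conditions in \<open>M\<close> are independent on the forms of degree \<open>e\<close>.
\<close>

definition jets :: "nat \<Rightarrow> nat \<Rightarrow> ('i \<times> nat) set \<Rightarrow> ('i \<Rightarrow> nat \<Rightarrow> complex) \<Rightarrow> bool" where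
  "jets n e M p \<longleftrightarrow> (\<forall>b. \<exists>F. form n e F \<and> (\<forall>m\<in>M. jet n p m F = b m))"

lemma jet_sum:
  assumes "\<And>a. a \<in> A \<Longrightarrow> form n e (F a)"
  shows "jet n p m (\<lambda>x. \<Sum>a\<in>A. c a * F a x) = (\<Sum>a\<in>A. c a * jet n p m (F a))"
proof -
  have "pd v (\<lambda>x. \<Sum>a\<in>A. c a * F a x) x = (\<Sum>a\<in>A. pd v (\<lambda>x. c a * F a x) x)" for v x
    by (rule pd_sum, rule gform_polyfun, rule gform_cmult, rule assms)
  moreover have "pd v (\<lambda>x. c a * F a x) x = c a * pd v (F a) x" if "a \<in> A" for v x a
    by (rule pd_cmult[OF gform_polyfun[OF assms[OF that]]])
  ultimately show ?thesis by (simp add: jet_def)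
qed

lemma jet_cmult: 
  assumes "form n e F"
  shows "jet n p m (\<lambda>x. c * F x) = c * jet n p m F"
  unfolding jet_def pd_cmult[OF gform_polyfun[OF assms]] by (cases "snd m \<le> n") simp_all

lemma jet_add: 
  assumes "form n e F" "form n e G"
  shows "jet n p m (\<lambda>x. F x + G x) = jet n p m F + jet n p m G"
  unfolding jet_def pd_add[OF gform_polyfun[OF assms(1)] gform_polyfun[OF assms(2)]] by (cases "snd m \<le> n") simp_all

lemma form_vanishing_jets:
  assumes "finite M" "card M < (n + e) choose n"
  shows "\<exists>F x. form n e F \<and> F x \<noteq> 0 \<and> (\<forall>m\<in>M. jet n p m F = 0)"
  by (rule form_vanishing[OF assms]) (rule jet_sum, erule form_mon)

lemma jets_mono: "jets n e M p \<Longrightarrow> M' \<subseteq> M \<Longrightarrow> jets n e M' p"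
  unfolding jets_def by (meson subsetD)

lemma jet_cong: "p (fst m) = p' (fst m) \<Longrightarrow> jet n p m F = jet n p' m F"
  by (simp add: jet_def)

lemma jets_reindex:
  assumes "jets n e M p" "inj_on f (fst ` M)" "M' = (\<lambda>(i, j). (f i, j)) ` M" "\<And>i. i \<in> fst ` M \<Longrightarrow> p' (f i) = p i"
  shows "jets n e M' p'"
  unfolding jets_def
proof
  fix b
  obtain F where F: "form n e F" "\<And>m. m \<in> M \<Longrightarrow> jet n p m F = b (f (fst m), snd m)"
    using spec[OF assms(1)[unfolded jets_def], of "\<lambda>m. b (f (fst m), snd m)"] by blast
  have "jet n p' m F = b m" if "m \<in> M'" for m
  proof -
    have "m \<in> (\<lambda>(i, j). (f i, j)) ` M" using that assms(3) by simp
    then obtain i j where ij: "(i, j) \<in> M" "m = (f i, j)" by auto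
    have "p' (f i) = p i" using assms(4) ij by force
    then show ?thesis using F(2)[OF ij(1)] ij by (cases "j \<le> n") (simp_all add: jet_def)
  qed
  then show "\<exists>F. form n e F \<and> (\<forall>m\<in>M'. jet n p' m F = b m)" using F(1) by blast
qed

lemma jets_insert_value_at:
  assumes "jets n e M p" "i \<notin> fst ` M"
    and F: "form n e F" "F q \<noteq> 0" "\<And>m. m \<in> M \<Longrightarrow> jet n p m F = 0"
  shows "jets n e (insert (i, Suc n) M) (p(i := q))"
  unfolding jets_def
proof
  fix b
  let ?p = "p(i := q)"
  have jp: "jet n ?p m G = jet n p m G" if "m \<in> M" for m G
    using that assms(2) by (intro jet_cong) force
  obtain G where G: "form n e G" "\<And>m. m \<in> M \<Longrightarrow> jet n p m G = b m"
    using assms(1) unfolding jets_def by blast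
  define c where "c = (b (i, Suc n) - G q) / F q"
  let ?H = "\<lambda>x. G x + c * F x"
  have "form n e ?H" by (rule gform.add[OF G(1) gform_cmult[OF F(1)]])
  moreover have "jet n ?p m ?H = b m" if "m \<in> M" for m
    using that by (simp add: jp jet_add[OF G(1) gform_cmult[OF F(1)]] jet_cmult[OF F(1)] F(3) G(2))
  moreover have "jet n ?p (i, Suc n) ?H = b (i, Suc n)"
    using F(2) by (simp add: jet_def c_def)
  ultimately show "\<exists>F. form n e F \<and> (\<forall>m\<in>insert (i, Suc n) M. jet n ?p m F = b m)" by blast
qed

text \<open>
  As long as the conditions are fewer than the monomials, some form satisfies all of them homogeneously
  without vanishing identically, and a point where it is nonzero gives one more independent condition.
\<close>

lemma jets_insert_value:
  assumes "jets n e M p" "finite M" "card M < (n + e) choose n" "i \<notin> fst ` M"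
  shows "\<exists>q. jets n e (insert (i, Suc n) M) (p(i := q))"
proof -
  obtain F q where F: "form n e F" "F q \<noteq> 0" "\<And>m. m \<in> M \<Longrightarrow> jet n p m F = 0"
    using form_vanishing_jets[OF assms(2,3), of p] by blast
  show ?thesis using jets_insert_value_at[OF assms(1,4) F] by (rule exI[of _ q])
qed

lemma jets_insert_values:
  assumes "finite J" "jets n e M p" "finite M" "card M + card J \<le> (n + e) choose n" "J \<inter> fst ` M = {}"
  shows "\<exists>p'. (\<forall>i. i \<notin> J \<longrightarrow> p' i = p i) \<and> jets n e (M \<union> J \<times> {Suc n}) p'"
  using assms
proof (induction J rule: finite_induct)
  case empty
  then show ?case by auto
next
  case (insert i J)
  then obtain p' where p': "\<forall>i. i \<notin> J \<longrightarrow> p' i = p i" "jets n e (M \<union> J \<times> {Suc n}) p'" by auto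
  have "card (M \<union> J \<times> {Suc n}) \<le> card M + card J"
    using card_Un_le[of M "J \<times> {Suc n}"] by (simp add: card_cartesian_product)
  then have "\<exists>q. jets n e (insert (i, Suc n) (M \<union> J \<times> {Suc n})) (p'(i := q))"
    using insert.hyps insert.prems by (intro jets_insert_value p') auto
  then obtain q where "jets n e (insert (i, Suc n) (M \<union> J \<times> {Suc n})) (p'(i := q))" by blast
  moreover have "insert (i, Suc n) (M \<union> J \<times> {Suc n}) = M \<union> insert i J \<times> {Suc n}" by blast
  ultimately have "jets n e (M \<union> insert i J \<times> {Suc n}) (p'(i := q))" by (simp only:)
  moreover have "\<forall>k. k \<notin> insert i J \<longrightarrow> (p'(i := q)) k = p k" using p'(1) by simp
  ultimately show ?case by blast
qed

subsection \<open>Genericity\<close>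

text \<open>
  A weak form of Zariski openness, which suffices to satisfy finitely many conditions at once when each of them
  can be satisfied separately.
\<close>

definition lineopen :: "(('i \<Rightarrow> nat \<Rightarrow> complex) \<Rightarrow> bool) \<Rightarrow> bool" where
  "lineopen P \<longleftrightarrow> (\<forall>A B. P A \<longrightarrow> finite {t::complex. \<not> P (\<lambda>i j. A i j + t * (B i j - A i j))})"

lemma lineopen_conj:
  assumes "lineopen P" "lineopen Q"
  shows "lineopen (\<lambda>p. P p \<and> Q p)"
  unfolding lineopen_def
proof (intro allI impI)
  fix A B assume AB: "P A \<and> Q A"
  let ?l = "\<lambda>t::complex. \<lambda>i j. A i j + t * (B i j - A i j)"
  have "{t. \<not> (P (?l t) \<and> Q (?l t))} = {t. \<not> P (?l t)} \<union> {t. \<not> Q (?l t)}" by blast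
  then show "finite {t. \<not> (P (?l t) \<and> Q (?l t))}"
    using assms AB unfolding lineopen_def by simp
qed

lemma lineopen_meet:
  assumes "lineopen P" "lineopen Q" "P A" "Q B"
  shows "\<exists>C. P C \<and> Q C"
proof -
  let ?l = "\<lambda>t::complex. \<lambda>i j. A i j + t * (B i j - A i j)"
  let ?r = "\<lambda>t::complex. \<lambda>i j. B i j + t * (A i j - B i j)"
  have lr: "?l t = ?r (1 - t)" for t by (auto simp: fun_eq_iff algebra_simps)
  have "finite {t. \<not> P (?l t)}" "finite {t. \<not> Q (?r t)}"
    using assms unfolding lineopen_def by blast+
  then have "finite ({t. \<not> P (?l t)} \<union> (\<lambda>t. 1 - t) ` {t. \<not> Q (?r t)})" by simp
  then obtain t where t: "t \<notin> {t. \<not> P (?l t)} \<union> (\<lambda>t. 1 - t) ` {t. \<not> Q (?r t)}"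
    using ex_new_if_finite[OF infinite_UNIV_char_0] by blast
  have "Q (?r (1 - t))"
  proof (rule ccontr)
    assume "\<not> Q (?r (1 - t))"
    then have "1 - (1 - t) \<in> (\<lambda>t. 1 - t) ` {t. \<not> Q (?r t)}" by (intro imageI) simp
    then show False using t by simp
  qed
  then show ?thesis using t lr[of t] by (intro exI[of _ "?l t"]) auto
qed

lemma lineopen_Ball_meet:
  assumes "finite E" "\<And>e. e \<in> E \<Longrightarrow> lineopen (P e)" "\<And>e. e \<in> E \<Longrightarrow> \<exists>p. P e p"
  shows "lineopen (\<lambda>p. \<forall>e\<in>E. P e p) \<and> (\<exists>p. \<forall>e\<in>E. P e p)"
  using assms
proof (induction E rule: finite_induct)
  case empty
  then show ?case by (simp add: lineopen_def)
next
  case (insert e E)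
  then have 1: "lineopen (\<lambda>p. \<forall>e\<in>E. P e p)" "\<exists>p. \<forall>e\<in>E. P e p" "lineopen (P e)" "\<exists>p. P e p" by auto
  have "\<exists>p. P e p \<and> (\<forall>e\<in>E. P e p)" using lineopen_meet[OF 1(3,1)] 1(2,4) by blast
  then show ?case using lineopen_conj[OF 1(3,1)] by simp
qed

lemma jet_line:
  assumes "form n e F"
  shows "\<exists>q. \<forall>t. jet n (\<lambda>i j. A i j + t * (B i j - A i j)) m F = poly q t"
  using polyfun_line'[OF gform_polyfun[OF assms], of "A (fst m)" "\<lambda>j. B (fst m) j - A (fst m) j"]
    polyfun_line'[OF polyfun_pd[OF gform_polyfun[OF assms]], of "snd m" "A (fst m)" "\<lambda>j. B (fst m) j - A (fst m) j"]
  by (cases "snd m \<le> n") (auto simp: jet_def)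

text \<open>
  Independence of finitely many conditions is the non-vanishing of a minor, which is polynomial along
  a line.
\<close>

lemma jets_lineopen:
  assumes "finite M"
  shows "lineopen (jets n e M)"
  unfolding lineopen_def
proof (intro allI impI)
  fix A B :: "'a \<Rightarrow> nat \<Rightarrow> complex"
  let ?l = "\<lambda>t. \<lambda>i j. A i j + t * (B i j - A i j)"
  assume J: "jets n e M A"
  have "\<exists>F. form n e F \<and> (\<forall>m\<in>M. jet n A m F = (if m = m' then 1 else 0))" for m'
    using J unfolding jets_def by (rule allE)
  then obtain G where G: "\<And>m'. form n e (G m')" "\<And>m m'. m \<in> M \<Longrightarrow> jet n A m (G m') = (if m = m' then 1 else 0)"
    by metis
  have "\<exists>q. \<forall>t. jet n (?l t) m (G m') = poly q t" for m m' by (rule jet_line[OF G(1)])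
  then obtain q where q: "\<And>m m' t. jet n (?l t) m (G m') = poly (q m m') t" by metis
  have "poly (q m m') 0 = (if m = m' then 1 else 0)" if "m \<in> M" for m m'
    using q[of 0 m m'] G(2)[OF that, of m'] by simp
  then have fin: "finite {t. \<not> (\<forall>b. \<exists>x. \<forall>m\<in>M. (\<Sum>m'\<in>M. poly (q m m') t * x m') = b m)}"
    by (intro poly_matrix_invertible_cofinite assms)
  have "jets n e M (?l t)" if t: "\<forall>b. \<exists>x. \<forall>m\<in>M. (\<Sum>m'\<in>M. poly (q m m') t * x m') = b m" for t
    unfolding jets_def
  proof
    fix b
    obtain x where x: "\<And>m. m \<in> M \<Longrightarrow> (\<Sum>m'\<in>M. poly (q m m') t * x m') = b m"
      using t by blast
    let ?F = "\<lambda>y. \<Sum>m'\<in>M. x m' * G m' y"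
    have "form n e ?F" by (rule form_sum, rule gform_cmult, rule G)
    moreover have "jet n (?l t) m ?F = b m" if "m \<in> M" for m
      using jet_sum[of M n e G "?l t" m x] G(1) x[OF that] q by (simp add: mult.commute)
    ultimately show "\<exists>F. form n e F \<and> (\<forall>m\<in>M. jet n (?l t) m F = b m)" by blast
  qed
  then have "{t. \<not> jets n e M (?l t)} \<subseteq> {t. \<not> (\<forall>b. \<exists>x. \<forall>m\<in>M. (\<Sum>m'\<in>M. poly (q m m') t * x m') = b m)}"
    by blast
  then show "finite {t. \<not> jets n e M (?l t)}" using fin finite_subset by blast
qed

section \<open>Interpolation of gradients\<close>

text \<open>
  By Terracini's lemma this says that the \<open>h\<close>-th secant variety of the Veronese variety of degree \<open>e\<close> of
  \<open>n\<close>-space has dimension \<open>h (n + 1) - 1\<close>. For \<open>e > 0\<close> the gradient determines the value, so the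
  \<open>n + 1\<close> derivatives at a point are all the conditions of a double point.
\<close>

definition gradients_indep :: "nat \<Rightarrow> nat \<Rightarrow> nat \<Rightarrow> bool" where
  "gradients_indep n e h \<longleftrightarrow> (\<exists>p. jets n e ({..<h} \<times> {..n}) p)"

lemma image_times: "(\<lambda>(i, j). (f i, j)) ` (I \<times> J) = f ` I \<times> J"
  by force

lemma gradients_indep_obtain:
  assumes "gradients_indep n e (card I)" "finite I"
  shows "\<exists>p. jets n e (I \<times> {..n}) p"
proof -
  obtain p where p: "jets n e ({..<card I} \<times> {..n}) p" using assms(1) unfolding gradients_indep_def by blast
  obtain f where f: "bij_betw f {..<card I} I"
    using ex_bij_betw_nat_finite[OF assms(2)] by (auto simp: atLeast0LessThan)
  have "jets n e (I \<times> {..n}) (\<lambda>i. p (the_inv_into {..<card I} f i))"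
  proof (rule jets_reindex[OF p])
    have fst: "fst ` ({..<card I} \<times> {..n}) = {..<card I}" by auto
    show "inj_on f (fst ` ({..<card I} \<times> {..n}))" using f unfolding fst bij_betw_def by blast
    show "I \<times> {..n} = (\<lambda>(i, j). (f i, j)) ` ({..<card I} \<times> {..n})"
    proof -
      have "f ` {..<card I} = I" using f by (simp add: bij_betw_def)
      then show ?thesis by (simp only: image_times)
    qed
    show "p (the_inv_into {..<card I} f (f i)) = p i" if "i \<in> fst ` ({..<card I} \<times> {..n})" for i
      using that f the_inv_into_f_f[of f "{..<card I}" i] unfolding fst bij_betw_def by simp
  qed
  then show ?thesis by blast
qed

lemma gradients_indep_of_jets:
  assumes "jets n e (I \<times> {..n}) p" "finite I"
  shows "gradients_indep n e (card I)"
proof -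
  obtain f where f: "bij_betw f I {..<card I}"
    using ex_bij_betw_finite_nat[OF assms(2)] by (auto simp: atLeast0LessThan)
  have "jets n e ({..<card I} \<times> {..n}) (\<lambda>i. p (the_inv_into I f i))"
  proof (rule jets_reindex[OF assms(1)])
    have fst: "fst ` (I \<times> {..n}) = I" by auto
    show "inj_on f (fst ` (I \<times> {..n}))" using f unfolding fst bij_betw_def by blast
    show "{..<card I} \<times> {..n} = (\<lambda>(i, j). (f i, j)) ` (I \<times> {..n})"
    proof -
      have "f ` I = {..<card I}" using f by (simp add: bij_betw_def)
      then show ?thesis by (simp only: image_times)
    qed
    show "p (the_inv_into I f (f i)) = p i" if "i \<in> fst ` (I \<times> {..n})" for i
      using that f the_inv_into_f_f[of f I i] unfolding fst bij_betw_def by simp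
  qed
  then show ?thesis unfolding gradients_indep_def by blast
qed

lemma gradients_indep_mono: "gradients_indep n e h \<Longrightarrow> k \<le> h \<Longrightarrow> gradients_indep n e k"
  unfolding gradients_indep_def using jets_mono[of n e "{..<h} \<times> {..n}" _ "{..<k} \<times> {..n}"] by force

lemma gradients_indep_0: "gradients_indep n e 0"
  using form_nonempty by (simp add: gradients_indep_def jets_def)

lemma pd_linear:
  fixes n :: nat
  assumes "j \<le> n"
  shows "pd j (\<lambda>x. \<Sum>j\<le>n. l j * x j) x = (l j :: complex)"
proof -
  have "pd j (\<lambda>x. \<Sum>j\<le>n. l j * x j) x = (\<Sum>i\<le>n. pd j (\<lambda>x. l i * x i) x)"
    by (rule pd_sum[of _ _ UNIV], rule polyfun.mult, rule polyfun.const, rule polyfun.var) simp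
  also have "\<dots> = (\<Sum>i\<le>n. if j = i then l i else 0)"
    by (rule sum.cong[OF refl], subst pd_cmult[of _ UNIV], rule polyfun.var) (simp_all add: pd_var)
  also have "\<dots> = l j" using assms by (subst sum.delta') simp_all
  finally show ?thesis .
qed

text \<open>
  The left-hand side is the gradient at \<open>q\<close> of the product of a form with the linear form \<open>l\<close>, where \<open>g\<close>
  and \<open>G0\<close> are the gradient and the value of the first factor. Taking the product with \<open>q\<close> and using Euler's
  relation determines \<open>l(q)\<close>, after which \<open>l\<close> can be read off.
\<close>

lemma solve_times_linear:
  fixes G0 :: complex
  assumes "G0 \<noteq> 0" "(\<Sum>j\<le>n. q j * g j) = of_nat d * G0"
  shows "\<exists>l. \<forall>j\<le>n. g j * (\<Sum>i\<le>n. l i * q i) + G0 * l j = b j"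
proof -
  define s where "s = (\<Sum>j\<le>n. q j * b j) / ((of_nat d + 1) * G0)"
  define l where "l j = (b j - g j * s) / G0" for j
  have d1: "(of_nat d + 1 :: complex) \<noteq> 0"
    using of_nat_neq_0[of d, where 'a = complex] by (simp add: add.commute)
  have "(\<Sum>i\<le>n. l i * q i) * G0 = (\<Sum>j\<le>n. q j * b j) - s * (\<Sum>j\<le>n. q j * g j)"
    using assms(1) unfolding l_def sum_distrib_left sum_distrib_right sum_subtractf[symmetric]
    by (intro sum.cong) (auto simp: field_simps)
  also have "\<dots> = s * ((of_nat d + 1) * G0) - s * (of_nat d * G0)"
    unfolding assms(2) using assms(1) d1 by (simp add: s_def)
  also have "\<dots> = s * G0" by (simp add: algebra_simps)
  finally have "(\<Sum>i\<le>n. l i * q i) = s" using assms(1) by simp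
  then show ?thesis using assms(1) by (intro exI[of _ l]) (simp add: l_def)
qed

text \<open>
  If \<open>G\<close> is singular at the old points, then so is every product \<open>G L\<close> with a linear form \<open>L\<close>. These products
  therefore change nothing at the old points, while at \<open>q\<close> they realise every gradient.
\<close>

lemma jets_insert_point:
  assumes J: "jets n (Suc d) (I \<times> {..n}) p" and "i \<notin> I" and "d \<ge> 1"
    and G: "form n d G" "G q \<noteq> 0" "\<And>k j. k \<in> I \<Longrightarrow> j \<le> n \<Longrightarrow> pd j G (p k) = 0"
  shows "jets n (Suc d) (insert i I \<times> {..n}) (p(i := q))"
  unfolding jets_def
proof
  fix b
  let ?p = "p(i := q)"
  have G0: "G (p k) = 0" if "k \<in> I" for k
    using form_euler[OF G(1), of "p k"] G(3)[OF that] \<open>d \<ge> 1\<close> by simp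
  obtain F where F: "form n (Suc d) F" "\<And>m. m \<in> I \<times> {..n} \<Longrightarrow> jet n p m F = b m"
    using J unfolding jets_def by blast
  obtain l where l: "\<And>j. j \<le> n \<Longrightarrow> pd j G q * (\<Sum>i\<le>n. l i * q i) + G q * l j = b (i, j) - pd j F q"
    using solve_times_linear[OF G(2) form_euler[OF G(1)], of "\<lambda>j. b (i, j) - pd j F q"] by blast
  define L where "L x = (\<Sum>i\<le>n. l i * x i)" for x
  have L: "form n 1 L" unfolding L_def[abs_def] by (rule form_linear)
  have GL: "form n (Suc d) (\<lambda>x. G x * L x)"
    using gform.mult[OF G(1) L] by simp
  have pdGL: "pd j (\<lambda>x. G x * L x) x = pd j G x * L x + G x * l j" if "j \<le> n" for j x
    using pd_mult[OF gform_polyfun[OF G(1)] gform_polyfun[OF L], of j x]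
      pd_linear[OF that, of l x] by (simp add: L_def[abs_def])
  let ?H = "\<lambda>x. F x + G x * L x"
  have H: "form n (Suc d) ?H" by (rule gform.add[OF F(1) GL])
  have pdH: "pd j ?H x = pd j F x + (pd j G x * L x + G x * l j)" if "j \<le> n" for j x
    using pd_add[OF gform_polyfun[OF F(1)] gform_polyfun[OF GL], of j x] pdGL[OF that] by simp
  have "jet n ?p m ?H = b m" if m: "m \<in> insert i I \<times> {..n}" for m
  proof -
    obtain k j where kj: "m = (k, j)" "k \<in> insert i I" "j \<le> n" using m by auto
    show ?thesis
    proof (cases "k = i")
      case True
      have "pd j G q * L q + G q * l j = b (i, j) - pd j F q" using l[OF kj(3)] by (simp only: L_def)
      then show ?thesis using kj True by (simp add: jet_def pdH)
    next
      case False
      then have k: "k \<in> I" using kj by simp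
      then have "jet n p (k, j) F = b (k, j)" using F(2)[of "(k, j)"] kj by simp
      then show ?thesis using kj False G(3)[OF k kj(3)] G0[OF k] by (simp add: jet_def pdH)
    qed
  qed
  then show "\<exists>F. form n (Suc d) F \<and> (\<forall>m\<in>insert i I \<times> {..n}. jet n ?p m F = b m)" using H by blast
qed

text \<open>
  There is a form of degree \<open>d\<close> that is singular at the \<open>h\<close> points since this is \<open>h (n + 1)\<close> conditions.
\<close>

lemma gradients_indep_Suc_of_count:
  assumes "gradients_indep n (Suc d) h" "d \<ge> 1" "h * (n + 1) < (n + d) choose n"
  shows "gradients_indep n (Suc d) (Suc h)"
proof -
  obtain p where p: "jets n (Suc d) ({..<h} \<times> {..n}) p" using assms(1) unfolding gradients_indep_def by blast
  have "card ({..<h} \<times> {..n}) < (n + d) choose n"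
    using assms(3) by (simp add: card_cartesian_product)
  then obtain G q where G: "form n d G" "G q \<noteq> 0" "\<And>m. m \<in> {..<h} \<times> {..n} \<Longrightarrow> jet n p m G = 0"
    using form_vanishing_jets[of "{..<h} \<times> {..n}" n d p] by blast
  have "pd j G (p k) = 0" if "k \<in> {..<h}" "j \<le> n" for k j
    using G(3)[of "(k, j)"] that by (simp add: jet_def)
  then have "jets n (Suc d) (insert h {..<h} \<times> {..n}) (p(h := q))"
    using jets_insert_point[OF p _ assms(2) G(1,2)] by simp
  then show ?thesis using gradients_indep_of_jets[of n "Suc d" "insert h {..<h}"] by simp
qed

lemma gradients_indep_of_count:
  assumes "d \<ge> 1" "(h - 1) * (n + 1) < (n + d) choose n"
  shows "gradients_indep n (Suc d) h"
proof -
  have "gradients_indep n (Suc d) k" if "k \<le> h" for k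
    using that
  proof (induction k)
    case 0
    then show ?case by (simp add: gradients_indep_0)
  next
    case (Suc k)
    have "k * (n + 1) \<le> (h - 1) * (n + 1)" using Suc.prems by (intro mult_right_mono) simp_all
    then have "k * (n + 1) < (n + d) choose n" using assms(2) by (rule le_less_trans)
    moreover have "gradients_indep n (Suc d) k" using Suc.IH Suc.prems by (simp only: Suc_leD)
    ultimately show ?case using assms(1) by (simp only: gradients_indep_Suc_of_count)
  qed
  then show ?thesis by simp
qed

text \<open>
  The square of a form of degree \<open>k\<close> through the points is singular at them. This costs only one condition per
  point and beats the count of conditions in low degree.
\<close>

lemma gradients_indep_Suc_of_square:
  assumes "gradients_indep n (Suc (2 * k)) h" "k \<ge> 1" "h < (n + k) choose n"
  shows "gradients_indep n (Suc (2 * k)) (Suc h)"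
proof -
  obtain p where p: "jets n (Suc (2 * k)) ({..<h} \<times> {..n}) p" using assms(1) unfolding gradients_indep_def by blast
  have "card ({..<h} \<times> {Suc n}) < (n + k) choose n"
    using assms(3) by (simp add: card_cartesian_product)
  then obtain g q where g: "form n k g" "g q \<noteq> 0" "\<And>m. m \<in> {..<h} \<times> {Suc n} \<Longrightarrow> jet n p m g = 0"
    using form_vanishing_jets[of "{..<h} \<times> {Suc n}" n k p] by blast
  have g0: "g (p i) = 0" if "i < h" for i
    using g(3)[of "(i, Suc n)"] that by (simp add: jet_def)
  define G where "G x = g x * g x" for x
  have "form n (k + k) G" unfolding G_def[abs_def] by (rule gform.mult[OF g(1) g(1)])
  then have G: "form n (2 * k) G" by (simp add: mult_2)
  have "pd j G (p i) = 0" if "i \<in> {..<h}" "j \<le> n" for i j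
    unfolding G_def[abs_def] using pd_mult[OF gform_polyfun[OF g(1)] gform_polyfun[OF g(1)], of j "p i"] g0[of i] that
    by simp
  moreover have "G q \<noteq> 0" using g(2) by (simp add: G_def)
  moreover have "2 * k \<ge> 1" using assms(2) by simp
  ultimately have "jets n (Suc (2 * k)) (insert h {..<h} \<times> {..n}) (p(h := q))"
    using jets_insert_point[OF p _ _ G] by simp
  then show ?thesis using gradients_indep_of_jets[of n "Suc (2 * k)" "insert h {..<h}"] by simp
qed

lemma gradients_indep_of_square:
  assumes "k \<ge> 1" "h \<le> (n + k) choose n"
  shows "gradients_indep n (Suc (2 * k)) h"
  using assms(2)
proof (induction h)
  case 0
  then show ?case by (simp add: gradients_indep_0)
next
  case (Suc h)
  then have "gradients_indep n (Suc (2 * k)) h" "h < (n + k) choose n" by simp_all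
  then show ?case using assms(1) by (simp only: gradients_indep_Suc_of_square)
qed

section \<open>Degeneration into layers\<close>

text \<open>
  A form of degree \<open>d\<close> in one more variable is \<open>\<Sum>e. x\<^sub>n\<^sub>+\<^sub>1\<^sup>e f\<^sub>e\<close>, where the layer \<open>f\<^sub>e\<close> has degree \<open>d - e\<close>. In
  the degeneration the point \<open>i\<close> goes to the layer \<open>c i\<close>, where it imposes its gradient, and to one
  adjacent layer, the next or the previous one according to \<open>up i\<close>, where it imposes its value.
\<close>

definition neighbour :: "('i \<Rightarrow> nat) \<Rightarrow> ('i \<Rightarrow> bool) \<Rightarrow> 'i \<Rightarrow> nat" where
  "neighbour c up i = (if up i then c i + 1 else c i - 1)"

definition layer :: "nat \<Rightarrow> 'i set \<Rightarrow> ('i \<Rightarrow> nat) \<Rightarrow> ('i \<Rightarrow> bool) \<Rightarrow> nat \<Rightarrow> ('i \<times> nat) set" where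
  "layer n I c up e = {i \<in> I. c i = e} \<times> {..n} \<union> {i \<in> I. neighbour c up i = e} \<times> {Suc n}"

text \<open>
  With \<open>l = \<eta> k\<close> the exponent is \<open>l (3 l - 2)\<close>, with the values \<open>0, 1\<close> at \<open>l = 0, 1\<close> and at least \<open>5\<close> elsewhere. So
  a quadratic weight singles out a layer together with one chosen neighbour.
\<close>

lemma layer_exponent:
  fixes k \<eta> :: int
  assumes "\<eta> = 1 \<or> \<eta> = -1"
  shows "0 \<le> 3 * k^2 - 2 * \<eta> * k" "3 * k^2 - 2 * \<eta> * k = 0 \<longleftrightarrow> k = 0"
    "3 * k^2 - 2 * \<eta> * k = 1 \<longleftrightarrow> \<eta> * k = 1"
proof -
  define l where "l = \<eta> * k"
  have e: "3 * k^2 - 2 * \<eta> * k = l * (3 * l - 2)"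
    using assms by (auto simp: l_def power2_eq_square algebra_simps)
  have l0: "k = 0 \<longleftrightarrow> l = 0" using assms by (auto simp: l_def)
  have "l \<le> -1 \<or> l = 0 \<or> l = 1 \<or> l \<ge> 2" by linarith
  moreover have "l * (3 * l - 2) \<ge> 5" if "l \<le> -1"
  proof -
    have "(-l) * (2 - 3 * l) \<ge> 1 * 5" using that by (intro mult_mono) auto
    then show ?thesis by (simp add: algebra_simps)
  qed
  moreover have "l * (3 * l - 2) \<ge> 8" if "l \<ge> 2"
  proof -
    have "l * (3 * l - 2) \<ge> 2 * 4" using that by (intro mult_mono) auto
    then show ?thesis by simp
  qed
  ultimately show "0 \<le> 3 * k^2 - 2 * \<eta> * k" "3 * k^2 - 2 * \<eta> * k = 0 \<longleftrightarrow> k = 0"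
    "3 * k^2 - 2 * \<eta> * k = 1 \<longleftrightarrow> \<eta> * k = 1"
    unfolding e l0 l_def[symmetric] by auto
qed

text \<open>
  Put the point \<open>i\<close> at \<open>(q\<^sub>i, s\<^sub>i)\<close> with \<open>s\<^sub>i = t\<^bsup>-(6 c + 2 \<eta>)\<^esup>\<close>, where \<open>c = c i\<close> and \<open>\<eta> = \<plusminus>1\<close> points to
  the neighbour, and scale the layer \<open>l\<close> by \<open>t\<^bsup>3 l\<^sup>2\<^esup>\<close>. Up to a common factor, the layer \<open>c + k\<close> then
  contributes to the conditions at \<open>i\<close> with the weight \<open>t\<^bsup>3 k\<^sup>2 - 2 \<eta> k\<^esup>\<close>. As \<open>t\<close> tends to \<open>0\<close>, the derivatives
  along the first \<open>n + 1\<close> coordinates only see the layer \<open>c\<close>. A combination of all derivatives at \<open>i\<close>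
  cancels this layer by Euler's relation; what is left of it only sees the neighbour, and there it
  is a multiple of the value. In the limit the conditions become those of \<open>lay\<close>.
\<close>

lemma jets_of_layers:
  fixes c :: "'i \<Rightarrow> nat" and q :: "'i \<Rightarrow> nat \<Rightarrow> complex"
  assumes I: "finite I"
    and c: "\<And>i. i \<in> I \<Longrightarrow> c i < d" "\<And>i. i \<in> I \<Longrightarrow> up i \<or> 0 < c i"
    and lay: "\<And>e. e \<le> d \<Longrightarrow> jets n (d - e) (layer n I c up e) q"
  shows "gradients_indep (Suc n) d (card I)"
proof -
  define M where "M = I \<times> {..Suc n}"
  define \<eta> :: "'i \<Rightarrow> int" where "\<eta> i = (if up i then 1 else -1)" for i
  define la where "la m = (if snd m \<le> n then c (fst m) else neighbour c up (fst m))" for m :: "'i \<times> nat"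
  have \<eta>: "\<eta> i = 1 \<or> \<eta> i = -1" for i by (simp add: \<eta>_def)
  have nb: "int (neighbour c up i) = int (c i) + \<eta> i" if "i \<in> I" for i
    using c(2)[OF that] by (auto simp: neighbour_def \<eta>_def of_nat_diff)
  have la_d: "la m \<le> d" if "m \<in> M" for m
    using that c(1)[of "fst m"] by (auto simp: la_def M_def neighbour_def)
  have la_in: "m \<in> layer n I c up (la m)" if "m \<in> M" for m
    using that by (cases m) (auto simp: layer_def la_def M_def)
  have "\<exists>F. form n (d - la m) F \<and> (\<forall>m'\<in>layer n I c up (la m). jet n q m' F = (if m' = m then 1 else 0))"
    if "m \<in> M" for m
    by (rule spec[OF lay[OF la_d[OF that], unfolded jets_def]])
  then obtain f where f: "\<And>m. m \<in> M \<Longrightarrow> form n (d - la m) (f m)"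
    "\<And>m m'. m \<in> M \<Longrightarrow> m' \<in> layer n I c up (la m) \<Longrightarrow> jet n q m' (f m) = (if m' = m then 1 else 0)"
    by metis
  define k where "k i m = int (la m) - int (c i)" for i m
  define ex where "ex i m = nat (3 * (k i m)^2 - 2 * \<eta> i * k i m)" for i m
  \<comment> \<open>The matrix of the rescaled conditions on the solutions of the layer problems; it is the identity at \<open>t = 0\<close>.\<close>
  define A where "A m m' = (if snd m \<le> n then Polynomial.monom (jet n q m (f m')) (ex (fst m) m')
      else if k (fst m) m' = 0 then 0
      else Polynomial.monom (of_int (\<eta> (fst m) * k (fst m) m') * jet n q m (f m')) (ex (fst m) m' - 1))" for m m'
  have ex0: "ex i m = 0 \<longleftrightarrow> k i m = 0" and ex1: "ex i m = 1 \<longleftrightarrow> \<eta> i * k i m = 1" for i m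
    using layer_exponent[OF \<eta>, of "k i m" i] by (auto simp: ex_def)
  have A0: "poly (A m m') 0 = (if m = m' then 1 else 0)" if "m \<in> M" "m' \<in> M" for m m'
  proof (cases "snd m \<le> n")
    case True
    then have kk: "k (fst m) m' = 0 \<longleftrightarrow> la m' = la m" by (auto simp: k_def la_def)
    show ?thesis
    proof (cases "la m' = la m")
      case la: True
      then have "m \<in> layer n I c up (la m')" using la_in[OF that(1)] by simp
      then show ?thesis using True la kk f(2)[OF that(2)] ex0[of "fst m" m']
        by (simp add: A_def poly_monom)
    next
      case False
      then show ?thesis using True kk ex0[of "fst m" m'] by (auto simp: A_def poly_monom)
    qed
  next
    case False
    have fm: "fst m \<in> I" using that by (auto simp: M_def)
    have lam: "int (la m) = int (c (fst m)) + \<eta> (fst m)" using False nb[OF fm] by (simp add: la_def)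
    have kk: "\<eta> (fst m) * k (fst m) m' = 1 \<longleftrightarrow> la m' = la m"
      using lam \<eta>[of "fst m"] by (auto simp: k_def)
    show ?thesis
    proof (cases "la m' = la m")
      case la: True
      then have "m \<in> layer n I c up (la m')" using la_in[OF that(1)] by simp
      moreover have "k (fst m) m' \<noteq> 0" using la kk by auto
      moreover have "ex (fst m) m' = 1" using la kk ex1 by blast
      ultimately show ?thesis using False la kk f(2)[OF that(2)]
        by (simp add: A_def poly_monom del: of_int_mult)
    next
      case la: False
      then have "m \<noteq> m'" by auto
      moreover have "ex (fst m) m' \<noteq> 1" using la kk ex1 by blast
      moreover have "k (fst m) m' = 0 \<or> ex (fst m) m' \<noteq> 0" using ex0 by blast
      ultimately show ?thesis using False by (auto simp: A_def poly_monom)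
    qed
  qed
  have "finite M" using I by (simp add: M_def)
  then have "finite ({t. \<not> (\<forall>b. \<exists>x. \<forall>m\<in>M. (\<Sum>m'\<in>M. poly (A m m') t * x m') = b m)} \<union> {0})"
    using poly_matrix_invertible_cofinite[of M A] A0 by simp
  then obtain t where "t \<notin> {t. \<not> (\<forall>b. \<exists>x. \<forall>m\<in>M. (\<Sum>m'\<in>M. poly (A m m') t * x m') = b m)} \<union> {0}"
    using ex_new_if_finite[OF infinite_UNIV_char_0] by blast
  then have t: "t \<noteq> 0" and sol: "\<And>b. \<exists>x. \<forall>m\<in>M. (\<Sum>m'\<in>M. poly (A m m') t * x m') = b m" by auto
  define s where "s i = t powi (- (6 * int (c i) + 2 * \<eta> i))" for i
  \<comment> \<open>\<open>K i\<close> is the common factor that turns the weights into \<open>t ^ ex i m\<close>.\<close>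
  define K where "K i = t powi (3 * (int (c i))^2 + 2 * \<eta> i * int (c i))" for i
  define P where "P i j = (if j \<le> n then q i j else s i)" for i j
  define G where "G m x = t ^ (3 * (la m)^2) * (x (Suc n) ^ la m * f m x)" for m :: "'i \<times> nat" and x :: "nat \<Rightarrow> complex"
  have PS: "P i (Suc n) = s i" and Pq: "j \<le> n \<Longrightarrow> P i j = q i j" for i j by (simp_all add: P_def)
  have s0: "s i \<noteq> 0" and K0: "K i \<noteq> 0" for i using t by (auto simp: s_def K_def)
  have exK: "t ^ ex i m = K i * (t ^ (3 * (la m)^2) * s i ^ la m)" for i m
  proof -
    have "t ^ ex i m = t powi (3 * (k i m)^2 - 2 * \<eta> i * k i m)"
      using layer_exponent(1)[OF \<eta>, of "k i m" i] by (simp add: ex_def power_int_def)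
    also have "3 * (k i m)^2 - 2 * \<eta> i * k i m = (3 * (int (c i))^2 + 2 * \<eta> i * int (c i))
       + (int (3 * (la m)^2) + (- (6 * int (c i) + 2 * \<eta> i)) * int (la m))"
      by (simp add: k_def power2_eq_square algebra_simps)
    also have "t powi \<dots> = K i * (t powi int (3 * (la m)^2) * s i powi int (la m))"
      using t by (simp add: power_int_add K_def s_def power_int_mult)
    finally show ?thesis by (simp only: power_int_of_nat)
  qed
  have fS: "form (Suc n) (d - la m) (f m)" if "m \<in> M" for m
    by (rule gform_mono[OF f(1)[OF that]]) auto
  have xk: "form (Suc n) e (\<lambda>x. x (Suc n) ^ e)" for e
    using gform_power[OF gform.var[of "Suc n" "{..Suc n}" "\<lambda>_. 1::nat"], of e] by simp
  have G: "form (Suc n) d (G m)" if "m \<in> M" for m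
  proof -
    have "form (Suc n) (la m + (d - la m)) (\<lambda>x. x (Suc n) ^ la m * f m x)"
      by (rule gform.mult[OF xk fS[OF that]])
    then show ?thesis using la_d[OF that] gform_cmult unfolding G_def[abs_def] by force
  qed
  have pdG: "pd j (G m) (P i) = t ^ (3 * (la m)^2) * (s i ^ la m * pd j (f m) (q i))" if "m \<in> M" "j \<le> n" for i j m
  proof -
    have f': "f m \<in> polyfun {..n}" by (rule gform_polyfun[OF f(1)[OF that(1)]])
    have x': "(\<lambda>x. x (Suc n) ^ la m) \<in> polyfun {Suc n}" by (rule polyfun_power[OF polyfun.var]) simp
    have "pd j (G m) (P i) = t ^ (3 * (la m)^2) * pd j (\<lambda>x. x (Suc n) ^ la m * f m x) (P i)"
      unfolding G_def[abs_def]
      by (rule pd_cmult[of _ UNIV]) (rule polyfun.mult[OF polyfun_mono[OF x'] polyfun_mono[OF f']]; simp)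
    also have "pd j (\<lambda>x. x (Suc n) ^ la m * f m x) (P i)
      = pd j (\<lambda>x. x (Suc n) ^ la m) (P i) * f m (P i) + P i (Suc n) ^ la m * pd j (f m) (P i)"
      by (rule pd_mult[OF x' f'])
    also have "pd j (\<lambda>x. x (Suc n) ^ la m) (P i) = 0" using that by (intro pd_outside[OF x']) simp
    also have "pd j (f m) (P i) = pd j (f m) (q i)"
      by (rule polyfun_local[OF polyfun_pd[OF f']]) (simp add: P_def)
    finally show ?thesis by (simp add: PS)
  qed
  have fP: "f m (P i) = f m (q i)" if "m \<in> M" for m i
    by (rule polyfun_local[OF gform_polyfun[OF f(1)[OF that]]]) (simp add: P_def)
  have eulerG: "s i * pd (Suc n) (G m) (P i) + (\<Sum>j\<le>n. q i j * pd j (G m) (P i)) = of_nat d * G m (P i)"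
    if "m \<in> M" for m i
    using form_euler[OF G[OF that], of "P i"] by (simp add: PS Pq add.commute)
  have eulerf: "(\<Sum>j\<le>n. q i j * pd j (G m) (P i)) = of_nat (d - la m) * G m (P i)" if "m \<in> M" for m i
  proof -
    have "(\<Sum>j\<le>n. q i j * pd j (G m) (P i)) = t ^ (3 * (la m)^2) * s i ^ la m * (\<Sum>j\<le>n. q i j * pd j (f m) (q i))"
      unfolding sum_distrib_left by (intro sum.cong) (simp_all add: pdG[OF that])
    also have "\<dots> = of_nat (d - la m) * G m (P i)"
      by (simp add: form_euler[OF f(1)[OF that]] G_def fP[OF that] PS)
    finally show ?thesis .
  qed
  \<comment> \<open>The coefficients \<open>d - c i\<close> and \<open>c i\<close> are chosen such that the layer \<open>c i\<close>, i.e. \<open>k = 0\<close>, drops out.\<close>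
  have row: "of_nat (d - c i) * (s i * pd (Suc n) (G m) (P i)) - of_nat (c i) * (\<Sum>j\<le>n. q i j * pd j (G m) (P i))
     = of_nat d * of_int (k i m) * G m (P i)" if "m \<in> M" "i \<in> I" for m i
  proof -
    have 1: "of_nat (d - c i) = (of_nat d - of_nat (c i) :: complex)" using c(1)[OF that(2)] by (simp add: of_nat_diff)
    have 2: "of_nat (d - la m) = (of_nat d - of_nat (la m) :: complex)" using la_d[OF that(1)] by (simp add: of_nat_diff)
    have "s i * pd (Suc n) (G m) (P i) = of_nat (la m) * G m (P i)"
      using eulerG[OF that(1), of i] unfolding eulerf[OF that(1)] 2 by (simp add: algebra_simps)
    then show ?thesis unfolding eulerf[OF that(1)] 1 2 by (simp add: k_def algebra_simps)
  qed
  have d0: "(of_nat d :: complex) \<noteq> 0" if "i \<in> I" for i using c(1)[OF that] by simp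
  have "jets (Suc n) d M P"
    unfolding jets_def
  proof
    fix b :: "'i \<times> nat \<Rightarrow> complex"
    \<comment> \<open>The data for the rescaled conditions, including the combination of derivatives from \<open>row\<close>.\<close>
    define b' where "b' m = (let i = fst m in if snd m \<le> n then K i * b m
       else of_int (\<eta> i) * K i / (of_nat d * t) * (of_nat (d - c i) * (s i * b (i, Suc n))
          - of_nat (c i) * (\<Sum>j\<le>n. q i j * b (i, j))))" for m
    obtain x where x: "\<And>m. m \<in> M \<Longrightarrow> (\<Sum>m'\<in>M. poly (A m m') t * x m') = b' m"
      using sol[of b'] by blast
    let ?F = "\<lambda>y. \<Sum>m\<in>M. x m * G m y"
    have F: "form (Suc n) d ?F" by (rule form_sum, rule gform_cmult, rule G)
    have pdF: "pd j ?F y = (\<Sum>m\<in>M. x m * pd j (G m) y)" for j y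
    proof -
      have "pd j ?F y = (\<Sum>m\<in>M. pd j (\<lambda>y. x m * G m y) y)"
        by (rule pd_sum, rule gform_polyfun, rule gform_cmult, erule G)
      also have "\<dots> = (\<Sum>m\<in>M. x m * pd j (G m) y)"
        by (intro sum.cong refl pd_cmult, rule gform_polyfun, erule G)
      finally show ?thesis .
    qed
    have 1: "pd j ?F (P i) = b (i, j)" if ij: "i \<in> I" "j \<le> n" for i j
    proof -
      have "K i * b (i, j) = (\<Sum>m'\<in>M. poly (A (i, j) m') t * x m')"
        using x[of "(i, j)"] ij by (simp add: M_def b'_def)
      also have "\<dots> = (\<Sum>m'\<in>M. K i * (x m' * pd j (G m') (P i)))"
        using ij by (intro sum.cong refl) (simp add: A_def poly_monom jet_def exK pdG)
      also have "\<dots> = K i * pd j ?F (P i)" unfolding pdF sum_distrib_left ..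
      finally show ?thesis using K0[of i] by simp
    qed
    have 2: "pd (Suc n) ?F (P i) = b (i, Suc n)" if i: "i \<in> I" for i
    proof -
      let ?B = "of_nat (d - c i) * (s i * b (i, Suc n)) - of_nat (c i) * (\<Sum>j\<le>n. q i j * b (i, j))"
      have trm: "of_nat d * t * poly (A (i, Suc n) m') t = of_int (\<eta> i) * K i *
        (of_nat (d - c i) * (s i * pd (Suc n) (G m') (P i)) - of_nat (c i) * (\<Sum>j\<le>n. q i j * pd j (G m') (P i)))"
        if m': "m' \<in> M" for m'
      proof (cases "k i m' = 0")
        case True
        then show ?thesis unfolding row[OF m' i] by (simp add: A_def)
      next
        case False
        then have "ex i m' \<noteq> 0" using ex0 by blast
        then have "t * t ^ (ex i m' - 1) = t ^ ex i m'" by (metis power_eq_if)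
        then have "of_nat d * t * poly (A (i, Suc n) m') t
           = of_nat d * of_int (\<eta> i * k i m') * f m' (q i) * t ^ ex i m'"
          using False by (simp add: A_def poly_monom jet_def mult_ac)
        then show ?thesis unfolding row[OF m' i] exK by (simp add: G_def fP[OF m'] PS mult_ac)
      qed
      have xb: "(\<Sum>m'\<in>M. poly (A (i, Suc n) m') t * x m') = b' (i, Suc n)"
        using i by (intro x) (simp add: M_def)
      define w where "w m' = (\<Sum>j\<le>n. q i j * pd j (G m') (P i))" for m'
      have "of_nat d * t * b' (i, Suc n) = (\<Sum>m'\<in>M. of_nat d * t * poly (A (i, Suc n) m') t * x m')"
        unfolding xb[symmetric] sum_distrib_left by (intro sum.cong) (simp_all add: mult_ac)
      also have "\<dots> = (\<Sum>m'\<in>M. of_int (\<eta> i) * K i *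
        (of_nat (d - c i) * (s i * (x m' * pd (Suc n) (G m') (P i))) - of_nat (c i) * (x m' * w m')))"
      proof (rule sum.cong)
        fix m' assume "m' \<in> M"
        from trm[OF this] show "of_nat d * t * poly (A (i, Suc n) m') t * x m' = of_int (\<eta> i) * K i *
          (of_nat (d - c i) * (s i * (x m' * pd (Suc n) (G m') (P i))) - of_nat (c i) * (x m' * w m'))"
          unfolding w_def[symmetric] by (simp only:) (simp add: algebra_simps)
      qed simp
      also have "\<dots> = of_int (\<eta> i) * K i *
        (of_nat (d - c i) * (s i * pd (Suc n) ?F (P i)) - of_nat (c i) * (\<Sum>m'\<in>M. x m' * w m'))"
        unfolding pdF sum_distrib_left sum_subtractf[symmetric] ..
      also have "(\<Sum>m'\<in>M. x m' * w m') = (\<Sum>m'\<in>M. \<Sum>j\<le>n. q i j * (x m' * pd j (G m') (P i)))"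
        unfolding w_def sum_distrib_left by (intro sum.cong) (simp_all add: mult_ac)
      also have "\<dots> = (\<Sum>j\<le>n. q i j * pd j ?F (P i))"
        unfolding pdF sum_distrib_left by (rule sum.swap)
      also have "(\<Sum>j\<le>n. q i j * pd j ?F (P i)) = (\<Sum>j\<le>n. q i j * b (i, j))"
        by (intro sum.cong refl) (simp add: 1[OF i])
      finally have e: "of_nat d * t * b' (i, Suc n) = of_int (\<eta> i) * K i *
         (of_nat (d - c i) * (s i * pd (Suc n) ?F (P i)) - of_nat (c i) * (\<Sum>j\<le>n. q i j * b (i, j)))" .
      have "of_nat d * t * b' (i, Suc n) = of_int (\<eta> i) * K i * ?B"
        using t d0[OF i] by (simp add: b'_def Let_def)
      moreover have "of_int (\<eta> i) * K i \<noteq> 0" using K0[of i] \<eta>[of i] by auto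
      ultimately have "of_nat (d - c i) * (s i * pd (Suc n) ?F (P i)) = of_nat (d - c i) * (s i * b (i, Suc n))"
        unfolding e by simp
      moreover have "(of_nat (d - c i) :: complex) \<noteq> 0" using c(1)[OF i] by simp
      ultimately show ?thesis using s0[of i] by simp
    qed
    have "jet (Suc n) P m ?F = b m" if m: "m \<in> M" for m
    proof -
      obtain i j where ij: "m = (i, j)" "i \<in> I" "j \<le> Suc n" using m by (cases m) (auto simp: M_def)
      then show ?thesis using 1[of i j] 2[of i] by (cases "j \<le> n") (auto simp: jet_def le_Suc_eq)
    qed
    then show "\<exists>F. form (Suc n) d F \<and> (\<forall>m\<in>M. jet (Suc n) P m F = b m)" using F by blast
  qed
  then show ?thesis unfolding M_def using gradients_indep_of_jets I by blast
qed

text \<open>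
  The layer \<open>e\<close> receives \<open>a e\<close> points whose neighbour is the next layer and \<open>b e\<close> points whose neighbour is the
  previous one. The values that come from adjacent layers are free points, hence a count suffices for
  them. The layer \<open>0\<close> has no previous layer, and the layer \<open>d\<close> consists of constants, which leaves
  room for one value.
\<close>

lemma gradients_indep_of_layers:
  fixes a b :: "nat \<Rightarrow> nat"
  assumes b0: "b 0 = 0" "b d = 0"
    and ind: "\<And>e. e < d \<Longrightarrow> gradients_indep n (d - e) (a e + b e)"
    and count: "\<And>e. e < d \<Longrightarrow> (n + 1) * (a e + b e) + (if e = 0 then 0 else a (e - 1)) + b (e + 1)
        \<le> (n + (d - e)) choose n"
    and last: "d > 0 \<Longrightarrow> a (d - 1) \<le> 1"
  shows "gradients_indep (Suc n) d (\<Sum>e<d. a e + b e)"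
proof -
  define I :: "(nat \<times> bool \<times> nat) set" where
    "I = (SIGMA c:{..<d}. SIGMA u:UNIV. {..<if u then a c else b c})"
  define c :: "nat \<times> bool \<times> nat \<Rightarrow> nat" where "c = fst"
  define up :: "nat \<times> bool \<times> nat \<Rightarrow> bool" where "up i = fst (snd i)" for i
  have finI: "finite I" unfolding I_def by (intro finite_SigmaI) auto
  have cardS: "card (SIGMA u:(UNIV :: bool set). {..<if u then a e else b e}) = a e + b e" for e
    by (subst card_SigmaI) (auto simp: UNIV_bool)
  have cardI: "card I = (\<Sum>e<d. a e + b e)"
    unfolding I_def by (subst card_SigmaI) (auto intro!: finite_SigmaI simp: cardS)
  have c: "c i < d" "up i \<or> 0 < c i" if "i \<in> I" for i
  proof -
    obtain e u k where i: "i = (e, u, k)" by (cases i)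
    have "e < d" "k < (if u then a e else b e)" using that by (auto simp: I_def i)
    then show "c i < d" "up i \<or> 0 < c i"
      using b0(1) by (cases u; cases e; auto simp: c_def up_def i)+
  qed
  have nbc: "neighbour c up i \<noteq> c i" if "i \<in> I" for i
    using c[OF that] by (auto simp: neighbour_def)
  have ex: "\<exists>q. jets n (d - e) (layer n I c up e) q" if "e \<le> d" for e
  proof -
    let ?D = "{i \<in> I. c i = e}" and ?J = "{i \<in> I. neighbour c up i = e}"
    have cardD: "card ?D = (if e < d then a e + b e else 0)"
    proof (cases "e < d")
      case True
      then have "?D = {e} \<times> (SIGMA u:UNIV. {..<if u then a e else b e})" by (auto simp: I_def c_def)
      then show ?thesis using True by (simp add: card_cartesian_product cardS)
    next
      case False
      then have D: "?D = {}" using c(1) by auto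
      show ?thesis unfolding D using False by simp
    qed
    have cardJ: "card ?J \<le> (if e = 0 then 0 else a (e - 1)) + (if e + 1 < d then b (e + 1) else 0)"
    proof -
      let ?U = "(if e = 0 then {} else {e - 1} \<times> {True} \<times> {..<a (e - 1)}) \<union>
         (if e + 1 < d then {e + 1} \<times> {False} \<times> {..<b (e + 1)} else {})"
      have "?J \<subseteq> ?U"
      proof
        fix i assume i: "i \<in> ?J"
        obtain f u k where f: "i = (f, u, k)" by (cases i)
        have "f < d" "k < (if u then a f else b f)" "neighbour c up i = e" "up i \<or> 0 < c i"
          using i c(2)[of i] by (auto simp: I_def f)
        then show "i \<in> ?U" by (cases u; cases f) (auto simp: f neighbour_def c_def up_def)
      qed
      then have "card ?J \<le> card ?U" by (rule card_mono[rotated]) auto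
      also have "\<dots> \<le> (if e = 0 then 0 else a (e - 1)) + (if e + 1 < d then b (e + 1) else 0)"
        by (rule order_trans[OF card_Un_le]) (simp add: card_cartesian_product)
      finally show ?thesis .
    qed
    have "gradients_indep n (d - e) (card ?D)"
      using ind[of e] by (simp add: cardD gradients_indep_0)
    then obtain q where q: "jets n (d - e) (?D \<times> {..n}) q"
      using gradients_indep_obtain[of n "d - e" ?D] finI by auto
    have le: "card (?D \<times> {..n}) + card ?J \<le> (n + (d - e)) choose n"
    proof (cases "e < d")
      case True
      have "card (?D \<times> {..n}) = (n + 1) * (a e + b e)"
        using True by (simp add: card_cartesian_product cardD)
      moreover have "card ?J \<le> (if e = 0 then 0 else a (e - 1)) + b (e + 1)"
        using cardJ by (auto split: if_splits)
      ultimately show ?thesis using count[OF True] by linarith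
    next
      case False
      with that have e: "e = d" by simp
      have "card ?D = 0" unfolding cardD using e by simp
      then have "card (?D \<times> {..n}) = 0" unfolding card_cartesian_product by simp
      moreover have "card ?J \<le> 1" using cardJ last e by (cases "d = 0") auto
      ultimately show ?thesis using e by simp
    qed
    have "False" if "i \<in> ?J" "i \<in> fst ` (?D \<times> {..n})" for i
    proof -
      have i: "i \<in> I" "neighbour c up i = e" "c i = e" using that by auto
      from nbc[OF i(1)] show False unfolding i(2,3) by simp
    qed
    then have "?J \<inter> fst ` (?D \<times> {..n}) = {}" by blast
    then obtain q' where "jets n (d - e) (?D \<times> {..n} \<union> ?J \<times> {Suc n}) q'"
      using jets_insert_values[of ?J n "d - e" "?D \<times> {..n}" q] q le finI by force
    then show ?thesis unfolding layer_def by blast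
  qed
  have finL: "finite (layer n I c up e)" for e using finI by (simp add: layer_def)
  have "\<exists>q. \<forall>e\<in>{..d}. jets n (d - e) (layer n I c up e) q"
    using lineopen_Ball_meet[of "{..d}" "\<lambda>e. jets n (d - e) (layer n I c up e)"]
      jets_lineopen[OF finL] ex by auto
  then obtain q where "\<And>e. e \<le> d \<Longrightarrow> jets n (d - e) (layer n I c up e) q" by auto
  then have "gradients_indep (Suc n) d (card I)"
    using jets_of_layers[of I c d up n q] finI c by blast
  then show ?thesis by (simp only: cardI)
qed

section \<open>Binary digits and binomial coefficients\<close>

text \<open>
  Reads the binary digits of \<open>m\<close> in base \<open>N\<close>, i.e. replaces \<open>\<Sum>k. 2\<^sup>k\<close> by \<open>\<Sum>k. N\<^sup>k\<close>.
\<close>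

fun rebase :: "nat \<Rightarrow> nat \<Rightarrow> nat" where
  "rebase N m = (if m = 0 then 0 else N * rebase N (m div 2) + m mod 2)"

declare rebase.simps [simp del]

lemma rebase_0 [simp]: "rebase N 0 = 0"
  by (simp add: rebase.simps)

lemma rebase_even: "rebase N (2 * m) = N * rebase N m"
  by (cases "m = 0") (simp_all add: rebase.simps[of N "2 * m"])

lemma rebase_odd: "rebase N (2 * m + 1) = N * rebase N m + 1"
  by (subst rebase.simps) simp

lemma rebase_sum:
  assumes "finite K"
  shows "rebase N (\<Sum>k\<in>K. 2 ^ k) = (\<Sum>k\<in>K. N ^ k)"
  using assms
proof (induction "\<Sum>k\<in>K. (2::nat) ^ k" arbitrary: K rule: less_induct)
  case less
  show ?case
  proof (cases "K = {}")
    case False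
    define L where "L = (\<lambda>k. k - 1) ` (K - {0})"
    have inj: "inj_on (\<lambda>k::nat. k - 1) (K - {0})" by (auto simp: inj_on_def)
    have finL: "finite L" using less.prems by (simp add: L_def)
    have S: "(\<Sum>k\<in>K. M ^ k) = M * (\<Sum>k\<in>L. M ^ k) + (if 0 \<in> K then 1 else 0)" for M :: nat
    proof -
      have "(\<Sum>k\<in>K - {0}. M ^ k) = M * (\<Sum>k\<in>L. M ^ k)"
        unfolding L_def sum.reindex[OF inj] sum_distrib_left o_def
        by (intro sum.cong refl) (auto simp: power_eq_if)
      then show ?thesis using less.prems by (cases "0 \<in> K") (simp_all add: sum.remove[of K 0])
    qed
    have pos: "0 < (\<Sum>k\<in>K. (2::nat) ^ k)" using False less.prems by (simp add: sum_pos)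
    have "(\<Sum>k\<in>L. (2::nat) ^ k) < (\<Sum>k\<in>K. 2 ^ k)"
      using pos unfolding S[of 2] by (auto split: if_splits)
    then have IH: "rebase N (\<Sum>k\<in>L. 2 ^ k) = (\<Sum>k\<in>L. N ^ k)" using less.hyps finL by blast
    show ?thesis
    proof (cases "0 \<in> K")
      case True
      then show ?thesis unfolding S[of 2] S[of N] using rebase_odd IH by simp
    next
      case False
      then show ?thesis unfolding S[of 2] S[of N] using rebase_even IH by simp
    qed
  qed simp
qed

lemma rebase_two: "rebase 2 m = m"
proof (induction m rule: less_induct)
  case (less m)
  then show ?case by (cases "m = 0") (simp_all add: rebase.simps[of 2 m])
qed

text \<open>
  The step from \<open>n\<close> to \<open>n + 1\<close> multiplies the two sides by explicit rational factors, which the last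
  assumption compares.
\<close>

lemma Suc_mult_binomial_le:
  assumes "n0 \<le> n" "(n0 + 1) * ((n0 + a) choose n0) \<le> (n0 + b) choose n0"
    and "\<And>n. n0 \<le> n \<Longrightarrow> n + 1 + a + (n + 1) * a \<le> (n + 1) * b"
  shows "(n + 1) * ((n + a) choose n) \<le> (n + b) choose n"
  using assms(1)
proof (induction n rule: dec_induct)
  case base
  show ?case by (rule assms(2))
next
  case (step n)
  have A: "(n + 1) * ((n + 1 + c) choose (n + 1)) = (n + 1 + c) * ((n + c) choose n)" for c
    using Suc_times_binomial[of n "n + c"] by simp
  have "(n + 2) * (n + 1 + a) \<le> (n + 1) * (n + 1 + b)"
    using assms(3)[OF step.hyps(1)] by (simp add: algebra_simps)
  then have "(n + 2) * (n + 1 + a) * ((n + a) choose n) \<le> (n + 1) * (n + 1 + b) * ((n + a) choose n)"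
    by (rule mult_right_mono) simp
  also have "\<dots> = (n + 1 + b) * ((n + 1) * ((n + a) choose n))" by (simp only: mult_ac)
  also have "\<dots> \<le> (n + 1 + b) * ((n + b) choose n)"
    using step.IH by (intro mult_left_mono) simp_all
  also have "\<dots> = (n + 1) * ((n + 1 + b) choose (n + 1))" by (rule A[symmetric])
  also have "(n + 2) * (n + 1 + a) * ((n + a) choose n) = (n + 2) * ((n + 1) * ((n + 1 + a) choose (n + 1)))"
    by (simp only: A mult.assoc)
  also have "\<dots> = (n + 1) * ((n + 2) * ((n + 1 + a) choose (n + 1)))" by (rule mult.left_commute)
  finally have "(n + 2) * ((n + 1 + a) choose (n + 1)) \<le> (n + 1 + b) choose (n + 1)"
    by (simp only: mult_le_cancel1)
  then show ?case by (simp add: add.commute add.left_commute)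
qed

text \<open>
  Doubling \<open>m\<close> multiplies \<open>rebase (n + 1) m\<close> by \<open>n + 1\<close>, so an induction over binary digits needs a growth
  of the number of monomials by this factor.
\<close>

lemma binomial_doubling:
  assumes "n \<ge> 2" "m \<ge> 2"
  shows "(n + 1) * ((n + 2 * m) choose n) \<le> (n + 4 * m) choose n"
proof (rule Suc_mult_binomial_le[OF assms(1)])
  have c: "2 * ((2 + c) choose 2) = (2 + c) * (1 + c)" for c :: nat
    by (simp add: choose_two)
  have "2 * ((2 + 1) * ((2 + 2 * m) choose 2)) \<le> 2 * ((2 + 4 * m) choose 2)"
  proof -
    obtain k where k: "m = k + 2" using assms(2) by (metis add.commute le_Suc_ex)
    have "2 * ((2 + 1) * ((2 + 2 * m) choose 2)) = 3 * ((2 + 2 * m) * (1 + 2 * m))"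
      using c[of "2 * m"] by simp
    also have "\<dots> \<le> (2 + 4 * m) * (1 + 4 * m)" by (simp add: k algebra_simps)
    finally show ?thesis using c[of "4 * m"] by simp
  qed
  then show "(2 + 1) * ((2 + 2 * m) choose 2) \<le> (2 + 4 * m) choose 2" by simp
next
  fix n :: nat assume "2 \<le> n"
  then obtain l where l: "n = l + 2" by (metis add.commute le_Suc_ex)
  obtain k where k: "m = k + 2" using assms(2) by (metis add.commute le_Suc_ex)
  show "n + 1 + 2 * m + (n + 1) * (2 * m) \<le> (n + 1) * (4 * m)"
    by (simp add: k l algebra_simps)
qed

lemma binomial_doubling':
  assumes "n \<ge> 1" "m \<ge> 1"
  shows "(n + 1) * ((n + (2 * m - 1)) choose n) \<le> (n + (4 * m - 1)) choose n"
proof (rule Suc_mult_binomial_le[OF assms(1)])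
  show "(1 + 1) * ((1 + (2 * m - 1)) choose 1) \<le> (1 + (4 * m - 1)) choose 1"
    using assms by simp
next
  fix n :: nat assume "1 \<le> n"
  then obtain l where l: "n = l + 1" by (metis add.commute le_Suc_ex)
  obtain k where k: "m = k + 1" using assms(2) by (metis add.commute le_Suc_ex)
  show "n + 1 + (2 * m - 1) + (n + 1) * (2 * m - 1) \<le> (n + 1) * (4 * m - 1)"
    by (simp add: k l algebra_simps)
qed

text \<open>
  The number of points is at most the number of monomials of degree \<open>2 m - 1\<close>, as is necessary for arbitrary values
  of forms of degree \<open>D - 2\<close>.
\<close>

lemma rebase_le_binomial:
  assumes "n \<ge> 1" "m \<ge> 1"
  shows "n * rebase (n + 1) m + 1 \<le> (n + (2 * m - 1)) choose n"
  using assms(2)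
proof (induction m rule: less_induct)
  case (less m)
  show ?case
  proof (cases "m = 1")
    case True
    then show ?thesis by (simp add: rebase.simps)
  next
    case False
    define k where "k = m div 2"
    have k: "k \<ge> 1" "k < m" using False less.prems by (auto simp: k_def)
    have "(n + 1) * (n * rebase (n + 1) k + 1) \<le> (n + 1) * ((n + (2 * k - 1)) choose n)"
      using less.IH[OF k(2,1)] by (rule mult_left_mono) simp
    also have "\<dots> \<le> (n + (4 * k - 1)) choose n" by (rule binomial_doubling'[OF assms(1) k(1)])
    also have "\<dots> \<le> (n + (2 * m - 1)) choose n" by (rule binomial_right_mono) (simp add: k_def)
    finally have *: "(n + 1) * (n * rebase (n + 1) k + 1) \<le> (n + (2 * m - 1)) choose n" .
    have "m = 2 * k \<or> m = 2 * k + 1" by (auto simp: k_def)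
    then have "n * rebase (n + 1) m + 1 \<le> (n + 1) * (n * rebase (n + 1) k + 1)"
      by (elim disjE; simp only: rebase_even rebase_odd) (simp_all add: algebra_simps)
    then show ?thesis using * by linarith
  qed
qed

text \<open>
  This many double points impose fewer conditions than there are monomials of degree \<open>2 m\<close>, hence one more point
  can be added to them.
\<close>

definition roomy :: "nat \<Rightarrow> nat \<Rightarrow> bool" where
  "roomy n m \<longleftrightarrow> n * (n + 1) * rebase (n + 1) m < (n + 2 * m) choose n"

lemma fact_mult_binomial: "fact k * ((n + k) choose n) = (\<Prod>i=1..k. n + i)"
proof (induction k)
  case (Suc k)
  have "(n + Suc k) choose n = (n + Suc k) choose Suc k"
    using binomial_symmetric[of n "n + Suc k"] by simp
  moreover have "(n + k) choose n = (n + k) choose k"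
    using binomial_symmetric[of n "n + k"] by simp
  ultimately have "Suc k * ((n + Suc k) choose n) = (n + Suc k) * ((n + k) choose n)"
    using Suc_times_binomial[of k "n + k"] by simp
  moreover have "fact (Suc k) * ((n + Suc k) choose n) = fact k * (Suc k * ((n + Suc k) choose n))"
    by (simp only: fact_Suc of_nat_id mult_ac)
  ultimately have "fact (Suc k) * ((n + Suc k) choose n) = (n + Suc k) * (fact k * ((n + k) choose n))"
    by (simp only: mult_ac)
  then show ?case by (simp add: Suc mult.commute)
qed simp

lemma roomyI:
  assumes "fact (2 * m) * (n * (n + 1) * rebase (n + 1) m) < (\<Prod>i=1..2 * m. n + i)"
  shows "roomy n m"
  using assms unfolding fact_mult_binomial[symmetric] roomy_def by simp

lemma roomy_even:
  assumes "roomy n m" "n \<ge> 2" "m \<ge> 2"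
  shows "roomy n (2 * m)"
proof -
  have "n * (n + 1) * rebase (n + 1) (2 * m) < (n + 1) * (n * (n + 1) * rebase (n + 1) m + 1)"
    by (simp only: rebase_even) (simp add: algebra_simps)
  also have "\<dots> \<le> (n + 1) * ((n + 2 * m) choose n)"
    using assms(1) unfolding roomy_def by (intro mult_left_mono) simp_all
  also have "\<dots> \<le> (n + 4 * m) choose n" by (rule binomial_doubling[OF assms(2,3)])
  finally show ?thesis by (simp add: roomy_def)
qed

lemma roomy_odd:
  assumes "roomy n m" "n \<ge> 2" "m \<ge> 2"
  shows "roomy n (2 * m + 1)"
proof -
  obtain l where l: "n = Suc l" using assms(2) by (cases n) auto
  have inc: "(n + k + 1) choose n \<ge> ((n + k) choose n) + ((n + 1) choose 2)" if "k \<ge> 1" for k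
  proof -
    have "(n + 1) choose 2 = (n + 1) choose l"
      using binomial_symmetric[of 2 "n + 1"] assms(2) by (simp add: l)
    also have "\<dots> \<le> (n + k) choose l" using that by (intro binomial_right_mono) simp
    finally show ?thesis by (simp add: l)
  qed
  have n2: "n * (n + 1) \<le> 2 * ((n + 1) choose 2)" by (simp add: choose_two)
  have "n * (n + 1) * rebase (n + 1) (2 * m + 1)
      = (n + 1) * (n * (n + 1) * rebase (n + 1) m + 1) + n * (n + 1) - (n + 1)"
    unfolding rebase_odd by (simp add: algebra_simps)
  also have "\<dots> < (n + 1) * (n * (n + 1) * rebase (n + 1) m + 1) + n * (n + 1)" by simp
  also have "(n + 1) * (n * (n + 1) * rebase (n + 1) m + 1) \<le> (n + 1) * ((n + 2 * m) choose n)"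
    using assms(1) unfolding roomy_def by (intro mult_left_mono) simp_all
  also have "\<dots> \<le> (n + 4 * m) choose n" by (rule binomial_doubling[OF assms(2,3)])
  finally have "n * (n + 1) * rebase (n + 1) (2 * m + 1) < ((n + 4 * m) choose n) + n * (n + 1)" by simp
  also have "\<dots> \<le> (n + 4 * m + 2) choose n"
    using inc[of "4 * m"] inc[of "4 * m + 1"] n2 assms(3) by simp
  finally show ?thesis unfolding roomy_def by (simp add: algebra_simps)
qed

lemma rebase_numeral:
  "rebase N 1 = 1" "rebase N 2 = N" "rebase N 3 = N + 1" "rebase N 4 = N * N"
  "rebase N 5 = N * N + 1" "rebase N 8 = N * (N * N)" "rebase N 9 = N * (N * N) + 1"
  "rebase N 16 = N * (N * (N * N))" "rebase N 17 = N * (N * (N * N)) + 1"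
proof -
  show 1: "rebase N 1 = 1" using rebase_odd[of N 0] by simp
  show 2: "rebase N 2 = N" using rebase_even[of N 1] 1 by simp
  show "rebase N 3 = N + 1" using rebase_odd[of N 1] 1 by simp
  show 4: "rebase N 4 = N * N" using rebase_even[of N 2] 2 by simp
  show "rebase N 5 = N * N + 1" using rebase_odd[of N 2] 2 by simp
  show 8: "rebase N 8 = N * (N * N)" using rebase_even[of N 4] 4 by simp
  show "rebase N 9 = N * (N * N) + 1" using rebase_odd[of N 4] 4 by simp
  show "rebase N 16 = N * (N * (N * N))" using rebase_even[of N 8] 8 by simp
  show "rebase N 17 = N * (N * (N * N)) + 1" using rebase_odd[of N 8] 8 by simp
qed

lemma prod_upto_numeral:
  fixes n :: nat
  shows "(\<Prod>i=1..3. n + i) = (n + 1) * (n + 2) * (n + 3)"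
    "(\<Prod>i=1..4. n + i) = (n + 1) * (n + 2) * (n + 3) * (n + 4)"
    "(\<Prod>i=1..5. n + i) = (n + 1) * (n + 2) * (n + 3) * (n + 4) * (n + 5)"
    "(\<Prod>i=1..6. n + i) = (n + 1) * (n + 2) * (n + 3) * (n + 4) * (n + 5) * (n + 6)"
    "(\<Prod>i=1..8. n + i) = (n + 1) * (n + 2) * (n + 3) * (n + 4) * (n + 5) * (n + 6) * (n + 7) * (n + 8)"
    "(\<Prod>i=1..10. n + i) = (n + 1) * (n + 2) * (n + 3) * (n + 4) * (n + 5) * (n + 6) * (n + 7) * (n + 8) * (n + 9) * (n + 10)"
proof -
  have step: "(\<Prod>i=1..Suc k. n + i) = (\<Prod>i=1..k. n + i) * (n + Suc k)" for k by simp
  have p2: "(\<Prod>i=1..2. n + i) = (n + 1) * (n + 2)"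
  proof -
    have "{1..2::nat} = {1, 2}" by auto
    then show ?thesis by (simp only:) simp
  qed
  show p3: "(\<Prod>i=1..3. n + i) = (n + 1) * (n + 2) * (n + 3)"
    using step[of 2] unfolding p2 by (simp only: Suc_numeral semiring_norm)
  show p4: "(\<Prod>i=1..4. n + i) = (n + 1) * (n + 2) * (n + 3) * (n + 4)"
    using step[of 3] unfolding p3 by (simp only: Suc_numeral semiring_norm)
  show p5: "(\<Prod>i=1..5. n + i) = (n + 1) * (n + 2) * (n + 3) * (n + 4) * (n + 5)"
    using step[of 4] unfolding p4 by (simp only: Suc_numeral semiring_norm)
  show p6: "(\<Prod>i=1..6. n + i) = (n + 1) * (n + 2) * (n + 3) * (n + 4) * (n + 5) * (n + 6)"
    using step[of 5] unfolding p5 by (simp only: Suc_numeral semiring_norm)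
  have p7: "(\<Prod>i=1..7. n + i) = (n + 1) * (n + 2) * (n + 3) * (n + 4) * (n + 5) * (n + 6) * (n + 7)"
    using step[of 6] unfolding p6 by (simp only: Suc_numeral semiring_norm)
  show p8: "(\<Prod>i=1..8. n + i) = (n + 1) * (n + 2) * (n + 3) * (n + 4) * (n + 5) * (n + 6) * (n + 7) * (n + 8)"
    using step[of 7] unfolding p7 by (simp only: Suc_numeral semiring_norm)
  have p9: "(\<Prod>i=1..9. n + i) = (n + 1) * (n + 2) * (n + 3) * (n + 4) * (n + 5) * (n + 6) * (n + 7) * (n + 8) * (n + 9)"
    using step[of 8] unfolding p8 by (simp only: Suc_numeral semiring_norm)
  show p10: "(\<Prod>i=1..10. n + i) = (n + 1) * (n + 2) * (n + 3) * (n + 4) * (n + 5) * (n + 6) * (n + 7) * (n + 8) * (n + 9) * (n + 10)"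
    using step[of 9] unfolding p9 by (simp only: Suc_numeral semiring_norm)
qed

lemma small_numerals:
  "2 * 3 = (6 :: nat)" "2 * 4 = (8 :: nat)" "2 * 5 = (10 :: nat)"
  "fact 6 = (720 :: nat)" "fact 8 = (40320 :: nat)" "fact 10 = (3628800 :: nat)"
  by (simp_all add: fact_numeral)

lemma roomy_3:
  assumes "n \<ge> 2"
  shows "roomy n 3"
proof -
  obtain k where k: "n = k + 2" using assms by (metis add.commute le_Suc_ex)
  have "720 * (n * (n + 1) * (n + 1 + 1)) < (n + 1) * (n + 2) * (n + 3) * (n + 4) * (n + 5) * (n + 6)"
    by (simp add: k algebra_simps)
  then show ?thesis
    by (intro roomyI) (simp only: rebase_numeral prod_upto_numeral small_numerals)
qed

lemma roomy_4:
  assumes "n \<ge> 5"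
  shows "roomy n 4"
proof -
  obtain k where k: "n = k + 5" using assms by (metis add.commute le_Suc_ex)
  have "40320 * (n * (n + 1) * ((n + 1) * (n + 1)))
      < (n + 1) * (n + 2) * (n + 3) * (n + 4) * (n + 5) * (n + 6) * (n + 7) * (n + 8)"
    by (simp add: k algebra_simps)
  then show ?thesis
    by (intro roomyI) (simp only: rebase_numeral prod_upto_numeral small_numerals)
qed

lemma roomy_5:
  assumes "n \<ge> 2"
  shows "roomy n 5"
proof -
  obtain k where k: "n = k + 2" using assms by (metis add.commute le_Suc_ex)
  have "3628800 * (n * (n + 1) * ((n + 1) * (n + 1) + 1))
      < (n + 1) * (n + 2) * (n + 3) * (n + 4) * (n + 5) * (n + 6) * (n + 7) * (n + 8) * (n + 9) * (n + 10)"
    by (simp add: k algebra_simps)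
  then show ?thesis
    by (intro roomyI) (simp only: rebase_numeral prod_upto_numeral small_numerals)
qed

lemma fact_mult_binomial': "fact n * ((n + k) choose n) = (\<Prod>i=1..n. k + i)"
  using fact_mult_binomial[of n k] binomial_symmetric[of n "n + k"] by (simp add: add.commute)

lemma choose_3: "6 * ((3 + k) choose 3) = (k + 1) * (k + 2) * (k + 3)"
  and choose_4: "24 * ((4 + k) choose 4) = (k + 1) * (k + 2) * (k + 3) * (k + 4)"
  using fact_mult_binomial'[of 3 k] fact_mult_binomial'[of 4 k]
  by (simp_all only: prod_upto_numeral) (simp_all add: fact_numeral)

lemma roomy_small:
  "roomy 3 8" "roomy 4 8" "roomy 2 9" "roomy 3 9" "roomy 4 9" "roomy 2 16" "roomy 2 17"
  using choose_3[of 16] choose_4[of 16] choose_3[of 18] choose_4[of 18]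
  by (simp_all add: roomy_def rebase_numeral choose_two)

text \<open>
  Induction over the binary digits of \<open>m\<close>. The inequality fails for the exceptional pairs, so the successors of
  an exceptional pair are checked by hand; \<open>m = 3, 4, 5\<close> start the induction.
\<close>

lemma roomy_all:
  assumes "n \<ge> 2" "m \<ge> 3" "\<not> (m = 4 \<and> n \<le> 4)" "\<not> (m = 8 \<and> n = 2)"
  shows "roomy n m"
  using assms(2-4)
proof (induction m rule: less_induct)
  case (less m)
  define k where "k = m div 2"
  have m: "m = 2 * k \<or> m = 2 * k + 1" by (auto simp: k_def)
  consider "m = 3" | "m = 4" | "m = 5" | "m \<ge> 6" using less.prems(1) by linarith
  then show ?case
  proof cases
    case 1
    then show ?thesis using roomy_3 assms(1) by simp
  next
    case 2
    then show ?thesis using roomy_4 less.prems by simp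
  next
    case 3
    then show ?thesis using roomy_5 assms(1) by simp
  next
    case 4
    then have k: "k \<ge> 3" "k < m" by (auto simp: k_def)
    consider "k = 4" "n \<le> 4" | "k = 8" "n = 2" | "\<not> (k = 4 \<and> n \<le> 4)" "\<not> (k = 8 \<and> n = 2)" by blast
    then show ?thesis
    proof cases
      case 1
      then have "n = 2 \<or> n = 3 \<or> n = 4" using assms(1) by linarith
      then show ?thesis using m 1 roomy_small less.prems by auto
    next
      case 2
      then show ?thesis using m roomy_small by auto
    next
      case 3
      then have "roomy n k" using less.IH k by blast
      then show ?thesis using m roomy_even roomy_odd assms(1) k(1) by auto
    qed
  qed
qed

section \<open>Veronese varieties\<close>

lemma gradients_indep_linear: "gradients_indep n 1 1"
  unfolding gradients_indep_def jets_def
proof (rule exI[of _ "\<lambda>_ _. 0"], intro allI)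
  fix b :: "nat \<times> nat \<Rightarrow> complex"
  show "\<exists>F. form n 1 F \<and> (\<forall>m\<in>{..<1} \<times> {..n}. jet n (\<lambda>_ _. 0) m F = b m)"
    using form_linear[of n "\<lambda>j. b (0, j)"] pd_linear[of _ n "\<lambda>j. b (0, j)"]
    by (intro exI[of _ "\<lambda>x. \<Sum>j\<le>n. b (0, j) * x j"]) (auto simp: jet_def)
qed

lemma gradients_indep_of_roomy:
  assumes "roomy n m" "m \<ge> 1" "d \<ge> 2 * m"
  shows "gradients_indep n (Suc d) (n * rebase (n + 1) m + 1)"
proof (rule gradients_indep_of_count)
  have "(n * rebase (n + 1) m + 1 - 1) * (n + 1) = n * (n + 1) * rebase (n + 1) m" by (simp add: algebra_simps)
  also have "\<dots> < (n + 2 * m) choose n" using assms(1) by (simp add: roomy_def)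
  also have "\<dots> \<le> (n + d) choose n" using assms(3) by (intro binomial_right_mono) simp
  finally show "(n * rebase (n + 1) m + 1 - 1) * (n + 1) < (n + d) choose n" .
qed (use assms in simp)

lemma gradients_indep_of_layer_lists:
  assumes ind: "\<And>e. e < d \<Longrightarrow> gradients_indep n (d - e) (as ! e + bs ! e)"
    and "list_all (\<lambda>e. (n + 1) * (as ! e + bs ! e) + (if e = 0 then 0 else as ! (e - 1)) + bs ! (e + 1)
        \<le> (n + (d - e)) choose n) [0..<d]"
    and "bs ! 0 = 0" "bs ! d = 0" "as ! (d - 1) \<le> 1"
  shows "gradients_indep (Suc n) d (\<Sum>e\<leftarrow>[0..<d]. as ! e + bs ! e)"
proof -
  have "gradients_indep (Suc n) d (\<Sum>e<d. as ! e + bs ! e)"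
    using assms by (intro gradients_indep_of_layers) (simp_all add: list_all_iff)
  then show ?thesis by (simp add: sum_list_distinct_conv_sum_set atLeast0LessThan)
qed

lemma gradients_indep_line:
  assumes "1 \<le> e" "2 * x \<le> e + 1"
  shows "gradients_indep 1 e x"
proof (cases "e = 1")
  case True
  then show ?thesis using assms gradients_indep_linear gradients_indep_mono[of 1 1 1 x] by simp
next
  case False
  then obtain d where d: "e = Suc d" "d \<ge> 1" using assms(1) by (cases e) auto
  then show ?thesis using assms(2) gradients_indep_of_count[of d x 1] by auto
qed

text \<open>
  On a line every number of points up to the count works, so only the inequalities for the layers remain.
\<close>

lemma gradients_indep_plane:
  assumes *: "list_all (\<lambda>e. 2 * (as ! e + bs ! e) + (if e = 0 then 0 else as ! (e - 1)) + bs ! (e + 1)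
        \<le> d - e + 1) [0..<d]"
    and "bs ! 0 = 0" "bs ! d = 0" "as ! (d - 1) \<le> 1"
  shows "gradients_indep 2 d (\<Sum>e\<leftarrow>[0..<d]. as ! e + bs ! e)"
proof -
  have "gradients_indep (Suc 1) d (\<Sum>e\<leftarrow>[0..<d]. as ! e + bs ! e)"
  proof (rule gradients_indep_of_layer_lists)
    fix e assume "e < d"
    then have "2 * (as ! e + bs ! e) + (if e = 0 then 0 else as ! (e - 1)) + bs ! (e + 1) \<le> d - e + 1"
      using * unfolding list_all_iff by simp
    then have "2 * (as ! e + bs ! e) \<le> d - e + 1" by linarith
    with \<open>e < d\<close> show "gradients_indep 1 (d - e) (as ! e + bs ! e)" by (intro gradients_indep_line) simp_all
  next
    have eq: "(1 + (d - e)) choose 1 = d - e + 1" for e by simp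
    show "list_all (\<lambda>e. (1 + 1) * (as ! e + bs ! e) + (if e = 0 then 0 else as ! (e - 1)) + bs ! (e + 1)
        \<le> (1 + (d - e)) choose 1) [0..<d]"
      unfolding eq one_add_one by (rule *)
  qed (use assms in simp_all)
  then show ?thesis by (simp add: numeral_2_eq_2)
qed

text \<open>
  The lists of this and the following lemmas solve the inequalities of \<open>gradients_indep_plane\<close>: their \<open>e\<close>-th entries count
  the points of the layer \<open>e\<close> with the next and with the previous layer as neighbour. The
  results are optimal, as \<open>3 \<cdot> 7 = 21\<close>, \<open>3 \<cdot> 18 = 54\<close> and \<open>3 \<cdot> 57 = 171\<close>, and there are \<open>21\<close>, \<open>55\<close> and
  \<open>171\<close> monomials.
\<close>

lemma gradients_indep_2_5: "gradients_indep 2 5 7"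
  using gradients_indep_plane[of "[3, 1, 1, 0, 1]" "[0, 0, 0, 1, 0, 0]" 5] by (simp add: upt_conv_Cons)

lemma gradients_indep_2_9: "gradients_indep 2 9 18"
  using gradients_indep_plane[of "[4, 1, 2, 1, 1, 1, 1, 0, 1]" "[0, 1, 1, 1, 1, 1, 0, 1, 0, 0]" 9] by (simp add: upt_conv_Cons)

lemma gradients_indep_2_17: "gradients_indep 2 17 57"
  using gradients_indep_plane[of "[8, 2, 5, 2, 3, 2, 2, 2, 2, 1, 2, 1, 1, 1, 1, 0, 1]"
      "[0, 2, 1, 2, 2, 2, 2, 2, 1, 2, 1, 1, 1, 1, 0, 1, 0, 0]" 17] by (simp add: upt_conv_Cons)

lemma less_5: "(e::nat) < 5 \<Longrightarrow> e = 0 \<or> e = 1 \<or> e = 2 \<or> e = 3 \<or> e = 4"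
  and less_9: "(e::nat) < 9 \<Longrightarrow> e = 0 \<or> e = 1 \<or> e = 2 \<or> e = 3 \<or> e = 4 \<or> e = 5 \<or> e = 6 \<or> e = 7 \<or> e = 8"
  by linarith+

lemma choose_3':
  fixes k :: nat
  assumes "3 \<le> k"
  shows "6 * (k choose 3) = (k - 2) * (k - 1) * k"
proof -
  obtain l where "k = 3 + l" using assms le_Suc_ex by blast
  then show ?thesis using choose_3[of l] by simp
qed

lemma gradients_indep_3_5: "gradients_indep 3 5 13"
proof -
  have "gradients_indep 2 5 6" "gradients_indep 2 3 3"
    using gradients_indep_of_square[of 2 6 2] gradients_indep_of_square[of 1 3 2] by (simp_all add: choose_two)
  moreover have "gradients_indep 2 4 3"
    using gradients_indep_of_count[of 3 3 2] by (simp add: choose_two)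
  moreover have "gradients_indep 2 (Suc 1) 1" by (rule gradients_indep_of_count) (simp_all add: choose_two)
  then have "gradients_indep 2 2 1" by (simp only: Suc_1)
  ultimately have "gradients_indep 2 (5 - e) ([6, 0, 3, 0, 1] ! e + [0, 3, 0, 1, 0, 0] ! e)" if "e < 5" for e
    using less_5[OF that] gradients_indep_linear[of 2] by (elim disjE) simp_all
  then have "gradients_indep (Suc 2) 5 (\<Sum>e\<leftarrow>[0..<5]. [6, 0, 3, 0, 1] ! e + [0, 3, 0, 1, 0, 0] ! e)"
    by (rule gradients_indep_of_layer_lists) (simp_all add: upt_conv_Cons choose_two)
  then have "gradients_indep 3 5 14" by (simp add: upt_conv_Cons)
  then show ?thesis by (rule gradients_indep_mono) simp
qed

text \<open>
  Here and for \<open>gradients_indep_4_9\<close> there is enough room to let all neighbours be the next layer.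
\<close>

lemma gradients_indep_3_9: "gradients_indep 3 9 49"
proof -
  have "gradients_indep 2 9 15" "gradients_indep 2 8 10" "gradients_indep 2 7 8" "gradients_indep 2 6 6" "gradients_indep 2 5 5" "gradients_indep 2 4 3" "gradients_indep 2 3 2"
    using gradients_indep_of_count[of 8 15 2] gradients_indep_of_count[of 7 10 2] gradients_indep_of_count[of 6 8 2] gradients_indep_of_count[of 5 6 2]
      gradients_indep_of_count[of 4 5 2] gradients_indep_of_count[of 3 3 2] gradients_indep_of_square[of 1 2 2]
    by (simp_all add: choose_two)
  then have "gradients_indep 2 (9 - e) ([15, 10, 8, 6, 5, 3, 2, 0, 0] ! e + replicate 10 0 ! e)" if "e < 9" for e
    using less_9[OF that] by (elim disjE) (simp_all add: gradients_indep_0)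
  then have "gradients_indep (Suc 2) 9 (\<Sum>e\<leftarrow>[0..<9]. [15, 10, 8, 6, 5, 3, 2, 0, 0] ! e + replicate 10 0 ! e)"
    by (rule gradients_indep_of_layer_lists) (simp_all add: upt_conv_Cons choose_two)
  then show ?thesis by (simp add: upt_conv_Cons)
qed

lemma gradients_indep_4_9: "gradients_indep 4 9 101"
proof -
  have "gradients_indep 3 9 42" "gradients_indep 3 8 30" "gradients_indep 3 7 21" "gradients_indep 3 6 8"
    using gradients_indep_of_count[of 8 42 3] gradients_indep_of_count[of 7 30 3] gradients_indep_of_count[of 6 21 3] gradients_indep_of_count[of 5 8 3]
      choose_3'[of 11] choose_3'[of 10] choose_3'[of 9] choose_3'[of 8]
    by simp_all
  then have "gradients_indep 3 (9 - e) ([42, 30, 21, 8, 0, 0, 0, 0, 0] ! e + replicate 10 0 ! e)" if "e < 9" for e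
    using less_9[OF that] by (elim disjE) (simp_all add: gradients_indep_0)
  then have "gradients_indep (Suc 3) 9 (\<Sum>e\<leftarrow>[0..<9]. [42, 30, 21, 8, 0, 0, 0, 0, 0] ! e + replicate 10 0 ! e)"
    using choose_3'[of 12] choose_3'[of 11] choose_3'[of 10] choose_3'[of 9] choose_3'[of 8]
    by (intro gradients_indep_of_layer_lists) (simp_all add: upt_conv_Cons)
  then show ?thesis by (simp add: upt_conv_Cons)
qed

text \<open>
  Induction over \<open>n\<close> with \<open>n (n + 1) + 1\<close>, \<open>n + 1\<close> and \<open>n + 1\<close> points in the layers \<open>0, 1, 2\<close> of degrees \<open>5, 4, 3\<close>;
  their sum is the number for \<open>n + 1\<close>.
\<close>

lemma gradients_indep_quintic:
  assumes "n \<ge> 3"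
  shows "gradients_indep n 5 (n * (n + 1) + 1)"
  using assms
proof (induction n rule: dec_induct)
  case base
  then show ?case using gradients_indep_3_5 by simp
next
  case (step k)
  obtain l where l: "k = l + 3" using step.hyps by (metis add.commute le_Suc_ex)
  have c: "fact j * ((k + j) choose k) = (\<Prod>i=1..j. k + i)" for j by (rule fact_mult_binomial)
  have c3: "6 * ((k + 3) choose k) = (k + 1) * (k + 2) * (k + 3)"
    using c[of 3] unfolding prod_upto_numeral by (simp add: fact_numeral)
  have c4: "24 * ((k + 4) choose k) = (k + 1) * (k + 2) * (k + 3) * (k + 4)"
    using c[of 4] unfolding prod_upto_numeral by (simp add: fact_numeral)
  have c5: "120 * ((k + 5) choose k) = (k + 1) * (k + 2) * (k + 3) * (k + 4) * (k + 5)"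
    using c[of 5] unfolding prod_upto_numeral by (simp add: fact_numeral)
  define a where "a e = (if e = 0 then k * (k + 1) + 1 else if e \<le> 2 then k + 1 else 0)" for e :: nat
  have "6 * (k * (k + 1)) < 6 * ((k + 3) choose k)" unfolding c3 by (simp add: l algebra_simps)
  then have "gradients_indep k 4 (k + 1)" using gradients_indep_of_count[of 3 "k + 1" k] by simp
  moreover have "gradients_indep k 3 (k + 1)" using gradients_indep_of_square[of 1 "k + 1" k] by simp
  ultimately have ind: "gradients_indep k (5 - e) (a e + 0)" if "e < 5" for e
    using less_5[OF that] step.IH by (auto simp: a_def gradients_indep_0)
  have "120 * ((k + 1) * (k * (k + 1) + 1)) \<le> 120 * ((k + 5) choose k)"
    unfolding c5 by (simp add: l algebra_simps)
  then have 0: "(k + 1) * (k * (k + 1) + 1) \<le> (k + 5) choose k" by (simp only: mult_le_cancel1)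
  have "24 * ((k + 1) * (k + 1) + (k * (k + 1) + 1)) \<le> 24 * ((k + 4) choose k)"
    unfolding c4 by (simp add: l algebra_simps)
  then have 1: "(k + 1) * (k + 1) + (k * (k + 1) + 1) \<le> (k + 4) choose k" by (simp only: mult_le_cancel1)
  have "6 * ((k + 1) * (k + 1) + (k + 1)) \<le> 6 * ((k + 3) choose k)"
    unfolding c3 by (simp add: l algebra_simps)
  then have 2: "(k + 1) * (k + 1) + (k + 1) \<le> (k + 3) choose k" by (simp only: mult_le_cancel1)
  have 3: "k + 1 \<le> (k + 2) choose k"
    using binomial_right_mono[of "k + 1" "k + 2" k] by simp
  have count: "(k + 1) * (a e + 0) + (if e = 0 then 0 else a (e - 1)) + 0 \<le> (k + (5 - e)) choose k" if "e < 5" for e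
    using less_5[OF that] 0 1 2 3 by (elim disjE; simp only: a_def) simp_all
  have "gradients_indep (Suc k) 5 (\<Sum>e<5. a e + 0)"
    by (rule gradients_indep_of_layers[of "\<lambda>_. 0"]) (use ind count in \<open>simp_all add: a_def\<close>)
  moreover have "(\<Sum>e<5. a e + 0) = Suc k * (Suc k + 1) + 1"
    by (simp add: a_def eval_nat_numeral)
  ultimately show ?case by simp
qed

text \<open>
  For \<open>m = 1\<close> squares handle the cubics, and a count handles the quartics. For \<open>d = 2 m + 2\<close> and for roomy pairs
  a count suffices; the quintics and the pairs that are not roomy were treated by layers. The bound
  fails for \<open>n = 2\<close> and \<open>d = 9\<close>, where it is \<open>19\<close> and \<open>19 \<cdot> 3 > 55\<close>.
\<close>

lemma gradients_indep_veronese: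
  assumes "n \<ge> 1" "m \<ge> 1" "d = 2 * m + 1 \<or> d = 2 * m + 2" "\<not> (n = 2 \<and> d = 9)"
  shows "gradients_indep n d (n * rebase (n + 1) m + 1)"
proof -
  have d: "d = Suc (d - 1)" "d - 1 \<ge> 2 * m" "d - 1 \<ge> 1" using assms by auto
  have roomy: "gradients_indep n d (n * rebase (n + 1) m + 1)" if "roomy n m"
    using gradients_indep_of_roomy[OF that assms(2) d(2)] d(1) by simp
  consider "n = 1" | "n \<ge> 2" "m = 1" | "n \<ge> 2" "m = 2" | "n \<ge> 2" "m = 4" "n \<le> 4" | "n = 2" "m = 8"
    | "n \<ge> 2" "m \<ge> 3" "\<not> (m = 4 \<and> n \<le> 4)" "\<not> (m = 8 \<and> n = 2)"
    using assms(1,2) by linarith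
  then show ?thesis
  proof cases
    case 1
    have "roomy 1 m" by (simp add: roomy_def rebase_two[unfolded numeral_2_eq_2] numeral_2_eq_2)
    then show ?thesis using roomy 1 by simp
  next
    case 2
    have c3: "6 * ((n + 3) choose n) = (n + 1) * (n + 2) * (n + 3)"
      using fact_mult_binomial[of 3 n] unfolding prod_upto_numeral by (simp add: fact_numeral)
    obtain l where l: "n = l + 2" using 2 by (metis add.commute le_Suc_ex)
    have "6 * (n * (n + 1)) < 6 * ((n + 3) choose n)" unfolding c3 by (simp add: l algebra_simps)
    then have "gradients_indep n 4 (n + 1)" using gradients_indep_of_count[of 3 "n + 1" n] by simp
    moreover have "gradients_indep n 3 (n + 1)" using gradients_indep_of_square[of 1 "n + 1" n] by simp
    ultimately show ?thesis using 2 assms(3) by (auto simp: rebase_numeral[unfolded One_nat_def])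
  next
    case 3
    have c5: "120 * ((n + 5) choose n) = (n + 1) * (n + 2) * (n + 3) * (n + 4) * (n + 5)"
      using fact_mult_binomial[of 5 n] unfolding prod_upto_numeral by (simp add: fact_numeral)
    obtain l where l: "n = l + 2" using 3 by (metis add.commute le_Suc_ex)
    have "120 * (n * (n + 1) * (n + 1)) < 120 * ((n + 5) choose n)"
      unfolding c5 by (simp add: l algebra_simps)
    then have "gradients_indep n 6 (n * (n + 1) + 1)" using gradients_indep_of_count[of 5 "n * (n + 1) + 1" n] by simp
    moreover have "gradients_indep n 5 (n * (n + 1) + 1)"
      using gradients_indep_quintic[of n] gradients_indep_2_5 3 by (cases "n = 2") simp_all
    ultimately show ?thesis using 3 assms(3) by (auto simp: rebase_numeral)
  next
    case 4
    then have n: "n = 2 \<or> n = 3 \<or> n = 4" by linarith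
    have "gradients_indep 2 10 19" "gradients_indep 3 10 49" "gradients_indep 4 10 101"
      using gradients_indep_of_count[of 9 19 2] gradients_indep_of_count[of 9 49 3] gradients_indep_of_count[of 9 101 4]
        choose_3[of 9] choose_4[of 9] by (simp_all add: choose_two)
    then show ?thesis using n 4 assms(3,4) gradients_indep_3_9 gradients_indep_4_9 by (auto simp: rebase_numeral)
  next
    case 5
    have "gradients_indep 2 18 55" using gradients_indep_of_count[of 17 55 2] by (simp add: choose_two)
    moreover have "gradients_indep 2 17 55" using gradients_indep_2_17 by (rule gradients_indep_mono) simp
    ultimately show ?thesis using 5 assms(3) by (auto simp: rebase_numeral)
  next
    case 6
    then show ?thesis using roomy roomy_all by blast
  qed
qed

section \<open>Homogeneous polynomials as graded forms\<close>

abbreviation hform :: "'i set \<Rightarrow> nat \<Rightarrow> (('i \<Rightarrow> complex) \<Rightarrow> complex) \<Rightarrow> bool" where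
  "hform I \<equiv> gform (\<lambda>_. 1) I"

lemma hform_of_hom_poly:
  assumes "F \<in> hom_polys I"
  shows "\<exists>k. hform I k (poly_eval F)"
proof -
  obtain k where k: "\<And>m. m \<in> Poly_Mapping.keys F \<Longrightarrow> Poly_Mapping.keys m \<subseteq> I \<and> mon_deg m = k"
    using assms unfolding hom_polys_def by blast
  have mon: "hform I k (mon_eval m)" if "m \<in> Poly_Mapping.keys F" for m
  proof -
    have "hform I (\<Sum>i\<in>Poly_Mapping.keys m. \<Sum>l<Poly_Mapping.lookup m i. 1) (\<lambda>v. \<Prod>i\<in>Poly_Mapping.keys m. v i ^ Poly_Mapping.lookup m i)"
      using k[OF that] by (intro gform_prod gform_power gform.var) auto
    then show ?thesis using k[OF that] by (simp add: mon_eval_def[abs_def] mon_deg_def)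
  qed
  show ?thesis
  proof (cases "Poly_Mapping.keys F = {}")
    case True
    then have "poly_eval F = (\<lambda>_. 0)" by (simp add: poly_eval_def fun_eq_iff)
    then show ?thesis using gform.const by metis
  next
    case False
    then obtain m where "m \<in> Poly_Mapping.keys F" by blast
    then have "hform I k (\<lambda>v. \<Sum>m\<in>Poly_Mapping.keys F. Poly_Mapping.lookup F m * mon_eval m v)"
      by (intro gform_sum[OF mon] gform_cmult mon)
    then show ?thesis unfolding poly_eval_def[abs_def] by blast
  qed
qed

lemma hom_poly_of_hform:
  assumes "hform I k g"
  shows "\<exists>F\<in>hom_polys I. poly_eval F = g"
proof -
  have "\<exists>F. (\<forall>m\<in>Poly_Mapping.keys F. Poly_Mapping.keys m \<subseteq> I \<and> mon_deg m = k) \<and> poly_eval F = g"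
    using assms
  proof induction
    case (const c)
    show ?case
      by (rule exI[of _ "Poly_Mapping.single 0 c"]) (auto simp: poly_eval_single mon_eval_def mon_deg_def fun_eq_iff)
  next
    case (var v)
    then show ?case
      by (intro exI[of _ "Poly_Mapping.single (Poly_Mapping.single v 1) 1"])
         (auto simp: poly_eval_single mon_eval_def mon_deg_def fun_eq_iff)
  next
    case (add g F G)
    then obtain P Q where
      P: "\<forall>m\<in>Poly_Mapping.keys P. Poly_Mapping.keys m \<subseteq> I \<and> mon_deg m = g" "poly_eval P = F" and
      Q: "\<forall>m\<in>Poly_Mapping.keys Q. Poly_Mapping.keys m \<subseteq> I \<and> mon_deg m = g" "poly_eval Q = G"
      by blast
    have "\<forall>m\<in>Poly_Mapping.keys (P + Q). Poly_Mapping.keys m \<subseteq> I \<and> mon_deg m = g"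
      using P(1) Q(1) keys_add[of P Q] by blast
    moreover have "poly_eval (P + Q) = (\<lambda>x. F x + G x)"
      by (simp add: fun_eq_iff poly_eval_add P(2) Q(2))
    ultimately show ?case by blast
  next
    case (mult g F h G)
    then obtain P Q where
      P: "\<forall>m\<in>Poly_Mapping.keys P. Poly_Mapping.keys m \<subseteq> I \<and> mon_deg m = g" "poly_eval P = F" and
      Q: "\<forall>m\<in>Poly_Mapping.keys Q. Poly_Mapping.keys m \<subseteq> I \<and> mon_deg m = h" "poly_eval Q = G"
      by blast
    have "Poly_Mapping.keys m \<subseteq> I \<and> mon_deg m = g + h" if m: "m \<in> Poly_Mapping.keys (P * Q)" for m
    proof -
      obtain a b where ab: "a \<in> Poly_Mapping.keys P" "b \<in> Poly_Mapping.keys Q" "m = a + b"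
        using m keys_mult[of P Q] by blast
      have "Poly_Mapping.keys a \<subseteq> I \<and> mon_deg a = g" "Poly_Mapping.keys b \<subseteq> I \<and> mon_deg b = h"
        using P(1) Q(1) ab(1,2) by simp_all
      then show ?thesis using keys_add[of a b] unfolding ab(3) by (auto simp: mon_deg_add)
    qed
    moreover have "poly_eval (P * Q) = (\<lambda>x. F x * G x)"
      by (simp add: fun_eq_iff poly_eval_mult P(2) Q(2))
    ultimately show ?case by blast
  qed
  then show ?thesis unfolding hom_polys_def by blast
qed

lemma hform_scale: "hform I k g \<Longrightarrow> g (\<lambda>i. c * v i) = c ^ k * g v"
  by (induction rule: gform.induct) (simp_all add: algebra_simps power_add)

lemma hform_zero:
  assumes "hform I k g" "k > 0"
  shows "g (\<lambda>_. 0) = 0"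
  using hform_scale[OF assms(1), of 0 "\<lambda>_. 0"] assms(2) by (simp add: power_0_left)

lemma mem_pt: "v \<in> pt v"
  unfolding pt_def by (rule cvec.span_base) simp

lemma proj_space_pt: "p \<in> proj_space I \<Longrightarrow> \<exists>v. p = pt v \<and> v \<noteq> 0 \<and> v \<in> cvecs I"
  by (auto simp: proj_space_def)

lemma pt_eqD: "pt v = pt w \<Longrightarrow> \<exists>c. v = (\<lambda>i. c * w i)"
  using mem_pt[of v] by (auto simp: pt_eq)

lemma closedin_hform:
  assumes "hform I k g" "Z \<subseteq> proj_space I"
  shows "closedin (subtopology (zariski I) Z) {p \<in> Z. \<forall>v. p = pt v \<longrightarrow> g v = 0}"
proof -
  obtain F where F: "F \<in> hom_polys I" "poly_eval F = g" using hom_poly_of_hform[OF assms(1)] by blast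
  have "{p \<in> Z. \<forall>v. p = pt v \<longrightarrow> g v = 0} = zero_locus I {F} \<inter> Z"
  proof (intro set_eqI iffI)
    fix p assume p: "p \<in> {p \<in> Z. \<forall>v. p = pt v \<longrightarrow> g v = 0}"
    then obtain v where "p = pt v" using assms(2) proj_space_pt by blast
    then show "p \<in> zero_locus I {F} \<inter> Z"
      using p F assms(2) pt_in_zero_locus_iff[of "{F}" I v] by auto
  next
    fix p assume p: "p \<in> zero_locus I {F} \<inter> Z"
    then show "p \<in> {p \<in> Z. \<forall>v. p = pt v \<longrightarrow> g v = 0}"
      using F pt_in_zero_locus_iff[of "{F}" I] by auto
  qed
  moreover have "closedin (zariski I) (zero_locus I {F})"
    using F(1) unfolding closedin_zariski_iff by blast
  ultimately show ?thesis unfolding closedin_subtopology by blast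
qed

text \<open>
  The zero sets of \<open>g\<close> and \<open>h\<close> in \<open>Z\<close> are closed and cover \<open>Z\<close>, so one of them is all of \<open>Z\<close>: forms on an irreducible set
  have no zero divisors.
\<close>

lemma irreducible_hform_mult:
  assumes irr: "irreduciblein (subtopology (zariski I) X) Z"
    and g: "hform I k g" "hform I l h" "\<And>v. pt v \<in> Z \<Longrightarrow> g v * h v = 0"
  shows "(\<forall>v. pt v \<in> Z \<longrightarrow> g v = 0) \<or> (\<forall>v. pt v \<in> Z \<longrightarrow> h v = 0)"
proof -
  have Z: "Z \<subseteq> proj_space I" "Z \<subseteq> X" and
    *: "irreducible_space (subtopology (subtopology (zariski I) X) Z)"
    using irr by (auto simp: irreduciblein_def)
  have st: "subtopology (subtopology (zariski I) X) Z = subtopology (zariski I) Z"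
    using Z(2) by (simp add: subtopology_subtopology Int_absorb1)
  have ts: "topspace (subtopology (zariski I) Z) = Z" using Z(1) by auto
  let ?A = "\<lambda>g. {p \<in> Z. \<forall>v. p = pt v \<longrightarrow> g v = 0}"
  have "?A g \<union> ?A h = Z"
  proof -
    have "p \<in> ?A g \<union> ?A h" if p: "p \<in> Z" for p
    proof (rule ccontr)
      assume "p \<notin> ?A g \<union> ?A h"
      then obtain v w where vw: "p = pt v" "g v \<noteq> 0" "p = pt w" "h w \<noteq> 0" using p by blast
      obtain c where c: "w = (\<lambda>i. c * v i)" using pt_eqD[of w v] vw by metis
      have "h w = c ^ l * h v" unfolding c by (rule hform_scale[OF g(2)])
      then have "h v \<noteq> 0" using vw(4) by auto
      then show False using g(3)[of v] p vw by auto
    qed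
    then show ?thesis by blast
  qed
  moreover have "closedin (subtopology (zariski I) Z) (?A g)" "closedin (subtopology (zariski I) Z) (?A h)"
    using closedin_hform g Z(1) by blast+
  ultimately have "?A g = Z \<or> ?A h = Z"
    using * unfolding irreducible_space_def st ts by blast
  then show ?thesis by blast
qed

section \<open>Irreducible chains and independent forms\<close>

lemma span_mult:
  assumes "F \<in> cvec.span S" "G \<in> cvec.span T"
    and ST: "\<And>f g. f \<in> S \<Longrightarrow> g \<in> T \<Longrightarrow> (\<lambda>x. f x * g x) \<in> cvec.span U"
  shows "(\<lambda>x. F x * G x) \<in> cvec.span U"
proof -
  have 1: "(\<lambda>x. f x * G x) \<in> cvec.span U" if "f \<in> S" for f
    using assms(2)
  proof (induction rule: cvec.span_induct_alt)
    case base
    then show ?case using cvec.span_zero[of U] by (simp add: zero_fun_def)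
  next
    case (step c g G)
    have "(\<lambda>x. f x * ((\<lambda>i. c * g i) + G) x) = (\<lambda>i. c * (f i * g i)) + (\<lambda>x. f x * G x)"
      by (auto simp: fun_eq_iff algebra_simps)
    then show ?case using step that by (simp add: cvec.span_add cvec.span_scale ST)
  qed
  show ?thesis
    using assms(1)
  proof (induction rule: cvec.span_induct_alt)
    case base
    then show ?case using cvec.span_zero[of U] by (simp add: zero_fun_def)
  next
    case (step c f F)
    have "(\<lambda>x. ((\<lambda>i. c * f i) + F) x * G x) = (\<lambda>i. c * (f i * G i)) + (\<lambda>x. F x * G x)"
      by (auto simp: fun_eq_iff algebra_simps)
    then show ?case using step by (simp add: cvec.span_add cvec.span_scale 1)
  qed
qed

lemma mon_mult: "mon V a x * mon V b x = mon V (\<lambda>v. a v + b v) x"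
  by (simp add: mon_def power_add prod.distrib)

lemma mon_zero: "mon V (\<lambda>_. 0) x = 1"
  by (simp add: mon_def)

lemma mon_unit: "finite V \<Longrightarrow> v \<in> V \<Longrightarrow> mon V (\<lambda>w. if w = v then 1 else 0) x = x v"
  by (simp add: mon_def if_distrib prod.delta cong: if_cong)

text \<open>
  The exponents of the monomials of degree \<open>g\<close>; the inner sum is the multiple \<open>a v\<close> of \<open>dg v\<close> in the monoid.
\<close>

definition graded_exps :: "('v \<Rightarrow> 'g::comm_monoid_add) \<Rightarrow> 'v set \<Rightarrow> 'g \<Rightarrow> ('v \<Rightarrow> nat) set" where
  "graded_exps dg V g = {a. (\<forall>v. v \<notin> V \<longrightarrow> a v = 0) \<and> (\<Sum>v\<in>V. \<Sum>i<a v. dg v) = g}"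

lemma sum_lessThan_add:
  fixes a b :: nat
  shows "(\<Sum>i<a + b. (d :: 'g::comm_monoid_add)) = (\<Sum>i<a. d) + (\<Sum>i<b. d)"
  by (induction b) (simp_all add: add.assoc)

lemma gform_span:
  assumes "gform dg V g F" "finite V"
  shows "F \<in> cvec.span (mon V ` graded_exps dg V g)"
  using assms(1)
proof induction
  case (const c)
  have "(\<lambda>_. 0) \<in> graded_exps dg V 0" by (simp add: graded_exps_def)
  then have "(\<lambda>x. c * mon V (\<lambda>_. 0) x) \<in> cvec.span (mon V ` graded_exps dg V 0)"
    by (intro cvec.span_scale cvec.span_base imageI)
  then show ?case by (simp add: mon_zero)
next
  case (var v)
  have "(\<Sum>w\<in>V. \<Sum>i<(if w = v then 1 else (0::nat)). dg w) = (\<Sum>w\<in>V. if w = v then dg v else 0)"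
    by (intro sum.cong) auto
  then have "(\<lambda>w. if w = v then 1 else 0) \<in> graded_exps dg V (dg v)"
    using var assms(2) by (auto simp: graded_exps_def)
  then have "mon V (\<lambda>w. if w = v then 1 else 0) \<in> cvec.span (mon V ` graded_exps dg V (dg v))"
    by (intro cvec.span_base imageI)
  moreover have "mon V (\<lambda>w. if w = v then 1 else 0) = (\<lambda>x. x v)"
    by (rule ext) (rule mon_unit[OF assms(2) var])
  ultimately show ?case by simp
next
  case (add g F G)
  have "(\<lambda>x. F x + G x) = F + G" by (simp add: fun_eq_iff)
  then show ?case using cvec.span_add[OF add.IH] by simp
next
  case (mult g F h G)
  show ?case
  proof (rule span_mult[OF mult.IH])
    fix f f' assume "f \<in> mon V ` graded_exps dg V g" "f' \<in> mon V ` graded_exps dg V h"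
    then obtain a b where ab: "a \<in> graded_exps dg V g" "b \<in> graded_exps dg V h" "f = mon V a" "f' = mon V b"
      by blast
    have "(\<lambda>v. a v + b v) \<in> graded_exps dg V (g + h)"
      using ab(1,2) by (auto simp: graded_exps_def sum_lessThan_add sum.distrib)
    moreover have "(\<lambda>x. f x * f' x) = mon V (\<lambda>v. a v + b v)"
      unfolding ab(3,4) by (rule ext) (rule mon_mult)
    ultimately show "(\<lambda>x. f x * f' x) \<in> cvec.span (mon V ` graded_exps dg V (g + h))"
      by (simp add: cvec.span_base)
  qed
qed

text \<open>
  At least \<open>N\<close> forms of degree \<open>q\<close> are linearly independent on \<open>Z\<close>. They are indexed by lists since in
  \<open>chain_forms\<close> they are built as products with one exponent for each member of a chain.
\<close>

definition has_forms :: "'i set \<Rightarrow> 'i point set \<Rightarrow> nat \<Rightarrow> nat \<Rightarrow> bool" where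
  "has_forms I Z q N \<longleftrightarrow> (\<exists>B gs. finite (B :: nat list set) \<and> card B = N \<and> (\<forall>\<beta>\<in>B. hform I q (gs \<beta>)) \<and>
     (\<forall>c. (\<forall>v. pt v \<in> Z \<longrightarrow> (\<Sum>\<beta>\<in>B. c \<beta> * gs \<beta> v) = 0) \<longrightarrow> (\<forall>\<beta>\<in>B. c \<beta> = 0)))"

lemma has_formsE:
  assumes "has_forms I Z q N"
  obtains B gs where "finite (B :: nat list set)" "card B = N" "\<forall>\<beta>\<in>B. hform I q (gs \<beta>)"
    "\<forall>c. (\<forall>v. pt v \<in> Z \<longrightarrow> (\<Sum>\<beta>\<in>B. c \<beta> * gs \<beta> v) = 0) \<longrightarrow> (\<forall>\<beta>\<in>B. c \<beta> = 0)"
  using assms unfolding has_forms_def by blast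

text \<open>
  Let \<open>f\<close> vanish on \<open>Z\<^sub>j\<close> but not on \<open>Z\<^sub>j\<^sub>+\<^sub>1\<close>, and let the linear form \<open>L\<close> vanish on no member of the chain. If the
  forms \<open>g\<close> are independent on \<open>Z\<^sub>j\<close>, then the products \<open>f\<^sup>s L\<^sup>u g\<close> with \<open>s \<le> e\<close> are independent on \<open>Z\<^sub>j\<^sub>+\<^sub>1\<close>: the lowest
  power of \<open>f\<close> in a relation can be cancelled by irreducibility, and a restriction to \<open>Z\<^sub>j\<close> then
  kills all terms but the lowest. The powers of \<open>L\<close> only equalise the degrees.
\<close>

lemma chain_forms:
  fixes Z :: "nat \<Rightarrow> 'i point set"
  assumes Z: "\<And>i. i \<le> k \<Longrightarrow> closedin (subtopology (zariski I) X) (Z i)"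
    "\<And>i. i \<le> k \<Longrightarrow> irreduciblein (subtopology (zariski I) X) (Z i)"
    and chain: "\<And>i. i < k \<Longrightarrow> Z i \<subset> Z (Suc i)"
  shows "\<exists>K. \<forall>e. has_forms I (Z k) (K * e) ((e + 1) ^ k)"
proof -
  have sub: "Z i \<subseteq> proj_space I" "Z i \<subseteq> X" if "i \<le> k" for i
    using Z(2)[OF that] by (auto simp: irreduciblein_def)
  have ne: "Z i \<noteq> {}" if "i \<le> k" for i
  proof -
    have "topspace (subtopology (subtopology (zariski I) X) (Z i)) = Z i" using sub[OF that] by auto
    then show ?thesis using Z(2)[OF that] by (simp add: irreduciblein_def irreducible_space_def)
  qed
  have Zmono: "Z 0 \<subseteq> Z i" if "i \<le> k" for i
    using that
  proof (induction i)
    case (Suc i)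
    then have "Z 0 \<subseteq> Z i" "Z i \<subset> Z (Suc i)" using chain[of i] by simp_all
    then show ?case by blast
  qed simp
  obtain v0 where v0: "pt v0 \<in> Z 0" "v0 \<noteq> 0" "v0 \<in> cvecs I"
    using ne[of 0] sub(1)[of 0] proj_space_pt by blast
  then obtain a where a: "v0 a \<noteq> 0" "a \<in> I" by (auto simp: cvecs_def fun_eq_iff)
  define L where "L v = v a" for v :: "'i \<Rightarrow> complex"
  have L: "hform I 1 L" unfolding L_def[abs_def] by (rule gform.var[OF a(2), of "\<lambda>_. 1"])
  have Lne: "\<not> (\<forall>v. pt v \<in> Z i \<longrightarrow> L v ^ m = 0)" if "i \<le> k" for i m
    using Zmono[OF that] v0(1) a(1) by (auto simp: L_def)
  have pow: "hform I (m * s) (\<lambda>v. g v ^ s)" if "hform I m g" for m g s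
    using gform_power[OF that, of s] by (simp add: mult.commute)
  have "j \<le> k \<Longrightarrow> \<exists>K. \<forall>e. has_forms I (Z j) (K * e) ((e + 1) ^ j)" for j
  proof (induction j)
    case 0
    show ?case unfolding has_forms_def
    proof (intro exI allI conjI)
      show "finite {[] :: nat list}" "card {[] :: nat list} = (e + 1) ^ 0" for e by simp_all
      show "\<forall>\<beta>\<in>{[]}. hform I (0 * e) (\<lambda>_. 1)" for e by (simp add: gform.const)
      show "(\<forall>v. pt v \<in> Z 0 \<longrightarrow> (\<Sum>\<beta>\<in>{[]}. c \<beta> * 1) = 0) \<longrightarrow> (\<forall>\<beta>\<in>{[]}. c \<beta> = 0)"
        for c :: "nat list \<Rightarrow> complex" using v0(1) by auto
    qed
  next
    case (Suc j)
    then obtain K where K: "\<And>e. has_forms I (Z j) (K * e) ((e + 1) ^ j)" by auto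
    have jk: "j < k" "j \<le> k" using Suc.prems by auto
    obtain S where S: "S \<subseteq> hom_polys I" "Z j = zero_locus I S \<inter> X"
      using Z(1)[OF jk(2)] unfolding closedin_subtopology closedin_zariski_iff by blast
    obtain p where p: "p \<in> Z (Suc j)" "p \<notin> Z j" using chain[OF jk(1)] by blast
    obtain w where w: "p = pt w" "p \<in> proj_space I" "p \<in> X"
      using p(1) sub[OF Suc.prems] proj_space_pt by blast
    obtain F where F: "F \<in> S" "poly_eval F w \<noteq> 0"
      using p(2) w pt_in_zero_locus_iff[OF S(1), of w] S(2) by blast
    define f where "f = poly_eval F"
    obtain m where m: "hform I m f" using hform_of_hom_poly F(1) S(1) unfolding f_def by blast
    have fZ: "f v = 0" if "pt v \<in> Z j" for v
      using that F(1) pt_in_zero_locus_iff[OF S(1), of v] S(2) by (auto simp: f_def)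
    have fne: "\<not> (\<forall>v. pt v \<in> Z (Suc j) \<longrightarrow> f v ^ s = 0)" for s
      using p(1) w(1) F(2) by (auto simp: f_def)
    show ?case
    proof (intro exI[of _ "m + K"] allI)
      fix e
      obtain B gs where B0: "finite (B :: nat list set)" "card B = (e + 1) ^ j" "\<forall>\<beta>\<in>B. hform I (K * e) (gs \<beta>)"
        "\<forall>c. (\<forall>v. pt v \<in> Z j \<longrightarrow> (\<Sum>\<beta>\<in>B. c \<beta> * gs \<beta> v) = 0) \<longrightarrow> (\<forall>\<beta>\<in>B. c \<beta> = 0)"
        by (rule has_formsE[OF K[of e]])
      note B = B0(1,2) bspec[OF B0(3)]
      have ind: "c \<beta> = 0" if "\<And>v. pt v \<in> Z j \<Longrightarrow> (\<Sum>\<beta>\<in>B. c \<beta> * gs \<beta> v) = 0" "\<beta> \<in> B" for c \<beta>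
        using spec[OF B0(4), of c] that by blast
      define B' where "B' = (\<lambda>(s, \<beta>). s # \<beta>) ` ({..e} \<times> B)"
      define gs' where "gs' x v = f v ^ hd x * (L v ^ (m * (e - hd x)) * gs (tl x) v)" for x v
      have inj: "inj_on (\<lambda>(s, \<beta>). s # \<beta>) ({..e} \<times> B)" by (auto simp: inj_on_def)
      have finB': "finite B'" using B(1) by (simp add: B'_def)
      have cardB': "card B' = (e + 1) ^ Suc j"
        unfolding B'_def card_image[OF inj] by (simp add: card_cartesian_product B(2))
      have gs': "hform I ((m + K) * e) (gs' x)" if xB: "x \<in> B'" for x
      proof -
        obtain s \<beta> where x: "x = s # \<beta>" "s \<le> e" "\<beta> \<in> B" using xB by (auto simp: B'_def)
        have "hform I (m * s + (1 * (m * (e - s)) + K * e)) (gs' x)"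
          unfolding gs'_def x(1) list.sel by (intro gform.mult pow m L B(3) x(3))
        moreover have "m * s + (1 * (m * (e - s)) + K * e) = (m + K) * e"
          using le_Suc_ex[OF x(2)] by (auto simp: algebra_simps)
        ultimately show ?thesis by simp
      qed
      have sumB': "(\<Sum>x\<in>B'. c x * gs' x v) = (\<Sum>s\<le>e. \<Sum>\<beta>\<in>B. c (s # \<beta>) * (f v ^ s * (L v ^ (m * (e - s)) * gs \<beta> v)))"
        for c v
        unfolding B'_def sum.reindex[OF inj] by (simp add: sum.cartesian_product gs'_def case_prod_beta')
      have indep: "\<forall>x\<in>B'. c x = 0" if c: "\<forall>v. pt v \<in> Z (Suc j) \<longrightarrow> (\<Sum>x\<in>B'. c x * gs' x v) = 0" for c
      proof -
        have "\<forall>\<beta>\<in>B. c (s # \<beta>) = 0" if "s \<le> e" for s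
          using that
        proof (induction s rule: less_induct)
          case (less s)
          define R where "R v = (\<Sum>t\<in>{s..e}. \<Sum>\<beta>\<in>B. c (t # \<beta>) * (f v ^ (t - s) * (L v ^ (m * (e - t)) * gs \<beta> v)))" for v
          have R: "hform I (m * (e - s) + K * e) R"
          proof -
            have h: "hform I (m * (e - s) + K * e) (\<lambda>v. c (t # \<beta>) * (f v ^ (t - s) * (L v ^ (m * (e - t)) * gs \<beta> v)))"
              if "t \<in> {s..e}" "\<beta> \<in> B" for t \<beta>
            proof -
              have "hform I (m * (t - s) + (1 * (m * (e - t)) + K * e)) (\<lambda>v. c (t # \<beta>) * (f v ^ (t - s) * (L v ^ (m * (e - t)) * gs \<beta> v)))"
                by (intro gform_cmult gform.mult pow m L B(3) that)
              moreover have "m * (t - s) + (1 * (m * (e - t)) + K * e) = m * (e - s) + K * e"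
              proof -
                have st: "s \<le> t" "t \<le> e" using that(1) by auto
                show ?thesis using le_Suc_ex[OF st(1)] le_Suc_ex[OF st(2)] by (auto simp: algebra_simps)
              qed
              ultimately show ?thesis by (simp only:)
            qed
            have "B \<noteq> {}" using B(2) by auto
            then obtain \<beta>0 where b0: "\<beta>0 \<in> B" by blast
            have H: "hform I (m * (e - s) + K * e) (\<lambda>v. c (s # \<beta>0) * (f v ^ (s - s) * (L v ^ (m * (e - s)) * gs \<beta>0 v)))"
              by (rule h[OF _ b0]) (use less.prems in simp)
            show ?thesis unfolding R_def[abs_def] by (intro gform_sum[OF H] h)
          qed
          have R0: "f v ^ s * R v = 0" if v: "pt v \<in> Z (Suc j)" for v
          proof -
            have "0 = (\<Sum>t\<le>e. \<Sum>\<beta>\<in>B. c (t # \<beta>) * (f v ^ t * (L v ^ (m * (e - t)) * gs \<beta> v)))"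
              using c v sumB' by simp
            also have "\<dots> = (\<Sum>t\<in>{s..e}. \<Sum>\<beta>\<in>B. c (t # \<beta>) * (f v ^ t * (L v ^ (m * (e - t)) * gs \<beta> v)))"
            proof (rule sum.mono_neutral_right)
              show "\<forall>t\<in>{..e} - {s..e}. (\<Sum>\<beta>\<in>B. c (t # \<beta>) * (f v ^ t * (L v ^ (m * (e - t)) * gs \<beta> v))) = 0"
              proof
                fix t assume "t \<in> {..e} - {s..e}"
                then have "\<forall>\<beta>\<in>B. c (t # \<beta>) = 0" by (intro less.IH) auto
                then show "(\<Sum>\<beta>\<in>B. c (t # \<beta>) * (f v ^ t * (L v ^ (m * (e - t)) * gs \<beta> v))) = 0"
                  by (intro sum.neutral) auto
              qed
            qed auto
            also have "\<dots> = f v ^ s * R v"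
              unfolding R_def sum_distrib_left
            proof (intro sum.cong refl)
              fix t \<beta> assume "t \<in> {s..e}"
              then have "f v ^ t = f v ^ s * f v ^ (t - s)" by (simp flip: power_add)
              then show "c (t # \<beta>) * (f v ^ t * (L v ^ (m * (e - t)) * gs \<beta> v)) =
                 f v ^ s * (c (t # \<beta>) * (f v ^ (t - s) * (L v ^ (m * (e - t)) * gs \<beta> v)))"
                by (simp only: mult_ac)
            qed
            finally show ?thesis by simp
          qed
          have "\<forall>v. pt v \<in> Z (Suc j) \<longrightarrow> R v = 0"
            using irreducible_hform_mult[OF Z(2)[OF Suc.prems] pow[OF m, of s] R R0] fne[of s] by blast
          then have RZ: "R v = 0" if "pt v \<in> Z j" for v using that chain[OF jk(1)] by blast
          define G where "G v = (\<Sum>\<beta>\<in>B. c (s # \<beta>) * gs \<beta> v)" for v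
          have G: "hform I (K * e) G"
          proof -
            have "B \<noteq> {}" using B(2) by auto
            then obtain \<beta>0 where "\<beta>0 \<in> B" by blast
            then show ?thesis unfolding G_def[abs_def] by (intro gform_sum[OF B(3)] gform_cmult B(3))
          qed
          have LG: "L v ^ (m * (e - s)) * G v = 0" if v: "pt v \<in> Z j" for v
          proof -
            have "R v = (\<Sum>t\<in>{s}. \<Sum>\<beta>\<in>B. c (t # \<beta>) * (f v ^ (t - s) * (L v ^ (m * (e - t)) * gs \<beta> v)))"
              unfolding R_def
            proof (rule sum.mono_neutral_right)
              show "\<forall>t\<in>{s..e} - {s}. (\<Sum>\<beta>\<in>B. c (t # \<beta>) * (f v ^ (t - s) * (L v ^ (m * (e - t)) * gs \<beta> v))) = 0"
                using fZ[OF v] by (auto simp: power_0_left)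
            qed (use less.prems in auto)
            also have "\<dots> = L v ^ (m * (e - s)) * G v"
              unfolding G_def sum_distrib_left by (simp add: mult_ac)
            finally show ?thesis using RZ[OF v] by simp
          qed
          have "\<forall>v. pt v \<in> Z j \<longrightarrow> G v = 0"
            using irreducible_hform_mult[OF Z(2)[OF jk(2)] pow[OF L] G LG] Lne[OF jk(2)] by blast
          then show ?case using ind[of "\<lambda>\<beta>. c (s # \<beta>)"] by (auto simp: G_def)
        qed
        then show ?thesis by (auto simp: B'_def)
      qed
      show "has_forms I (Z (Suc j)) ((m + K) * e) ((e + 1) ^ Suc j)"
        unfolding has_forms_def using finB' cardB' gs' indep by (intro exI[of _ B'] exI[of _ gs'] conjI allI impI ballI) auto
    qed
  qed
  then show ?thesis by simp
qed

section \<open>The dimension of a Segre-Veronese variety\<close>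

text \<open>
  The coordinate \<open>x\<^sub>i\<^sub>j\<close> of the product is the variable \<open>(i, j)\<close>, and multidegrees are functions on the
  factors. So a multiform of multidegree \<open>d\<close> is a graded form with respect to \<open>mdeg\<close> on \<open>mvars r n\<close>, of
  degree \<open>mtype r d\<close>.
\<close>

definition mdeg :: "nat \<times> nat \<Rightarrow> nat \<Rightarrow> nat" where
  "mdeg v = (\<lambda>k. if k = fst v then 1 else 0)"

definition mvars :: "nat \<Rightarrow> (nat \<Rightarrow> nat) \<Rightarrow> (nat \<times> nat) set" where
  "mvars r n = (SIGMA i:{1..r}. {0..n i})"

definition mtype :: "nat \<Rightarrow> (nat \<Rightarrow> nat) \<Rightarrow> nat \<Rightarrow> nat" where
  "mtype r d = (\<lambda>i. if i \<in> {1..r} then d i else 0)"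

lemma finite_mvars: "finite (mvars r n)"
  by (simp add: mvars_def)

lemma sum_mvars: "(\<Sum>v\<in>mvars r n. f v) = (\<Sum>i=1..r. \<Sum>j=0..n i. f (i, j))"
  unfolding mvars_def by (simp add: sum.Sigma)

lemma prod_mvars: "(\<Prod>v\<in>mvars r n. f v) = (\<Prod>i=1..r. \<Prod>j=0..n i. f (i, j))"
  unfolding mvars_def by (simp add: prod.Sigma)

lemma sum_mdeg:
  "(\<Sum>v\<in>mvars r n. \<Sum>l<a v. mdeg v) = (\<lambda>k. if k \<in> {1..r} then \<Sum>j=0..n k. a (k, j) else 0)"
proof
  fix k
  have "(\<Sum>v\<in>mvars r n. \<Sum>l<a v. mdeg v) k = (\<Sum>i=1..r. \<Sum>j=0..n i. a (i, j) * (if k = i then 1 else 0))"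
    unfolding sum_mvars by (simp add: sum_apply mdeg_def)
  also have "\<dots> = (\<Sum>i=1..r. if k = i then \<Sum>j=0..n k. a (k, j) else 0)"
    by (intro sum.cong) auto
  also have "\<dots> = (if k \<in> {1..r} then \<Sum>j=0..n k. a (k, j) else 0)"
    by (subst sum.delta') auto
  finally show "(\<Sum>v\<in>mvars r n. \<Sum>l<a v. mdeg v) k = (if k \<in> {1..r} then \<Sum>j=0..n k. a (k, j) else 0)" .
qed

lemma graded_exps_mvars:
  "a \<in> graded_exps mdeg (mvars r n) (mtype r d) \<longleftrightarrow> (\<lambda>i j. a (i, j)) \<in> multi_exps r n d"
proof -
  have "(\<lambda>k. if k \<in> {1..r} then \<Sum>j=0..n k. a (k, j) else 0) = mtype r d \<longleftrightarrow>
      (\<forall>i\<in>{1..r}. (\<Sum>j=0..n i. a (i, j)) = d i)"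
    unfolding mtype_def fun_eq_iff by auto
  then show ?thesis
    unfolding graded_exps_def multi_exps_def mem_Collect_eq sum_mdeg
    by (auto simp: mvars_def)
qed

lemma sv_vec_mon:
  assumes "a \<in> multi_exps r n d"
  shows "sv_vec r n d (\<lambda>i j. y (i, j)) a = mon (mvars r n) (\<lambda>(i, j). a i j) y"
  using assms by (simp add: sv_vec_def mon_def prod_mvars)

lemma sv_vec_outside: "a \<notin> multi_exps r n d \<Longrightarrow> sv_vec r n d x a = 0"
  by (simp add: sv_vec_def)

lemma sv_vec_gform: "a \<in> multi_exps r n d \<Longrightarrow> gform mdeg (mvars r n) (mtype r d) (\<lambda>y. sv_vec r n d (\<lambda>i j. y (i, j)) a)"
proof -
  assume a: "a \<in> multi_exps r n d"
  have "(\<lambda>(i, j). a i j) \<in> graded_exps mdeg (mvars r n) (mtype r d)"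
    using a by (simp add: graded_exps_mvars)
  then have "(\<Sum>v\<in>mvars r n. \<Sum>l<(\<lambda>(i, j). a i j) v. mdeg v) = mtype r d"
    unfolding graded_exps_def by blast
  then show ?thesis
    using mon_gform[OF finite_mvars[of r n], of mdeg "\<lambda>(i, j). a i j"]
    unfolding sv_vec_mon[OF a] by (simp add: mon_def[abs_def])
qed

lemma hform_sv:
  assumes "hform (multi_exps r n d) Q g"
  shows "gform mdeg (mvars r n) (mtype r (\<lambda>i. Q * d i)) (\<lambda>y. g (sv_vec r n d (\<lambda>i j. y (i, j))))"
  using assms
proof induction
  case (const c)
  have 0: "mtype r (\<lambda>i. 0 * d i) = 0" by (auto simp: mtype_def fun_eq_iff)
  show ?case unfolding 0 by (rule gform.const)
next
  case (var a)
  then show ?case using sv_vec_gform by simp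
next
  case (add g F G)
  then show ?case by (intro gform.add)
next
  case (mult g F h G)
  have gh: "mtype r (\<lambda>i. (g + h) * d i) = mtype r (\<lambda>i. g * d i) + mtype r (\<lambda>i. h * d i)"
    by (auto simp: mtype_def fun_eq_iff algebra_simps)
  show ?case unfolding gh by (rule gform.mult[OF mult.IH])
qed

text \<open>
  An exponent is determined by its entries \<open>(i, j)\<close> with \<open>j \<ge> 1\<close>, because the sum over each factor is prescribed.
\<close>

lemma card_multi_graded_exps:
  assumes M: "\<And>i. i \<in> {1..r} \<Longrightarrow> d i + 1 \<le> M"
  shows "finite (graded_exps mdeg (mvars r n) (mtype r d)) \<and>
    card (graded_exps mdeg (mvars r n) (mtype r d)) \<le> M ^ (\<Sum>i=1..r. n i)"
proof -
  let ?E = "graded_exps mdeg (mvars r n) (mtype r d)"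
  define W where "W = (SIGMA i:{1..r}. {1..n i})"
  have finW: "finite W" by (simp add: W_def)
  have cardW: "card W = (\<Sum>i=1..r. n i)" by (simp add: W_def)
  have E: "(\<Sum>j=0..n i. a (i, j)) = d i" "v \<notin> mvars r n \<Longrightarrow> a v = 0" if "a \<in> ?E" "i \<in> {1..r}" for a i v
    using that unfolding graded_exps_mvars by (auto simp: multi_exps_def mvars_def) (cases v, auto)
  have inj: "inj_on (\<lambda>a. restrict a W) ?E"
  proof (rule inj_onI)
    fix a b assume ab: "a \<in> ?E" "b \<in> ?E" "restrict a W = restrict b W"
    have W: "a v = b v" if "v \<in> W" for v using ab(3) that by (metis restrict_apply')
    show "a = b"
    proof
      fix v :: "nat \<times> nat"
      obtain i j where v: "v = (i, j)" by (cases v)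
      show "a v = b v"
      proof (cases "v \<in> mvars r n")
        case False
        have "a v = 0" "b v = 0" using ab(1,2) False unfolding graded_exps_def by blast+
        then show ?thesis by simp
      next
        case True
        then have i: "i \<in> {1..r}" "j \<le> n i" by (auto simp: mvars_def v)
        show ?thesis
        proof (cases "j = 0")
          case False
          then show ?thesis using i W[of v] by (auto simp: W_def v)
        next
          case True
          have "(\<Sum>j=1..n i. a (i, j)) = (\<Sum>j=1..n i. b (i, j))"
            using i by (intro sum.cong refl W) (auto simp: W_def)
          moreover have "(\<Sum>j=0..n i. c (i, j)) = c (i, 0) + (\<Sum>j=1..n i. c (i, j))" for c :: "nat \<times> nat \<Rightarrow> nat"
            by (simp add: sum.atLeast_Suc_atMost)
          ultimately have "a (i, 0) = b (i, 0)"
            using E(1)[OF ab(1) i(1)] E(1)[OF ab(2) i(1)] by simp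
          then show ?thesis by (simp add: v True)
        qed
      qed
    qed
  qed
  have sub: "(\<lambda>a. restrict a W) ` ?E \<subseteq> PiE W (\<lambda>_. {..<M})"
  proof (rule image_subsetI, rule restrict_PiE_iff[THEN iffD2], rule ballI)
    fix a v assume a: "a \<in> ?E" and v: "v \<in> W"
    then obtain i j where ij: "v = (i, j)" "i \<in> {1..r}" "j \<in> {1..n i}" by (auto simp: W_def)
    have "a (i, j) \<le> (\<Sum>j=0..n i. a (i, j))" using ij(3) by (intro member_le_sum) auto
    then show "a v \<in> {..<M}" using E(1)[OF a ij(2)] M[OF ij(2)] ij(1) by auto
  qed
  have finP: "finite (PiE W (\<lambda>_. {..<M}))" using finW by (intro finite_PiE) auto
  have fin: "finite ?E" using finite_subset[OF sub finP] finite_image_iff[OF inj] by blast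
  have "card ?E = card ((\<lambda>a. restrict a W) ` ?E)" using card_image[OF inj] by simp
  also have "\<dots> \<le> card (PiE W (\<lambda>_. {..<M}))" by (rule card_mono[OF finP sub])
  also have "\<dots> = M ^ (\<Sum>i=1..r. n i)" using finW by (simp add: card_PiE cardW)
  finally show ?thesis using fin by blast
qed

lemma power_bound_le:
  fixes k D C :: nat
  assumes "\<And>e. (e + 1) ^ k \<le> (C * (e + 1)) ^ D"
  shows "k \<le> D"
proof (rule ccontr)
  assume "\<not> k \<le> D"
  then obtain l where l: "k = D + Suc l" by (metis add_Suc_right less_imp_Suc_add not_le)
  define e where "e = C ^ D"
  have "(e + 1) ^ D * (e + 1) ^ Suc l \<le> (e + 1) ^ D * C ^ D"
    using assms[of e] unfolding l by (simp only: power_add power_mult_distrib mult.commute)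
  then have "(e + 1) ^ Suc l \<le> C ^ D" unfolding mult_le_cancel1 by simp
  then have "(e + 1) ^ Suc l \<le> e" by (simp only: e_def)
  moreover have "(e + 1) ^ 1 \<le> (e + 1) ^ Suc l" by (intro power_increasing) auto
  ultimately show False by simp
qed

text \<open>
  Forms of degree \<open>K e\<close> pull back to multiforms of multidegree \<open>K e d\<close>, whose number is bounded by a polynomial in \<open>e\<close>
  of degree \<open>n\<^sub>1 + \<dots> + n\<^sub>r\<close>. A chain of length \<open>k\<close> requires \<open>(e + 1)\<^sup>k\<close> of them for all \<open>e\<close>.
\<close>

lemma proj_dim_segre_veronese_le:
  "proj_dim (multi_exps r n d) (segre_veronese r n d) \<le> enat (\<Sum>i=1..r. n i)"
proof -
  let ?I = "multi_exps r n d" and ?X = "segre_veronese r n d"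
  let ?T = "subtopology (zariski ?I) ?X"
  have "k \<le> (\<Sum>i=1..r. n i)" if Z: "\<forall>i\<le>k. closedin ?T (Z i) \<and> irreduciblein ?T (Z i)"
    "\<forall>i<k. Z i \<subset> Z (Suc i)" for k Z
  proof -
    have "\<exists>K. \<forall>e. has_forms ?I (Z k) (K * e) ((e + 1) ^ k)"
      by (rule chain_forms[where X = ?X]) (use Z in simp_all)
    then obtain K where K: "\<And>e. has_forms ?I (Z k) (K * e) ((e + 1) ^ k)" by auto
    have sub: "Z k \<subseteq> ?X" using Z(1) by (auto simp: irreduciblein_def)
    define C where "C = (\<Sum>i=1..r. K * d i) + 1"
    have "(e + 1) ^ k \<le> (C * (e + 1)) ^ (\<Sum>i=1..r. n i)" for e
    proof -
      obtain B gs where B0: "finite (B :: nat list set)" "card B = (e + 1) ^ k" "\<forall>\<beta>\<in>B. hform ?I (K * e) (gs \<beta>)"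
        "\<forall>c. (\<forall>v. pt v \<in> Z k \<longrightarrow> (\<Sum>\<beta>\<in>B. c \<beta> * gs \<beta> v) = 0) \<longrightarrow> (\<forall>\<beta>\<in>B. c \<beta> = 0)"
        by (rule has_formsE[OF K[of e]])
      note B = B0(1,2) bspec[OF B0(3)]
      have ind: "c \<beta> = 0" if "\<And>v. pt v \<in> Z k \<Longrightarrow> (\<Sum>\<beta>\<in>B. c \<beta> * gs \<beta> v) = 0" "\<beta> \<in> B" for c \<beta>
        using spec[OF B0(4), of c] that by blast
      let ?E = "graded_exps mdeg (mvars r n) (mtype r (\<lambda>i. K * e * d i))"
      have E: "finite ?E" "card ?E \<le> (C * (e + 1)) ^ (\<Sum>i=1..r. n i)"
      proof -
        have M: "K * e * d i + 1 \<le> C * (e + 1)" if i: "i \<in> {1..r}" for i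
        proof -
          have "K * d i \<le> (\<Sum>i=1..r. K * d i)" using i by (intro member_le_sum) auto
          then have "(K * d i + 1) * (e + 1) \<le> C * (e + 1)" unfolding C_def by (intro mult_right_mono) auto
          then show ?thesis by (simp add: algebra_simps)
        qed
        show "finite ?E" "card ?E \<le> (C * (e + 1)) ^ (\<Sum>i=1..r. n i)"
          using card_multi_graded_exps[of r "\<lambda>i. K * e * d i" "C * (e + 1)" n] M by auto
      qed
      define G where "G \<beta> y = gs \<beta> (sv_vec r n d (\<lambda>i j. y (i, j)))" for \<beta> y
      have G: "G \<beta> \<in> cvec.span (mon (mvars r n) ` ?E)" if "\<beta> \<in> B" for \<beta>
        unfolding G_def[abs_def]
        by (rule gform_span[OF hform_sv[OF B(3)[OF that]] finite_mvars])
      have "\<not> card (mon (mvars r n) ` ?E) < card B"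
      proof
        assume less: "card (mon (mvars r n) ` ?E) < card B"
        have "\<exists>c. (\<exists>\<beta>\<in>B. c \<beta> \<noteq> 0) \<and> (\<forall>y. (\<Sum>\<beta>\<in>B. c \<beta> * G \<beta> y) = 0)"
          by (rule dependent_of_card_less[OF B(1) finite_imageI[OF E(1)] less G])
        then obtain c where c: "\<exists>\<beta>\<in>B. c \<beta> \<noteq> 0" "\<And>y. (\<Sum>\<beta>\<in>B. c \<beta> * G \<beta> y) = 0" by (elim exE conjE) blast
        have "(\<Sum>\<beta>\<in>B. c \<beta> * gs \<beta> v) = 0" if v: "pt v \<in> Z k" for v
        proof -
          obtain x where x: "pt v = pt (sv_vec r n d x)" using v sub by (auto simp: segre_veronese_def)
          obtain s where s: "v = (\<lambda>i. s * sv_vec r n d x i)" using pt_eqD[OF x] by blast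
          have "(\<Sum>\<beta>\<in>B. c \<beta> * gs \<beta> v) = (\<Sum>\<beta>\<in>B. s ^ (K * e) * (c \<beta> * G \<beta> (\<lambda>(i, j). x i j)))"
          proof (rule sum.cong[OF refl])
            fix \<beta> assume "\<beta> \<in> B"
            then have "gs \<beta> v = s ^ (K * e) * gs \<beta> (sv_vec r n d x)"
              unfolding s by (intro hform_scale[OF B(3)])
            then show "c \<beta> * gs \<beta> v = s ^ (K * e) * (c \<beta> * G \<beta> (\<lambda>(i, j). x i j))"
              by (simp add: G_def)
          qed
          then show ?thesis by (simp add: c(2) flip: sum_distrib_left)
        qed
        then show False using ind[of c] c(1) by blast
      qed
      then have "(e + 1) ^ k \<le> card (mon (mvars r n) ` ?E)" by (simp add: B(2) not_less)
      also have "\<dots> \<le> card ?E" by (rule card_image_le[OF E(1)])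
      finally show ?thesis using E(2) by linarith
    qed
    then show ?thesis by (rule power_bound_le)
  qed
  then show ?thesis
    unfolding proj_dim_def krull_dim_def by (intro Sup_least) auto
qed

section \<open>Lower bounds for dimensions\<close>

text \<open>
  Bounding the degree in each variable separately makes the number of monomials a pure power of the
  number of variables.
\<close>

definition box :: "'v set \<Rightarrow> nat \<Rightarrow> ('v \<Rightarrow> nat) set" where
  "box V \<delta> = {a. (\<forall>v. v \<notin> V \<longrightarrow> a v = 0) \<and> (\<forall>v\<in>V. a v \<le> \<delta>)}"

definition boxed :: "'v set \<Rightarrow> nat \<Rightarrow> (('v \<Rightarrow> complex) \<Rightarrow> complex) set" where
  "boxed V \<delta> = cvec.span (mon V ` box V \<delta>)"

lemma card_box:
  assumes "finite V"
  shows "finite (box V \<delta>) \<and> card (box V \<delta>) = (\<delta> + 1) ^ card V"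
proof -
  have "bij_betw (\<lambda>a. restrict a V) (box V \<delta>) (PiE V (\<lambda>_. {..\<delta>}))"
  proof (rule bij_betw_byWitness[where f' = "\<lambda>b v. if v \<in> V then b v else 0"])
    show "\<forall>a\<in>box V \<delta>. (\<lambda>v. if v \<in> V then restrict a V v else 0) = a"
      by (auto simp: box_def fun_eq_iff)
    show "\<forall>b\<in>PiE V (\<lambda>_. {..\<delta>}). restrict (\<lambda>v. if v \<in> V then b v else 0) V = b"
      by (auto simp: fun_eq_iff restrict_def PiE_def extensional_def)
    show "(\<lambda>a. restrict a V) ` box V \<delta> \<subseteq> PiE V (\<lambda>_. {..\<delta>})"
      by (auto simp: box_def)
    show "(\<lambda>b v. if v \<in> V then b v else 0) ` PiE V (\<lambda>_. {..\<delta>}) \<subseteq> box V \<delta>"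
      by (auto simp: box_def PiE_def Pi_def)
  qed
  then have "card (box V \<delta>) = card (PiE V (\<lambda>_. {..\<delta>}))" "finite (box V \<delta>) = finite (PiE V (\<lambda>_. {..\<delta>}))"
    by (simp_all add: bij_betw_same_card bij_betw_finite)
  then show ?thesis using assms by (simp add: card_PiE finite_PiE)
qed

lemma boxed_mono: "F \<in> boxed V \<delta> \<Longrightarrow> \<delta> \<le> \<epsilon> \<Longrightarrow> F \<in> boxed V \<epsilon>"
proof -
  assume "F \<in> boxed V \<delta>" "\<delta> \<le> \<epsilon>"
  moreover from this(2) have "box V \<delta> \<subseteq> box V \<epsilon>" by (auto simp: box_def intro: order_trans)
  ultimately show ?thesis
    unfolding boxed_def using cvec.span_mono[of "mon V ` box V \<delta>" "mon V ` box V \<epsilon>"] by blast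
qed

lemma boxed_mult:
  assumes "F \<in> boxed V \<delta>" "G \<in> boxed V \<epsilon>"
  shows "(\<lambda>x. F x * G x) \<in> boxed V (\<delta> + \<epsilon>)"
  unfolding boxed_def
proof (rule span_mult[OF assms[unfolded boxed_def]])
  fix f g assume "f \<in> mon V ` box V \<delta>" "g \<in> mon V ` box V \<epsilon>"
  then obtain a b where ab: "a \<in> box V \<delta>" "b \<in> box V \<epsilon>" "f = mon V a" "g = mon V b" by blast
  have "(\<lambda>v. a v + b v) \<in> box V (\<delta> + \<epsilon>)" using ab(1,2) by (auto simp: box_def add_mono)
  moreover have "(\<lambda>x. f x * g x) = mon V (\<lambda>v. a v + b v)"
    unfolding ab(3,4) by (rule ext) (rule mon_mult)
  ultimately show "(\<lambda>x. f x * g x) \<in> cvec.span (mon V ` box V (\<delta> + \<epsilon>))"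
    by (simp add: cvec.span_base)
qed

lemma boxed_const: "(\<lambda>_. c) \<in> boxed V \<delta>"
proof -
  have "(\<lambda>_. 0) \<in> box V \<delta>" by (simp add: box_def)
  then have "(\<lambda>x. c * mon V (\<lambda>_. 0) x) \<in> boxed V \<delta>"
    unfolding boxed_def by (intro cvec.span_scale cvec.span_base imageI)
  then show ?thesis by (simp add: mon_zero)
qed

lemma boxed_power: "F \<in> boxed V \<delta> \<Longrightarrow> (\<lambda>x. F x ^ k) \<in> boxed V (k * \<delta>)"
proof (induction k)
  case (Suc k)
  then show ?case using boxed_mult[of F V \<delta> "\<lambda>x. F x ^ k" "k * \<delta>"] by simp
qed (simp add: boxed_const)

lemma boxed_prod:
  "(\<And>a. a \<in> A \<Longrightarrow> F a \<in> boxed V (\<delta> a)) \<Longrightarrow> (\<lambda>x. \<Prod>a\<in>A. F a x) \<in> boxed V (\<Sum>a\<in>A. \<delta> a)"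
  by (induction A rule: infinite_finite_induct) (simp_all add: boxed_const boxed_mult)

lemma polyfun_boxed:
  assumes "F \<in> polyfun V" "finite V"
  shows "\<exists>\<delta>. F \<in> boxed V \<delta>"
  using assms(1)
proof induction
  case (const c)
  then show ?case using boxed_const by blast
next
  case (var v)
  have "(\<lambda>w. if w = v then 1 else 0) \<in> box V 1" using var by (auto simp: box_def)
  then have "mon V (\<lambda>w. if w = v then 1 else 0) \<in> boxed V 1"
    unfolding boxed_def by (intro cvec.span_base imageI)
  moreover have "mon V (\<lambda>w. if w = v then 1 else 0) = (\<lambda>x. x v)"
    by (rule ext) (rule mon_unit[OF assms(2) var])
  ultimately show ?case by auto
next
  case (add F G)
  then obtain \<delta> \<epsilon> where "F \<in> boxed V \<delta>" "G \<in> boxed V \<epsilon>" by blast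
  then have "F \<in> boxed V (\<delta> + \<epsilon>)" "G \<in> boxed V (\<delta> + \<epsilon>)"
    by (auto elim: boxed_mono)
  then have "F + G \<in> boxed V (\<delta> + \<epsilon>)" unfolding boxed_def by (rule cvec.span_add)
  moreover have "F + G = (\<lambda>x. F x + G x)" by (simp add: fun_eq_iff)
  ultimately show ?case by auto
next
  case (mult F G)
  then show ?case using boxed_mult by blast
qed

text \<open>
  Along the line with direction \<open>w\<close> the functions \<open>P w l\<close> start with \<open>t f w l\<close> and \<open>H w\<close> starts with \<open>1\<close>. The lowest
  power of \<open>t\<close> in a relation is therefore a relation between monomials in the numbers \<open>f w l\<close>, which
  are arbitrary. So functions with independent linear parts are algebraically independent.
\<close>

lemma leading_terms_vanish:
  fixes c :: "(nat \<Rightarrow> nat) \<Rightarrow> complex" and H :: "'w \<Rightarrow> complex poly" and P :: "'w \<Rightarrow> nat \<Rightarrow> complex poly"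
  assumes A: "finite A" "\<And>\<alpha>. \<alpha> \<in> A \<Longrightarrow> (\<Sum>l<k. \<alpha> l) \<le> N" "\<And>\<alpha> l. \<alpha> \<in> A \<Longrightarrow> \<not> l < k \<Longrightarrow> \<alpha> l = 0"
    and P: "\<And>w. coeff (H w) 0 = 1" "\<And>w l. l < k \<Longrightarrow> coeff (P w l) 0 = 0"
      "\<And>w l. l < k \<Longrightarrow> coeff (P w l) 1 = f w l"
    and surj: "\<And>x. \<exists>w. \<forall>l<k. f w l = x l"
    and zero: "\<And>w t. (\<Sum>\<alpha>\<in>A. c \<alpha> * (poly (H w) t ^ (N - (\<Sum>l<k. \<alpha> l)) * (\<Prod>l<k. poly (P w l) t ^ \<alpha> l))) = 0"
    and "\<alpha> \<in> A"
  shows "c \<alpha> = 0"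
  using \<open>\<alpha> \<in> A\<close>
proof (induction "\<Sum>l<k. \<alpha> l" arbitrary: \<alpha> rule: less_induct)
  case less
  define m where "m = (\<Sum>l<k. \<alpha> l)"
  define B where "B = {\<beta> \<in> A. m \<le> (\<Sum>l<k. \<beta> l)}"
  define B0 where "B0 = {\<beta> \<in> A. (\<Sum>l<k. \<beta> l) = m}"
  have small: "c \<beta> = 0" if "\<beta> \<in> A - B" for \<beta>
    using that less.hyps[of \<beta>] by (auto simp: B_def m_def not_le)
  have finB: "finite B" using A(1) by (simp add: B_def)
  have "(\<Sum>\<beta>\<in>B0. c \<beta> * mon {..<k} \<beta> x) = 0" for x
  proof -
    obtain w where w: "\<And>l. l < k \<Longrightarrow> f w l = x l" using surj[of x] by blast
    have "\<exists>q. P w l = pCons 0 q \<and> coeff q 0 = x l" if "l < k" for l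
    proof -
      obtain a q where q: "P w l = pCons a q" by (rule pCons_cases)
      then show ?thesis using P(2,3)[OF that, of w] w[OF that] by simp
    qed
    then obtain q where q: "\<And>l. l < k \<Longrightarrow> P w l = pCons 0 (q l)" "\<And>l. l < k \<Longrightarrow> coeff (q l) 0 = x l"
      by metis
    define R where "R = (\<Sum>\<beta>\<in>B. smult (c \<beta>) (Polynomial.monom 1 ((\<Sum>l<k. \<beta> l) - m) *
        (H w ^ (N - (\<Sum>l<k. \<beta> l)) * (\<Prod>l<k. q l ^ \<beta> l))))"
    have "poly (Polynomial.monom 1 m * R) t = 0" for t
    proof -
      have "poly (Polynomial.monom 1 m * R) t = (\<Sum>\<beta>\<in>B. c \<beta> * (poly (H w) t ^ (N - (\<Sum>l<k. \<beta> l)) * (\<Prod>l<k. poly (P w l) t ^ \<beta> l)))"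
        unfolding R_def poly_mult poly_sum sum_distrib_left
      proof (rule sum.cong[OF refl])
        fix \<beta> assume \<beta>: "\<beta> \<in> B"
        have "(\<Prod>l<k. poly (P w l) t ^ \<beta> l) = (\<Prod>l<k. t ^ \<beta> l * poly (q l) t ^ \<beta> l)"
          by (intro prod.cong refl) (simp add: q(1) power_mult_distrib)
        also have "\<dots> = t ^ (\<Sum>l<k. \<beta> l) * (\<Prod>l<k. poly (q l) t ^ \<beta> l)"
          by (simp add: prod.distrib power_sum)
        also have "t ^ (\<Sum>l<k. \<beta> l) = t ^ m * t ^ ((\<Sum>l<k. \<beta> l) - m)"
          using \<beta> by (simp add: B_def flip: power_add)
        finally show "poly (Polynomial.monom 1 m) t * poly (smult (c \<beta>) (Polynomial.monom 1 ((\<Sum>l<k. \<beta> l) - m) *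
           (H w ^ (N - (\<Sum>l<k. \<beta> l)) * (\<Prod>l<k. q l ^ \<beta> l)))) t
          = c \<beta> * (poly (H w) t ^ (N - (\<Sum>l<k. \<beta> l)) * (\<Prod>l<k. poly (P w l) t ^ \<beta> l))"
          by (simp add: poly_monom poly_prod mult_ac)
      qed
      also have "\<dots> = (\<Sum>\<alpha>\<in>A. c \<alpha> * (poly (H w) t ^ (N - (\<Sum>l<k. \<alpha> l)) * (\<Prod>l<k. poly (P w l) t ^ \<alpha> l)))"
        using A(1) small by (intro sum.mono_neutral_left) (auto simp: B_def)
      finally show ?thesis using zero by simp
    qed
    then have "Polynomial.monom 1 m * R = 0" using poly_all_0_iff_0 by blast
    then have "R = 0" by (simp add: monom_eq_0_iff)
    then have "0 = poly R 0" by simp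
    also have "\<dots> = (\<Sum>\<beta>\<in>B. c \<beta> * (0 ^ ((\<Sum>l<k. \<beta> l) - m) * (\<Prod>l<k. x l ^ \<beta> l)))"
    proof -
      have "poly (H w) 0 = 1" "\<And>l. l < k \<Longrightarrow> poly (q l) 0 = x l"
        using P(1)[of w] q(2) by (simp_all add: poly_0_coeff_0)
      then show ?thesis unfolding R_def by (simp add: poly_sum poly_monom poly_prod)
    qed
    also have "\<dots> = (\<Sum>\<beta>\<in>B0. c \<beta> * (0 ^ ((\<Sum>l<k. \<beta> l) - m) * (\<Prod>l<k. x l ^ \<beta> l)))"
      using finB by (intro sum.mono_neutral_right) (auto simp: B0_def B_def power_0_left)
    also have "\<dots> = (\<Sum>\<beta>\<in>B0. c \<beta> * mon {..<k} \<beta> x)"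
      by (intro sum.cong) (auto simp: B0_def mon_def)
    finally show ?thesis by simp
  qed
  moreover have "\<alpha> \<in> B0" using less.prems by (simp add: B0_def m_def)
  moreover have "finite B0" using A(1) by (simp add: B0_def)
  ultimately show ?case
    using A(3) by (intro mon_independent[of "{..<k}" B0 c \<alpha>]) (auto simp: B0_def)
qed

lemma hform_comp_polyfun:
  assumes "hform I k g" "\<And>a. a \<in> I \<Longrightarrow> (\<lambda>u. \<phi> u a) \<in> polyfun V"
  shows "(\<lambda>u. g (\<phi> u)) \<in> polyfun V"
  by (rule polyfun_comp[OF gform_polyfun[OF assms(1)] assms(2)])

text \<open>
  Let \<open>Z k\<close> be the closure of the image of the \<open>k\<close>-dimensional coordinate subspace \<open>E k\<close>. It is irreducible since
  polynomials on \<open>E k\<close> have no zero divisors. If \<open>Z k = Z (k + 1)\<close>, then every form that vanishes on the image of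
  \<open>E k\<close> vanishes on that of \<open>E (k + 1)\<close>. But the monomials in \<open>z, y\<^sub>0, \<dots>, y\<^sub>k\<close> of a large degree outnumber
  the monomials available for their pullbacks to \<open>E k\<close>, hence are dependent there, whereas they are
  independent on \<open>E (k + 1)\<close> as the \<open>y\<^sub>l\<close> have independent linear parts.
\<close>

lemma proj_dim_ge:
  fixes \<phi> :: "(nat \<Rightarrow> complex) \<Rightarrow> 'i \<Rightarrow> complex"
  assumes poly: "\<And>a. a \<in> I \<Longrightarrow> (\<lambda>u. \<phi> u a) \<in> polyfun {..<K}"
    and cv: "\<And>u. \<phi> u \<in> cvecs I"
    and Y: "closedin (zariski I) Y" "\<And>u. \<phi> u \<noteq> 0 \<Longrightarrow> pt (\<phi> u) \<in> Y"
    and z: "hform I 1 z" "z (\<phi> (\<lambda>_. 0)) = 1"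
    and y: "\<And>l. l < K \<Longrightarrow> hform I 1 (y l)" "\<And>l. l < K \<Longrightarrow> y l (\<phi> (\<lambda>_. 0)) = 0"
      "\<And>l l'. l < K \<Longrightarrow> l' < K \<Longrightarrow> pd l' (\<lambda>u. y l (\<phi> u)) (\<lambda>_. 0) = (if l = l' then 1 else 0)"
  shows "enat K \<le> proj_dim I Y"
proof -
  define E where "E k = {u :: nat \<Rightarrow> complex. \<forall>l. k \<le> l \<longrightarrow> u l = 0}" for k
  define J where "J k = {F \<in> hom_polys I. \<forall>u\<in>E k. \<phi> u \<noteq> 0 \<longrightarrow> poly_eval F (\<phi> u) = 0}" for k
  define Z where "Z k = zero_locus I (J k)" for k
  have J: "J k \<subseteq> hom_polys I" for k by (auto simp: J_def)
  have Zcl: "closedin (zariski I) (Z k)" for k unfolding closedin_zariski_iff Z_def using J by blast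
  have ptZ: "pt (\<phi> u) \<in> Z k" if "u \<in> E k" "\<phi> u \<noteq> 0" for u k
  proof -
    have "pt (\<phi> u) \<in> proj_space I" using cv[of u] that(2) by (auto simp: proj_space_def)
    then show ?thesis using that unfolding Z_def pt_in_zero_locus_iff[OF J] by (auto simp: J_def)
  qed
  have ZY: "Z k \<subseteq> Y" for k
  proof -
    obtain S where S: "S \<subseteq> hom_polys I" "Y = zero_locus I S"
      using Y(1) unfolding closedin_zariski_iff by blast
    have "S \<subseteq> J k"
    proof
      fix F assume F: "F \<in> S"
      have "poly_eval F (\<phi> u) = 0" if "\<phi> u \<noteq> 0" for u
        using Y(2)[OF that] F unfolding S(2) pt_in_zero_locus_iff[OF S(1)] by blast
      then show "F \<in> J k" using F S(1) by (auto simp: J_def)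
    qed
    then show ?thesis unfolding Z_def S(2) by (auto simp: zero_locus_def)
  qed
  have ne0: "\<phi> (\<lambda>_. 0) \<noteq> 0"
  proof
    assume "\<phi> (\<lambda>_. 0) = 0"
    then have "z (\<lambda>_. 0) = 1" using z(2) by (simp add: zero_fun_def)
    then show False using hform_zero[OF z(1)] by simp
  qed
  obtain a0 where a0: "\<phi> (\<lambda>_. 0) a0 \<noteq> 0" "a0 \<in> I"
    using ne0 cv[of "\<lambda>_. 0"] by (auto simp: fun_eq_iff cvecs_def)
  have E0: "(\<lambda>_. 0) \<in> E k" for k by (simp add: E_def)
  have line: "(\<lambda>v. u v + t * (u' v - u v)) \<in> E k" if "u \<in> E k" "u' \<in> E k" for u u' t k
    using that by (auto simp: E_def)
  have Jpoly: "(\<lambda>u. poly_eval F (\<phi> u)) \<in> polyfun {..<K}" if F: "F \<in> hom_polys I" for F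
  proof -
    obtain k where "hform I k (poly_eval F)" using hform_of_hom_poly[OF F] by blast
    then show ?thesis by (rule hform_comp_polyfun) (rule poly)
  qed
  have irr: "irreduciblein (subtopology (zariski I) Y) (Z k)" for k
  proof -
    have st: "subtopology (subtopology (zariski I) Y) (Z k) = subtopology (zariski I) (Z k)"
      using ZY[of k] by (simp add: subtopology_subtopology Int_absorb1)
    have Zp: "Z k \<subseteq> proj_space I" by (auto simp: Z_def zero_locus_def)
    have ts: "topspace (subtopology (zariski I) (Z k)) = Z k" using Zp by auto
    have main: "A = Z k \<or> B = Z k"
      if cl: "closedin (subtopology (zariski I) (Z k)) A" "closedin (subtopology (zariski I) (Z k)) B"
        and AB: "A \<union> B = Z k" for A B
    proof (rule ccontr)
      assume neg: "\<not> (A = Z k \<or> B = Z k)"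
      have ex: "\<exists>F u. F \<in> hom_polys I \<and> u \<in> E k \<and> poly_eval F (\<phi> u) \<noteq> 0 \<and> (\<forall>u'. pt (\<phi> u') \<in> C \<longrightarrow> poly_eval F (\<phi> u') = 0)"
        if C: "closedin (subtopology (zariski I) (Z k)) C" "C \<noteq> Z k" for C
      proof -
        obtain S where S: "S \<subseteq> hom_polys I" "C = zero_locus I S \<inter> Z k"
          using C(1) unfolding closedin_subtopology closedin_zariski_iff by blast
        then obtain p where p: "p \<in> Z k" "p \<notin> zero_locus I S" using C(2) by blast
        obtain v where v: "p = pt v" "p \<in> proj_space I" using p(1) Zp proj_space_pt by blast
        then obtain F where F: "F \<in> S" "poly_eval F v \<noteq> 0"
          using p(2) pt_in_zero_locus_iff[OF S(1), of v] by blast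
        have "F \<notin> J k" using p(1) F(2) unfolding v(1) Z_def pt_in_zero_locus_iff[OF J] by blast
        then obtain u where "u \<in> E k" "poly_eval F (\<phi> u) \<noteq> 0" using F(1) S(1) by (auto simp: J_def)
        moreover have "poly_eval F (\<phi> u') = 0" if "pt (\<phi> u') \<in> C" for u'
          using that F(1) unfolding S(2) by (auto simp: pt_in_zero_locus_iff[OF S(1)])
        ultimately show ?thesis using F(1) S(1) by blast
      qed
      obtain F u where F: "F \<in> hom_polys I" "u \<in> E k" "poly_eval F (\<phi> u) \<noteq> 0"
        "\<And>u'. pt (\<phi> u') \<in> A \<Longrightarrow> poly_eval F (\<phi> u') = 0" using ex[OF cl(1)] neg by blast
      obtain G u1 where G: "G \<in> hom_polys I" "u1 \<in> E k" "poly_eval G (\<phi> u1) \<noteq> 0"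
        "\<And>u'. pt (\<phi> u') \<in> B \<Longrightarrow> poly_eval G (\<phi> u') = 0" using ex[OF cl(2)] neg by blast
      obtain u2 where u2: "u2 \<in> E k" "poly_eval F (\<phi> u2) \<noteq> 0" "poly_eval G (\<phi> u2) \<noteq> 0"
        using polyfun_common_nonzero[of "\<lambda>u. poly_eval F (\<phi> u)" "{..<K}" "\<lambda>u. poly_eval G (\<phi> u)" "{..<K}" u u1,
            OF Jpoly[OF F(1)] Jpoly[OF G(1)] F(3) G(3)]
        by (elim exE conjE) (rule that[OF line[OF F(2) G(2)]])
      have FG: "(\<lambda>u. poly_eval F (\<phi> u) * poly_eval G (\<phi> u)) \<in> polyfun {..<K}"
        by (rule polyfun.mult[OF Jpoly[OF F(1)] Jpoly[OF G(1)]])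
      have u2': "poly_eval F (\<phi> u2) * poly_eval G (\<phi> u2) \<noteq> 0" using u2 by simp
      obtain u3 where u3: "u3 \<in> E k" "poly_eval F (\<phi> u3) * poly_eval G (\<phi> u3) \<noteq> 0" "\<phi> u3 a0 \<noteq> 0"
        using polyfun_common_nonzero[of "\<lambda>u. poly_eval F (\<phi> u) * poly_eval G (\<phi> u)" "{..<K}" "\<lambda>u. \<phi> u a0" "{..<K}"
            u2 "\<lambda>_. 0", OF FG poly[OF a0(2)] u2' a0(1)]
        by (elim exE conjE) (rule that[OF line[OF u2(1) E0]])
      have "pt (\<phi> u3) \<in> Z k" using u3 by (intro ptZ) (auto simp: fun_eq_iff)
      then show False using AB F(4)[of u3] G(4)[of u3] u3(2) by auto
    qed
    have "Z k \<noteq> {}" using ptZ[OF E0 ne0] by blast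
    then show ?thesis
      unfolding irreduciblein_def irreducible_space_def st ts using main ZY[of k] Zp by auto
  qed
  have strict: "Z k \<subset> Z (Suc k)" if k: "k < K" for k
  proof -
    have "E k \<subseteq> E (Suc k)" by (auto simp: E_def)
    then have "J (Suc k) \<subseteq> J k" by (auto simp: J_def)
    then have sub: "Z k \<subseteq> Z (Suc k)" by (auto simp: Z_def zero_locus_def)
    have "Z k \<noteq> Z (Suc k)"
    proof
      assume eq: "Z k = Z (Suc k)"
      define res where "res u = (\<lambda>l. if l < k then u l else 0)" for u :: "nat \<Rightarrow> complex"
      have resE: "res u \<in> E k" for u by (simp add: res_def E_def)
      have res: "res u = u" if "u \<in> E k" for u using that by (auto simp: res_def E_def fun_eq_iff)
      have pres: "(\<lambda>u. g (\<phi> (res u))) \<in> polyfun {..<k}" if "hform I 1 g" for g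
      proof (rule polyfun_comp[OF hform_comp_polyfun[OF that poly], of "\<lambda>u. u"])
        fix l show "(\<lambda>u. res u l) \<in> polyfun {..<k}"
          by (cases "l < k") (simp_all add: res_def polyfun.intros)
      qed
      obtain \<delta>0 where \<delta>0: "(\<lambda>u. z (\<phi> (res u))) \<in> boxed {..<k} \<delta>0"
        using polyfun_boxed[OF pres[OF z(1)]] by blast
      have "\<exists>\<delta>. (\<lambda>u. y l (\<phi> (res u))) \<in> boxed {..<k} \<delta>" if "l < K" for l
        using polyfun_boxed[OF pres[OF y(1)[OF that]]] by blast
      then obtain \<delta>1 where \<delta>1: "\<And>l. l < K \<Longrightarrow> (\<lambda>u. y l (\<phi> (res u))) \<in> boxed {..<k} (\<delta>1 l)" by metis
      define \<delta> where "\<delta> = \<delta>0 + (\<Sum>l<K. \<delta>1 l)"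
      have b0: "(\<lambda>u. z (\<phi> (res u))) \<in> boxed {..<k} \<delta>"
        using \<delta>0 by (rule boxed_mono) (simp add: \<delta>_def)
      have b1: "(\<lambda>u. y l (\<phi> (res u))) \<in> boxed {..<k} \<delta>" if "l < K" for l
      proof (rule boxed_mono[OF \<delta>1[OF that]])
        have "\<delta>1 l \<le> (\<Sum>l<K. \<delta>1 l)" using that by (intro member_le_sum) auto
        then show "\<delta>1 l \<le> \<delta>" by (simp add: \<delta>_def)
      qed
      \<comment> \<open>This \<open>e\<close> gives \<open>((k + 1) e \<delta> + 1)\<^sup>k \<le> e (e + 1)\<^sup>k < (e + 1)\<^bsup>k+1\<^esup>\<close>, i.e. more products \<open>\<Psi> \<alpha>\<close> than monomials.\<close>
      define e where "e = ((k + 1) * \<delta> + 1) ^ k"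
      define N where "N = (k + 1) * e"
      define A where "A = box {..<Suc k} e"
      define s where "s \<alpha> = (\<Sum>l<Suc k. \<alpha> l)" for \<alpha> :: "nat \<Rightarrow> nat"
      define \<Psi> where "\<Psi> \<alpha> v = z v ^ (N - s \<alpha>) * (\<Prod>l<Suc k. y l v ^ \<alpha> l)" for \<alpha> v
      have finA: "finite A" and cardA: "card A = (e + 1) ^ Suc k"
        using card_box[of "{..<Suc k}" e] by (simp_all add: A_def)
      have sN: "s \<alpha> \<le> N" if "\<alpha> \<in> A" for \<alpha>
      proof -
        have "s \<alpha> \<le> (\<Sum>l<Suc k. e)" unfolding s_def using that by (intro sum_mono) (auto simp: A_def box_def)
        then show ?thesis by (simp add: N_def)
      qed
      have pow: "hform I s' (\<lambda>v. g v ^ s')" if "hform I 1 g" for g s'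
        using gform_power[OF that, of s'] by simp
      have \<Psi>: "hform I N (\<Psi> \<alpha>)" if "\<alpha> \<in> A" for \<alpha>
      proof -
        have "hform I ((N - s \<alpha>) + (\<Sum>l<Suc k. \<alpha> l)) (\<Psi> \<alpha>)"
          unfolding \<Psi>_def using k by (intro gform.mult gform_prod pow z y(1)) auto
        then show ?thesis using sN[OF that] by (simp add: s_def)
      qed
      have \<Psi>b: "(\<lambda>u. \<Psi> \<alpha> (\<phi> (res u))) \<in> cvec.span (mon {..<k} ` box {..<k} (N * \<delta>))" if "\<alpha> \<in> A" for \<alpha>
      proof -
        have "(\<lambda>u. \<Psi> \<alpha> (\<phi> (res u))) \<in> boxed {..<k} ((N - s \<alpha>) * \<delta> + (\<Sum>l<Suc k. \<alpha> l * \<delta>))"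
          unfolding \<Psi>_def using k by (intro boxed_mult boxed_prod boxed_power b0 b1) auto
        moreover have "(N - s \<alpha>) * \<delta> + (\<Sum>l<Suc k. \<alpha> l * \<delta>) = N * \<delta>"
          using sN[OF that] by (simp add: s_def flip: sum_distrib_right distrib_right)
        ultimately show ?thesis by (simp add: boxed_def)
      qed
      have less: "card (mon {..<k} ` box {..<k} (N * \<delta>)) < card A"
      proof -
        have "card (mon {..<k} ` box {..<k} (N * \<delta>)) \<le> (N * \<delta> + 1) ^ k"
          using card_box[of "{..<k}" "N * \<delta>"] card_image_le[of "box {..<k} (N * \<delta>)" "mon {..<k}"] by simp
        also have "\<dots> \<le> (((k + 1) * \<delta> + 1) * (e + 1)) ^ k"
          by (intro power_mono) (simp_all add: N_def algebra_simps)
        also have "\<dots> = e * (e + 1) ^ k" by (simp only: power_mult_distrib e_def)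
        also have "\<dots> < (e + 1) ^ Suc k" by simp
        finally show ?thesis by (simp only: cardA)
      qed
      have "\<exists>c. (\<exists>\<alpha>\<in>A. c \<alpha> \<noteq> 0) \<and> (\<forall>u. (\<Sum>\<alpha>\<in>A. c \<alpha> * \<Psi> \<alpha> (\<phi> (res u))) = 0)"
        by (rule dependent_of_card_less[OF finA _ less \<Psi>b]) (use card_box[of "{..<k}"] in simp)
      then obtain c where c: "\<exists>\<alpha>\<in>A. c \<alpha> \<noteq> 0" "\<forall>u. (\<Sum>\<alpha>\<in>A. c \<alpha> * \<Psi> \<alpha> (\<phi> (res u))) = 0" by (elim exE conjE)
      define G where "G v = (\<Sum>\<alpha>\<in>A. c \<alpha> * \<Psi> \<alpha> v)" for v
      obtain \<alpha>0 where \<alpha>0: "\<alpha>0 \<in> A" "c \<alpha>0 \<noteq> 0" using c(1) by blast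
      have G: "hform I N G"
        unfolding G_def[abs_def] by (intro gform_sum[OF \<Psi>[OF \<alpha>0(1)]] gform_cmult \<Psi>)
      obtain F where F: "F \<in> hom_polys I" "poly_eval F = G" using hom_poly_of_hform[OF G] by blast
      have "G (\<phi> u) = 0" if "u \<in> E k" for u
        using spec[OF c(2), of u] res[OF that] by (simp add: G_def)
      then have FJ: "F \<in> J k" using F by (auto simp: J_def)
      have GE: "G (\<phi> u) = 0" if u: "u \<in> E (Suc k)" for u
      proof (cases "\<phi> u = 0")
        case True
        have "N > 0" by (simp add: N_def e_def)
        then show ?thesis using hform_zero[OF G] True by (simp add: zero_fun_def)
      next
        case False
        then have "pt (\<phi> u) \<in> Z k" using ptZ[OF u] eq by simp
        then show ?thesis using FJ F(2) unfolding Z_def pt_in_zero_locus_iff[OF J] by blast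
      qed
      define res' where "res' w = (\<lambda>l. if l < Suc k then w l else 0)" for w :: "nat \<Rightarrow> complex"
      have lines: "\<exists>p. (\<forall>t. g (\<phi> (\<lambda>v. t * res' w v)) = poly p t) \<and> coeff p 1 = (\<Sum>v<K. res' w v * pd v (\<lambda>u. g (\<phi> u)) (\<lambda>_. 0))"
        if "hform I 1 g" for g w
        using polyfun_line[OF hform_comp_polyfun[OF that poly], of "\<lambda>u. u" "\<lambda>_. 0" "res' w"] by simp
      define Q where "Q g w = (SOME p. (\<forall>t. g (\<phi> (\<lambda>v. t * res' w v)) = poly p t) \<and>
        coeff p 1 = (\<Sum>v<K. res' w v * pd v (\<lambda>u. g (\<phi> u)) (\<lambda>_. 0)))" for g w
      have Q: "(\<forall>t. g (\<phi> (\<lambda>v. t * res' w v)) = poly (Q g w) t) \<and>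
        coeff (Q g w) 1 = (\<Sum>v<K. res' w v * pd v (\<lambda>u. g (\<phi> u)) (\<lambda>_. 0))" if "hform I 1 g" for g w
        unfolding Q_def by (rule someI_ex) (rule lines[OF that])
      define P0 where "P0 w = Q z w" for w
      define P where "P w l = Q (y l) w" for w l
      have P0: "z (\<phi> (\<lambda>v. t * res' w v)) = poly (P0 w) t" for w t
        using Q[OF z(1), of w] unfolding P0_def by (elim conjE) (erule spec)
      have P: "y l (\<phi> (\<lambda>v. t * res' w v)) = poly (P w l) t"
        "coeff (P w l) 1 = (\<Sum>v<K. res' w v * pd v (\<lambda>u. y l (\<phi> u)) (\<lambda>_. 0))"
        if "l < Suc k" for l w t
      proof -
        have "l < K" using that k by simp
        note conj = Q[OF y(1)[OF this], of w]
        show "y l (\<phi> (\<lambda>v. t * res' w v)) = poly (P w l) t"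
          unfolding P_def by (rule spec[OF conjunct1[OF conj]])
        show "coeff (P w l) 1 = (\<Sum>v<K. res' w v * pd v (\<lambda>u. y l (\<phi> u)) (\<lambda>_. 0))"
          unfolding P_def by (rule conjunct2[OF conj])
      qed
      have "c \<alpha>0 = 0"
      proof (rule leading_terms_vanish[where k = "Suc k" and N = N and A = A and P = P and H = P0 and c = c and \<alpha> = \<alpha>0 and f = "\<lambda>w. w"])
        show "finite A" by (rule finA)
        show "(\<Sum>l<Suc k. \<alpha> l) \<le> N" if "\<alpha> \<in> A" for \<alpha> using sN[OF that] by (simp only: s_def)
        show "\<alpha> l = 0" if "\<alpha> \<in> A" "\<not> l < Suc k" for \<alpha> l using that by (simp add: A_def box_def)
        show "coeff (P0 w) 0 = 1" for w using P0[of 0 w] z(2) by (simp add: poly_0_coeff_0)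
        show "coeff (P w l) 0 = 0" if "l < Suc k" for w l
          using P(1)[OF that, of 0 w] y(2)[of l] that k by (simp add: poly_0_coeff_0)
        show "coeff (P w l) 1 = w l" if "l < Suc k" for w l
        proof -
          have lK: "l < K" using that k by simp
          have "(\<Sum>v<K. res' w v * pd v (\<lambda>u. y l (\<phi> u)) (\<lambda>_. 0)) = (\<Sum>v<K. if l = v then res' w v else 0)"
            using y(3)[OF lK] by (intro sum.cong) auto
          also have "\<dots> = w l" using lK that by (simp add: res'_def)
          finally show ?thesis using P(2)[OF that, of w] by simp
        qed
        show "\<exists>w. \<forall>l<Suc k. w l = x l" for x :: "nat \<Rightarrow> complex" by blast
        show "\<alpha>0 \<in> A" by (rule \<alpha>0(1))
        show "(\<Sum>\<alpha>\<in>A. c \<alpha> * (poly (P0 w) t ^ (N - (\<Sum>l<Suc k. \<alpha> l)) * (\<Prod>l<Suc k. poly (P w l) t ^ \<alpha> l))) = 0" for w t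
        proof -
          have "(\<lambda>v. t * res' w v) \<in> E (Suc k)" by (simp add: E_def res'_def)
          then have "0 = G (\<phi> (\<lambda>v. t * res' w v))" using GE by simp
          also have "\<dots> = (\<Sum>\<alpha>\<in>A. c \<alpha> * (poly (P0 w) t ^ (N - (\<Sum>l<Suc k. \<alpha> l)) * (\<Prod>l<Suc k. poly (P w l) t ^ \<alpha> l)))"
            unfolding G_def \<Psi>_def s_def P0
            by (intro sum.cong refl arg_cong2[of _ _ _ _ "(*)"] prod.cong) (simp add: P(1))
          finally show ?thesis by simp
        qed
      qed
      then show False using \<alpha>0(2) by simp
    qed
    then show ?thesis using sub by blast
  qed
  have cl: "closedin (subtopology (zariski I) Y) (Z k)" for k
    using Zcl[of k] ZY[of k] by (metis closedin_subtopology inf.absorb1)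
  have "enat K \<in> {enat k |k. \<exists>Z. (\<forall>i\<le>k. closedin (subtopology (zariski I) Y) (Z i) \<and>
      irreduciblein (subtopology (zariski I) Y) (Z i)) \<and> (\<forall>i<k. Z i \<subset> Z (Suc i))}"
    using cl irr strict by (intro CollectI exI[of _ K] conjI refl exI[of _ Z]) auto
  then show ?thesis unfolding proj_dim_def krull_dim_def by (rule Sup_upper)
qed

section \<open>Tangent spaces to the secant varieties\<close>

lemma finite_multi_exps: "finite (multi_exps r n d)"
proof -
  let ?E = "graded_exps mdeg (mvars r n) (mtype r d)"
  have "multi_exps r n d \<subseteq> (\<lambda>a i j. a (i, j)) ` ?E"
  proof
    fix a assume "a \<in> multi_exps r n d"
    then have "(\<lambda>(i, j). a i j) \<in> ?E" by (simp add: graded_exps_mvars)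
    then show "a \<in> (\<lambda>a i j. a (i, j)) ` ?E" by (rule rev_image_eqI) simp
  qed
  moreover have "finite ?E"
    using card_multi_graded_exps[of r d "(\<Sum>i=1..r. d i) + 1" n] member_le_sum[of _ "{1..r}" d] by auto
  ultimately show ?thesis by (rule finite_surj[rotated])
qed

text \<open>
  The coordinates of the Segre-Veronese embedding are all monomials of multidegree \<open>d\<close>, so multiforms are the
  linear functionals on its ambient space.
\<close>

lemma mform_coeffs:
  assumes "gform mdeg (mvars r n) (mtype r d) M"
  shows "\<exists>c. \<forall>z. M z = (\<Sum>a\<in>multi_exps r n d. c a * sv_vec r n d (\<lambda>k j. z (k, j)) a)"
  using gform_span[OF assms finite_mvars]
proof (induction rule: cvec.span_induct_alt)
  case base
  show ?case by (rule exI[of _ "\<lambda>_. 0"]) simp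
next
  case (step s f F)
  then obtain c b where c: "\<And>z. F z = (\<Sum>a\<in>multi_exps r n d. c a * sv_vec r n d (\<lambda>k j. z (k, j)) a)"
    and b: "f = mon (mvars r n) b" "b \<in> graded_exps mdeg (mvars r n) (mtype r d)" by auto
  define b' where "b' = (\<lambda>i j. b (i, j))"
  have b': "b' \<in> multi_exps r n d" using b(2) unfolding graded_exps_mvars b'_def .
  have f: "f z = sv_vec r n d (\<lambda>k j. z (k, j)) b'" for z
    unfolding sv_vec_mon[OF b'] b(1) by (simp add: b'_def)
  show ?case
  proof (intro exI allI)
    fix z
    have "(\<Sum>a\<in>multi_exps r n d. ((if a = b' then s else 0) + c a) * sv_vec r n d (\<lambda>k j. z (k, j)) a)
       = (\<Sum>a\<in>multi_exps r n d. if a = b' then s * sv_vec r n d (\<lambda>k j. z (k, j)) b' else 0) + F z"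
      unfolding c sum.distrib[symmetric] by (intro sum.cong) (auto simp: algebra_simps)
    also have "\<dots> = s * f z + F z" using finite_multi_exps b' by (simp add: f)
    finally show "((\<lambda>i. s * f i) + F) z
       = (\<Sum>a\<in>multi_exps r n d. ((if a = b' then s else 0) + c a) * sv_vec r n d (\<lambda>k j. z (k, j)) a)"
      by simp
  qed
qed

lemma sv_vec_cong:
  "(\<And>i j. (i, j) \<in> mvars r n \<Longrightarrow> x i j = y i j) \<Longrightarrow> sv_vec r n d x = sv_vec r n d y"
  by (auto simp: sv_vec_def fun_eq_iff mvars_def intro!: prod.cong)

lemma sv_vec_in_segre_veronese:
  assumes "sv_vec r n d x \<noteq> 0" "\<And>i. i \<in> {1..r} \<Longrightarrow> 0 < d i"
  shows "pt (sv_vec r n d x) \<in> segre_veronese r n d"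
proof -
  define y where "y i j = (if (i, j) \<in> mvars r n then x i j else 0)" for i j
  have xy: "sv_vec r n d x = sv_vec r n d y" by (rule sv_vec_cong) (simp add: y_def)
  have "y i \<in> cvecs {0..n i} - {0}" if i: "i \<in> {1..r}" for i
  proof -
    have "y i \<noteq> 0"
    proof
      assume y0: "y i = 0"
      have "sv_vec r n d y a = 0" for a
      proof (cases "a \<in> multi_exps r n d")
        case True
        then have "(\<Sum>j=0..n i. a i j) = d i" using i by (auto simp: multi_exps_def)
        then have "(\<Sum>j=0..n i. a i j) \<noteq> 0" using assms(2)[OF i] by simp
        then have "\<not> (\<forall>j\<in>{0..n i}. a i j = 0)" using sum.neutral[of "{0..n i}" "a i"] by simp
        then obtain j where j: "j \<in> {0..n i}" "a i j \<noteq> 0" by auto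
        have "(\<Prod>j=0..n i. y i j ^ a i j) = 0" using j y0 by (auto simp: prod_zero_iff)
        then have "(\<Prod>i=1..r. \<Prod>j=0..n i. y i j ^ a i j) = 0" using i by (auto simp: prod_zero_iff)
        then show ?thesis by (simp add: sv_vec_def)
      qed (simp add: sv_vec_outside)
      then show False using assms(1) xy by (simp add: fun_eq_iff)
    qed
    then show ?thesis using i by (auto simp: cvecs_def y_def mvars_def)
  qed
  then show ?thesis unfolding segre_veronese_def xy by blast
qed

text \<open>
  A curve in the variety; the exponents \<open>a\<close> and \<open>b\<close> belong to two coordinates with the values \<open>1\<close> and \<open>t\<close> along it.
\<close>

lemma infinite_segre_veronese:
  assumes "1 \<le> r" "\<And>i. i \<in> {1..r} \<Longrightarrow> 0 < d i" "0 < n 1"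
  shows "infinite (segre_veronese r n d)"
proof -
  define x where "x t i j = (if j = 0 then 1 else if i = 1 \<and> j = 1 then t else (0::complex))" for t and i j :: nat
  define a where "a i j = (if i \<in> {1..r} \<and> j = 0 then d i else 0)" for i j :: nat
  define b where "b = a(1 := (\<lambda>j. if j = 0 then d 1 - 1 else if j = 1 then 1 else 0))"
  have a: "a \<in> multi_exps r n d"
    by (auto simp: multi_exps_def a_def sum.atLeast_Suc_atMost)
  have b: "b \<in> multi_exps r n d"
  proof -
    have "(\<Sum>j=0..n 1. b 1 j) = (\<Sum>j\<in>{0, 1}. b 1 j)"
      using assms(3) by (intro sum.mono_neutral_right) (auto simp: b_def)
    then have "(\<Sum>j=0..n 1. b 1 j) = d 1" using assms(1) assms(2)[of 1] by (simp add: b_def)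
    moreover have "(\<Sum>j=0..n i. b i j) = d i" if "i \<in> {1..r}" "i \<noteq> 1" for i
      using a that by (simp add: b_def multi_exps_def)
    ultimately have "\<forall>i\<in>{1..r}. (\<Sum>j=0..n i. b i j) = d i" by metis
    moreover have "b i j = 0" if "\<not> (i \<in> {1..r} \<and> j \<in> {0..n i})" for i j
      using that assms(1,3) by (auto simp: b_def a_def)
    ultimately show ?thesis by (simp add: multi_exps_def)
  qed
  have sa: "sv_vec r n d (x t) a = 1" for t
    using a by (auto simp: sv_vec_def a_def x_def intro!: prod.neutral)
  have sb: "sv_vec r n d (x t) b = t" for t
  proof -
    have "(\<Prod>i=1..r. \<Prod>j=0..n i. x t i j ^ b i j) = (\<Prod>i\<in>{1}. \<Prod>j=0..n i. x t i j ^ b i j)"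
      using assms(1) by (intro prod.mono_neutral_right) (auto simp: b_def a_def x_def intro!: prod.neutral)
    also have "\<dots> = (\<Prod>j=0..n 1. x t 1 j ^ b 1 j)" by simp
    also have "\<dots> = (\<Prod>j\<in>{1}. x t 1 j ^ b 1 j)"
      using assms(3) by (intro prod.mono_neutral_right) (auto simp: b_def x_def)
    finally show ?thesis using b by (simp add: sv_vec_def b_def x_def)
  qed
  have "inj (\<lambda>t. pt (sv_vec r n d (x t)))"
  proof (rule injI)
    fix s t assume "pt (sv_vec r n d (x s)) = pt (sv_vec r n d (x t))"
    then obtain c where c: "sv_vec r n d (x s) = (\<lambda>i. c * sv_vec r n d (x t) i)" using pt_eqD by blast
    have "c = 1" using fun_cong[OF c, of a] by (simp add: sa)
    then show "s = t" using fun_cong[OF c, of b] by (simp add: sb)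
  qed
  then have "infinite (range (\<lambda>t. pt (sv_vec r n d (x t))))"
    using infinite_UNIV_char_0 finite_imageD by blast
  moreover have "range (\<lambda>t. pt (sv_vec r n d (x t))) \<subseteq> segre_veronese r n d"
  proof
    fix p assume "p \<in> range (\<lambda>t. pt (sv_vec r n d (x t)))"
    then obtain t where t: "p = pt (sv_vec r n d (x t))" by blast
    have "sv_vec r n d (x t) \<noteq> 0" using sa[of t] by (auto dest: fun_cong[of _ _ a])
    then show "p \<in> segre_veronese r n d" unfolding t by (rule sv_vec_in_segre_veronese) (rule assms(2))
  qed
  ultimately show ?thesis using finite_subset by blast
qed

text \<open>
  The points in the sum may coincide or vanish, while \<open>secant\<close> asks for exactly \<open>h\<close> points. The infinite
  variety supplies the missing ones.
\<close>

lemma sum_in_secant: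
  assumes "infinite X" "v \<noteq> 0" "v \<in> cvecs I"
    and v: "v = (\<lambda>a. \<Sum>i<h. c i * w i a)" "\<And>i. i < h \<Longrightarrow> w i \<noteq> 0 \<Longrightarrow> pt (w i) \<in> X"
  shows "pt v \<in> secant I h X"
proof -
  define S0 where "S0 = (\<lambda>i. pt (w i)) ` {i \<in> {..<h}. w i \<noteq> 0}"
  have S0: "finite S0" "S0 \<subseteq> X" using v(2) by (auto simp: S0_def)
  have "card S0 \<le> card {i \<in> {..<h}. w i \<noteq> 0}" unfolding S0_def by (rule card_image_le) simp
  also have "\<dots> \<le> card {..<h}" by (rule card_mono) auto
  finally have card0: "card S0 \<le> h" by simp
  obtain T where T: "T \<subseteq> X - S0" "finite T" "card T = h - card S0"
    using infinite_arbitrarily_large[of "X - S0" "h - card S0"] S0(1) assms(1) by (auto simp: Diff_infinite_finite)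
  define S where "S = S0 \<union> T"
  have S: "S \<subseteq> X" "finite S" using S0 T by (auto simp: S_def)
  have "card S = card S0 + card T" unfolding S_def using S0(1) T by (intro card_Un_disjoint) auto
  then have cardS: "card S = h" using card0 T(3) by simp
  have wS: "w i \<in> cvec.span (\<Union>S)" if "i < h" for i
  proof (cases "w i = 0")
    case True
    then show ?thesis by (simp add: cvec.span_zero)
  next
    case False
    then have "pt (w i) \<in> S" using that by (auto simp: S_def S0_def)
    then show ?thesis using mem_pt[of "w i"] by (intro cvec.span_base) auto
  qed
  have v': "v = (\<Sum>i<h. (\<lambda>a. c i * w i a))" unfolding v(1) by (simp add: fun_eq_iff sum_apply)
  have vS: "v \<in> cvec.span (\<Union>S)"
    unfolding v' by (rule cvec.span_sum, rule cvec.span_scale, rule wS) simp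
  have "pt v \<subseteq> cvec.span (\<Union>S)"
    unfolding pt_eq using cvec.span_scale[OF vS] by auto
  moreover have vp: "pt v \<in> proj_space I" using assms(2,3) by (auto simp: proj_space_def)
  ultimately have "pt v \<in> lin_span I S" by (simp add: lin_span_def)
  then have mem: "pt v \<in> \<Union>{lin_span I S |S. S \<subseteq> X \<and> finite S \<and> card S = h}" using S cardS by blast
  have "\<Union>{lin_span I S |S. S \<subseteq> X \<and> finite S \<and> card S = h} \<subseteq> topspace (zariski I)"
    by (auto simp: lin_span_def)
  from subsetD[OF closure_of_subset[OF this] mem] show ?thesis unfolding secant_def .
qed

text \<open>
  The map \<open>\<phi>\<close> moves the sum of the \<open>h\<close> points along \<open>U\<close> and rescales all summands except the first, which fixes
  the overall scale. Its derivatives are evaluated by multiforms, which are linear functionals on the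
  ambient space, and \<open>sol\<close> provides a dual basis for them. So \<open>proj_dim_ge\<close> applies.
\<close>

lemma secant_dim_ge:
  fixes P :: "nat \<Rightarrow> nat \<times> nat \<Rightarrow> complex"
  assumes rn: "1 \<le> r" "\<And>i. i \<in> {1..r} \<Longrightarrow> 0 < d i" "0 < n 1" and h: "1 \<le> h"
    and U: "finite U" "U \<subseteq> {..<h} \<times> mvars r n"
    and sol: "\<And>v \<beta>. \<exists>M. gform mdeg (mvars r n) (mtype r d) M \<and> (\<forall>i<h. M (P i) = v i) \<and>
      (\<forall>(i, w)\<in>U. pd w M (P i) = \<beta> i w)"
  shows "enat (h - 1 + card U) \<le> proj_dim (multi_exps r n d) (secant (multi_exps r n d) h (segre_veronese r n d))"
proof -
  let ?I = "multi_exps r n d" and ?X = "segre_veronese r n d"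
  define K where "K = h - 1 + card U"
  obtain ix where ix: "bij_betw ix U {..<card U}"
    using ex_bij_betw_finite_nat[OF U(1)] by (auto simp: atLeast0LessThan)
  have ixb: "ix x < card U" if "x \<in> U" for x using ix that by (auto simp: bij_betw_def)
  have ixi: "ix x = ix y \<longleftrightarrow> x = y" if "x \<in> U" "y \<in> U" for x y
    using ix that by (auto simp: bij_betw_def inj_on_def)
  define sc where "sc u i = (1 + (if i = 0 then 0 else u (i - 1)) :: complex)" for u :: "nat \<Rightarrow> complex" and i :: nat
  define pnt where "pnt u i w = P i w + (if (i, w) \<in> U then u (h - 1 + ix (i, w)) else 0)" for u i w
  define \<phi> where "\<phi> u a = (\<Sum>i<h. sc u i * sv_vec r n d (\<lambda>k j. pnt u i (k, j)) a)" for u a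
  have psc: "(\<lambda>u. sc u i) \<in> polyfun {..<K}" if "i < h" for i
  proof -
    have "(\<lambda>u. u (i - 1)) \<in> polyfun {..<K}" if "i \<noteq> 0" using that \<open>i < h\<close> by (intro polyfun.var) (auto simp: K_def)
    then show ?thesis by (cases "i = 0") (simp_all add: sc_def polyfun.intros)
  qed
  have ppnt: "(\<lambda>u. pnt u i w) \<in> polyfun {..<K}" for i w
  proof -
    have "(\<lambda>u. u (h - 1 + ix (i, w))) \<in> polyfun {..<K}" if "(i, w) \<in> U"
      using ixb[OF that] by (intro polyfun.var) (simp add: K_def)
    then show ?thesis by (cases "(i, w) \<in> U") (simp_all add: pnt_def polyfun.intros)
  qed
  have pcomp: "(\<lambda>u. \<Sum>i<h. sc u i * M (pnt u i)) \<in> polyfun {..<K}" if "gform mdeg (mvars r n) g M" for M g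
  proof (rule polyfun_sum, rule polyfun.mult)
    fix i assume "i \<in> {..<h}"
    then show "(\<lambda>u. sc u i) \<in> polyfun {..<K}" using psc by simp
    show "(\<lambda>u. M (pnt u i)) \<in> polyfun {..<K}"
      by (rule polyfun_comp[OF gform_polyfun[OF that]]) (rule ppnt)
  qed
  have "\<exists>y. hform ?I 1 y \<and> (\<forall>u. y (\<phi> u) = (\<Sum>i<h. sc u i * M (pnt u i)))"
    if M: "gform mdeg (mvars r n) (mtype r d) M" "?I \<noteq> {}" for M
  proof -
    obtain c where c: "\<And>z. M z = (\<Sum>a\<in>?I. c a * sv_vec r n d (\<lambda>k j. z (k, j)) a)"
      using mform_coeffs[OF M(1)] by blast
    define y where "y v = (\<Sum>a\<in>?I. c a * v a)" for v
    have t: "hform ?I 1 (\<lambda>v. c a * v a)" if "a \<in> ?I" for a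
      using gform_cmult[OF gform.var[OF that, of "\<lambda>_. 1::nat"]] by simp
    obtain a0 where "a0 \<in> ?I" using M(2) by blast
    then have "hform ?I 1 y" unfolding y_def[abs_def] by (intro gform_sum[OF t] t)
    moreover have "y (\<phi> u) = (\<Sum>i<h. sc u i * M (pnt u i))" for u
      unfolding y_def \<phi>_def c sum_distrib_left
      by (subst sum.swap) (simp add: mult_ac)
    ultimately show ?thesis by blast
  qed
  note functional = this
  have P0: "sc (\<lambda>_. 0) i = 1" "pnt (\<lambda>_. 0) i = P i" for i
    by (simp_all add: sc_def pnt_def fun_eq_iff)
  have pd_scale: "pd l (\<lambda>u. \<Sum>i<h. sc u i * M (pnt u i)) (\<lambda>_. 0) = M (P (Suc l))"
    if l: "l < h - 1" for l and M :: "(nat \<times> nat \<Rightarrow> complex) \<Rightarrow> complex"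
  proof (rule pd_eqI)
    have e: "(\<Sum>i<h. sc ((\<lambda>_. 0)(l := t)) i * M (pnt ((\<lambda>_. 0)(l := t)) i)) = (\<Sum>i<h. M (P i)) + t * M (P (Suc l))" for t
    proof -
      have "pnt ((\<lambda>_. 0)(l := t)) i = P i" for i
        using l by (auto simp: pnt_def fun_eq_iff)
      moreover have "sc ((\<lambda>_. 0)(l := t)) i = 1 + (if i = Suc l then t else 0)" for i
        by (cases i) (auto simp: sc_def)
      ultimately have "(\<Sum>i<h. sc ((\<lambda>_. 0)(l := t)) i * M (pnt ((\<lambda>_. 0)(l := t)) i))
          = (\<Sum>i<h. M (P i) + (if i = Suc l then t * M (P (Suc l)) else 0))"
        by (intro sum.cong) (auto simp: algebra_simps)
      then show ?thesis using l by (simp add: sum.distrib)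
    qed
    show "((\<lambda>t. \<Sum>i<h. sc ((\<lambda>_. 0)(l := t)) i * M (pnt ((\<lambda>_. 0)(l := t)) i)) has_field_derivative M (P (Suc l)))
       (at ((\<lambda>_. 0) l))"
      unfolding e by (auto intro!: derivative_eq_intros)
  qed
  have pd_dir: "pd (h - 1 + ix (i0, w0)) (\<lambda>u. \<Sum>i<h. sc u i * M (pnt u i)) (\<lambda>_. 0) = pd w0 M (P i0)"
    if iw: "(i0, w0) \<in> U" and M: "M \<in> polyfun V" for i0 w0 M V
  proof (rule pd_eqI)
    let ?l = "h - 1 + ix (i0, w0)"
    have i0: "i0 < h" using iw U(2) by auto
    have e: "(\<Sum>i<h. sc ((\<lambda>_. 0)(?l := t)) i * M (pnt ((\<lambda>_. 0)(?l := t)) i))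
       = M ((P i0)(w0 := t + P i0 w0)) + (\<Sum>i\<in>{..<h} - {i0}. M (P i))" for t
    proof -
      have p: "pnt ((\<lambda>_. 0)(?l := t)) i = (if i = i0 then (P i0)(w0 := t + P i0 w0) else P i)" for i
      proof
        fix w
        have "(i, w) \<in> U \<Longrightarrow> ix (i, w) = ix (i0, w0) \<longleftrightarrow> i = i0 \<and> w = w0" using ixi[OF _ iw] by simp
        then show "pnt ((\<lambda>_. 0)(?l := t)) i w = (if i = i0 then (P i0)(w0 := t + P i0 w0) else P i) w"
          using iw by (auto simp: pnt_def)
      qed
      have s: "sc ((\<lambda>_. 0)(?l := t)) i = 1" if "i < h" for i
        using that by (auto simp: sc_def)
      have "(\<Sum>i<h. sc ((\<lambda>_. 0)(?l := t)) i * M (pnt ((\<lambda>_. 0)(?l := t)) i))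
         = (\<Sum>i<h. M (if i = i0 then (P i0)(w0 := t + P i0 w0) else P i))"
      proof (rule sum.cong[OF refl])
        fix i assume "i \<in> {..<h}"
        then have "i < h" by simp
        show "sc ((\<lambda>_. 0)(?l := t)) i * M (pnt ((\<lambda>_. 0)(?l := t)) i) = M (if i = i0 then (P i0)(w0 := t + P i0 w0) else P i)"
          unfolding s[OF \<open>i < h\<close>] p by simp
      qed
      also have "\<dots> = M ((P i0)(w0 := t + P i0 w0)) + (\<Sum>i\<in>{..<h} - {i0}. M (if i = i0 then (P i0)(w0 := t + P i0 w0) else P i))"
        using i0 by (subst sum.remove[of _ i0]) auto
      also have "(\<Sum>i\<in>{..<h} - {i0}. M (if i = i0 then (P i0)(w0 := t + P i0 w0) else P i)) = (\<Sum>i\<in>{..<h} - {i0}. M (P i))"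
        by (intro sum.cong) auto
      finally show ?thesis .
    qed
    have "((\<lambda>t. M ((P i0)(w0 := t + P i0 w0))) has_field_derivative pd w0 M (P i0)) (at 0)"
      using polyfun_has_pd[OF M, of "P i0" w0]
      by (subst DERIV_shift[of "\<lambda>t. M ((P i0)(w0 := t))" "pd w0 M (P i0)" 0 "P i0 w0", symmetric]) simp
    then show "((\<lambda>t. \<Sum>i<h. sc ((\<lambda>_. 0)(?l := t)) i * M (pnt ((\<lambda>_. 0)(?l := t)) i)) has_field_derivative pd w0 M (P i0))
       (at ((\<lambda>_. 0) ?l))"
      unfolding e by (auto intro!: derivative_eq_intros simp del: fun_upd_apply)
  qed
  have Kcases: "(l < h - 1) \<or> (\<exists>i w. (i, w) \<in> U \<and> l = h - 1 + ix (i, w))" if "l < K" for l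
  proof (cases "l < h - 1")
    case False
    then have "l - (h - 1) \<in> ix ` U" using ix that by (auto simp: bij_betw_def K_def)
    then obtain x where x: "x \<in> U" "l - (h - 1) = ix x" by blast
    obtain i w where iw: "x = (i, w)" by (cases x)
    have "l = h - 1 + ix (i, w)" using x(2) False unfolding iw by linarith
    then show ?thesis using x(1) unfolding iw by blast
  qed simp
  obtain M0 where M0: "gform mdeg (mvars r n) (mtype r d) M0" "\<And>i. i < h \<Longrightarrow> M0 (P i) = (if i = 0 then 1 else 0)"
    "\<forall>(i, w)\<in>U. pd w M0 (P i) = 0"
    using sol[of "\<lambda>i. if i = 0 then 1 else 0" "\<lambda>_ _. 0"] by blast
  have Ine: "?I \<noteq> {}"
  proof
    assume I: "?I = {}"
    obtain c where "\<And>z. M0 z = (\<Sum>a\<in>?I. c a * sv_vec r n d (\<lambda>k j. z (k, j)) a)"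
      using mform_coeffs[OF M0(1)] by blast
    then show False using M0(2)[of 0] h unfolding I by simp
  qed
  obtain y0 where y0: "hform ?I 1 y0" "\<And>u. y0 (\<phi> u) = (\<Sum>i<h. sc u i * M0 (pnt u i))"
    using functional[OF M0(1) Ine] by blast
  have "\<exists>y. hform ?I 1 y \<and> y (\<phi> (\<lambda>_. 0)) = 0 \<and>
     (\<forall>l'<K. pd l' (\<lambda>u. y (\<phi> u)) (\<lambda>_. 0) = (if l = l' then 1 else 0))" if l: "l < K" for l
  proof -
    \<comment> \<open>The value \<open>-1\<close> at the first point makes the functional vanish at the base point, where all scales are \<open>1\<close>.\<close>
    define v where "v i = (if l < h - 1 then (if i = 0 then -1 else if i = Suc l then 1 else 0) else (0::complex))" for i
    define \<beta> where "\<beta> i w = (if l = h - 1 + ix (i, w) then 1 else (0::complex))" for i w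
    obtain M where M: "gform mdeg (mvars r n) (mtype r d) M" "\<And>i. i < h \<Longrightarrow> M (P i) = v i"
      "\<And>i w. (i, w) \<in> U \<Longrightarrow> pd w M (P i) = \<beta> i w"
      using sol[of v \<beta>] by blast
    obtain y where y: "hform ?I 1 y" "\<And>u. y (\<phi> u) = (\<Sum>i<h. sc u i * M (pnt u i))"
      using functional[OF M(1) Ine] by blast
    have "y (\<phi> (\<lambda>_. 0)) = (\<Sum>i<h. v i)" unfolding y(2) by (simp add: P0 M(2))
    also have "\<dots> = 0"
    proof (cases "l < h - 1")
      case True
      then have "(\<Sum>i<h. v i) = (\<Sum>i\<in>{0, Suc l}. v i)"
        using h by (intro sum.mono_neutral_right) (auto simp: v_def)
      then show ?thesis using True by (simp add: v_def)
    qed (simp add: v_def)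
    finally have "y (\<phi> (\<lambda>_. 0)) = 0" .
    moreover have "pd l' (\<lambda>u. y (\<phi> u)) (\<lambda>_. 0) = (if l = l' then 1 else 0)" if l': "l' < K" for l'
      using Kcases[OF l']
    proof (elim disjE exE conjE)
      assume l1: "l' < h - 1"
      have "pd l' (\<lambda>u. y (\<phi> u)) (\<lambda>_. 0) = v (Suc l')" unfolding y(2) using l1 by (simp add: pd_scale M(2))
      then show ?thesis using l1 by (auto simp: v_def)
    next
      fix i w assume iw: "(i, w) \<in> U" "l' = h - 1 + ix (i, w)"
      have "pd l' (\<lambda>u. y (\<phi> u)) (\<lambda>_. 0) = \<beta> i w"
        unfolding y(2) iw(2) using pd_dir[OF iw(1) gform_polyfun[OF M(1)]] M(3)[OF iw(1)] by simp
      then show ?thesis using iw(2) by (auto simp: \<beta>_def)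
    qed
    ultimately show ?thesis using y(1) by blast
  qed
  then obtain y where y: "\<And>l. l < K \<Longrightarrow> hform ?I 1 (y l)" "\<And>l. l < K \<Longrightarrow> y l (\<phi> (\<lambda>_. 0)) = 0"
    "\<And>l l'. l < K \<Longrightarrow> l' < K \<Longrightarrow> pd l' (\<lambda>u. y l (\<phi> u)) (\<lambda>_. 0) = (if l = l' then 1 else 0)"
    by metis
  have cv: "\<phi> u \<in> cvecs ?I" for u
    by (simp add: cvecs_def \<phi>_def sv_vec_outside)
  have "enat K \<le> proj_dim ?I (secant ?I h ?X)"
  proof (rule proj_dim_ge[where \<phi> = \<phi> and y = y and z = y0])
    show "(\<lambda>u. \<phi> u a) \<in> polyfun {..<K}" if "a \<in> ?I" for a
      unfolding \<phi>_def by (rule pcomp[OF sv_vec_gform[OF that]])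
    show "\<phi> u \<in> cvecs ?I" for u by (rule cv)
    show "closedin (zariski ?I) (secant ?I h ?X)" by (simp add: secant_def)
    show "pt (\<phi> u) \<in> secant ?I h ?X" if "\<phi> u \<noteq> 0" for u
    proof (rule sum_in_secant[OF infinite_segre_veronese that cv])
      show "\<phi> u = (\<lambda>a. \<Sum>i<h. sc u i * sv_vec r n d (\<lambda>k j. pnt u i (k, j)) a)"
        by (rule ext) (rule \<phi>_def)
      show "pt (sv_vec r n d (\<lambda>k j. pnt u i (k, j))) \<in> ?X" if "sv_vec r n d (\<lambda>k j. pnt u i (k, j)) \<noteq> 0" for i
        using that by (rule sv_vec_in_segre_veronese) (rule rn(2))
    qed (use rn in auto)
    show "hform ?I 1 y0" by (rule y0(1))
    show "y0 (\<phi> (\<lambda>_. 0)) = 1" unfolding y0(2) using h by (simp add: P0 M0(2))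
  qed (use y in auto)
  then show ?thesis by (simp add: K_def)
qed

section \<open>Interpolation at diagonal points\<close>

definition diag :: "(nat \<Rightarrow> complex) \<Rightarrow> nat \<times> nat \<Rightarrow> complex" where
  "diag y = (\<lambda>(k, j). y j)"

lemma diag_apply [simp]: "diag y (k, j) = y j"
  by (simp add: diag_def)

lemma mtype_outside: "k \<notin> {1..r} \<Longrightarrow> mtype r d k = 0"
  unfolding mtype_def by (rule if_not_P)

lemma split_sum_nat:
  fixes g :: "'a \<Rightarrow> nat"
  assumes "finite K" "e \<le> (\<Sum>k\<in>K. g k)"
  shows "\<exists>g'. (\<forall>k. g' k \<le> g k) \<and> (\<Sum>k\<in>K. g' k) = e"
  using assms
proof (induction K arbitrary: e rule: finite_induct)
  case empty
  then show ?case by (intro exI[of _ "\<lambda>_. 0"]) simp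
next
  case (insert a K)
  define m where "m = min e (g a)"
  have "e - m \<le> (\<Sum>k\<in>K. g k)" using insert by (auto simp: m_def)
  then obtain g' where g': "\<forall>k. g' k \<le> g k" "(\<Sum>k\<in>K. g' k) = e - m" using insert.IH by blast
  have "(\<Sum>k\<in>K. (g'(a := m)) k) = (\<Sum>k\<in>K. g' k)" using insert.hyps by (intro sum.cong) auto
  then have "(\<Sum>k\<in>insert a K. (g'(a := m)) k) = e" using insert.hyps g' by (simp add: m_def)
  moreover have "\<forall>k. (g'(a := m)) k \<le> g k" using g'(1) by (simp add: m_def)
  ultimately show ?case by blast
qed

text \<open>
  The variables of each monomial can be assigned to the factors in any way that respects the degrees. The
  lift is not unique; it avoids coordinates beyond \<open>N\<close>.
\<close>

lemma lift_form:
  assumes "form N e F" "(\<Sum>k=1..r. g k) = e" "\<And>k. k \<notin> {1..r} \<Longrightarrow> g k = 0"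
  shows "\<exists>M. gform mdeg ({1..r} \<times> {..N}) g M \<and> (\<forall>y. M (diag y) = F y)"
  using assms
proof (induction arbitrary: g)
  case (const c)
  have "g = 0"
  proof
    fix k show "g k = 0 k" using const by (cases "k \<in> {1..r}") auto
  qed
  then have "gform mdeg ({1..r} \<times> {..N}) g (\<lambda>_. c)" by (simp only: gform.const)
  then show ?case by (intro exI[of _ "\<lambda>_. c"]) blast
next
  case (var j)
  have "\<exists>k\<in>{1..r}. g k \<noteq> 0"
  proof (rule ccontr)
    assume "\<not> (\<exists>k\<in>{1..r}. g k \<noteq> 0)"
    then have "(\<Sum>k=1..r. g k) = 0" by simp
    then show False using var.prems(1) by simp
  qed
  then obtain k where k: "k \<in> {1..r}" "g k \<noteq> 0" by blast
  have "(\<Sum>k=1..r. g k) = g k + (\<Sum>k\<in>{1..r} - {k}. g k)" using k(1) by (simp add: sum.remove)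
  then have "g k = 1" "(\<Sum>k\<in>{1..r} - {k}. g k) = 0" using k(2) var.prems(1) by linarith+
  then have gk: "g k = 1" "\<And>l. l \<in> {1..r} \<Longrightarrow> l \<noteq> k \<Longrightarrow> g l = 0" by auto
  have g: "g = mdeg (k, j)"
  proof
    fix l show "g l = mdeg (k, j) l" using gk var.prems(2)[of l] by (cases "l = k"; cases "l \<in> {1..r}") (auto simp: mdeg_def)
  qed
  have "gform mdeg ({1..r} \<times> {..N}) g (\<lambda>x. x (k, j))"
    unfolding g using k(1) var.hyps by (intro gform.var) simp
  then show ?case by (intro exI[of _ "\<lambda>x. x (k, j)"]) simp
next
  case (add e F G)
  obtain M where M: "gform mdeg ({1..r} \<times> {..N}) g M \<and> (\<forall>y. M (diag y) = F y)"
    using add.IH(1)[OF add.prems] by blast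
  obtain M' where M': "gform mdeg ({1..r} \<times> {..N}) g M' \<and> (\<forall>y. M' (diag y) = G y)"
    using add.IH(2)[OF add.prems] by blast
  from M M' show ?case by (intro exI[of _ "\<lambda>x. M x + M' x"]) (simp add: gform.add)
next
  case (mult e F f G)
  obtain g' where g': "\<forall>k. g' k \<le> g k" "(\<Sum>k=1..r. g' k) = e"
    using split_sum_nat[of "{1..r}" e g] mult.prems(1) by auto
  define g'' where "g'' k = g k - g' k" for k
  have "(\<Sum>k=1..r. g' k) + (\<Sum>k=1..r. g'' k) = (\<Sum>k=1..r. g k)"
    unfolding sum.distrib[symmetric] using g'(1) by (intro sum.cong) (auto simp: g''_def)
  then have f: "(\<Sum>k=1..r. g'' k) = f" using g'(2) mult.prems(1) by simp
  have z'': "g'' k = 0" if "k \<notin> {1..r}" for k using mult.prems(2)[OF that] by (simp add: g''_def)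
  obtain M' where M': "gform mdeg ({1..r} \<times> {..N}) g'' M'" "\<forall>y. M' (diag y) = G y"
    using mult.IH(2)[of g'', OF f z''] by blast
  have z: "g' k = 0" if "k \<notin> {1..r}" for k using g'(1) mult.prems(2)[OF that] by (metis le_zero_eq)
  obtain M where M: "gform mdeg ({1..r} \<times> {..N}) g' M" "\<forall>y. M (diag y) = F y"
    using mult.IH(1)[of g', OF g'(2) z] by blast
  have "g = g' + g''" using g'(1) by (auto simp: g''_def fun_eq_iff)
  then have "gform mdeg ({1..r} \<times> {..N}) g (\<lambda>x. M x * M' x)" using gform.mult[OF M(1) M'(1)] by simp
  then show ?case using M(2) M'(2) by (intro exI[of _ "\<lambda>x. M x * M' x"]) simp
qed

text \<open>
  The chain rule for the diagonal embedding.
\<close>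

lemma pd_diag:
  assumes "M \<in> polyfun ({1..r} \<times> {..N})"
  shows "pd j (\<lambda>y. M (diag y)) y = (\<Sum>k=1..r. pd (k, j) M (diag y))"
proof -
  have pf: "(\<lambda>y. M (diag y)) \<in> polyfun UNIV" if "M \<in> polyfun ({1..r} \<times> {..N})" for M :: "(nat \<times> nat \<Rightarrow> complex) \<Rightarrow> complex"
    by (rule polyfun_comp[OF that]) (auto simp: diag_def intro: polyfun.var)
  show ?thesis
    using assms
  proof induction
    case (const c)
    then show ?case by simp
  next
    case (var v)
    obtain k0 j0 where v: "v = (k0, j0)" "k0 \<in> {1..r}" using var by auto
    have "(\<Sum>k=1..r. pd (k, j) (\<lambda>x. x v) (diag y)) = (\<Sum>k=1..r. if k0 = k then (if j = j0 then 1 else 0) else 0)"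
      by (intro sum.cong) (auto simp: pd_var v(1))
    also have "\<dots> = (if j = j0 then 1 else 0)" using v(2) by (subst sum.delta') auto
    finally show ?case by (simp add: v(1) pd_var)
  next
    case (add F G)
    then show ?case by (simp add: pd_add[OF add.hyps] pd_add[OF pf[OF add.hyps(1)] pf[OF add.hyps(2)]] sum.distrib)
  next
    case (mult F G)
    then show ?case
      by (simp add: pd_mult[OF mult.hyps] pd_mult[OF pf[OF mult.hyps(1)] pf[OF mult.hyps(2)]]
          sum.distrib sum_distrib_left sum_distrib_right)
  qed
qed

definition block_linear :: "nat \<Rightarrow> (nat \<Rightarrow> complex) \<Rightarrow> nat \<Rightarrow> (nat \<times> nat \<Rightarrow> complex) \<Rightarrow> complex" where
  "block_linear N c k x = (\<Sum>j\<le>N. c j * x (k, j))"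

lemma block_linear_gform:
  assumes "k \<in> {1..r}"
  shows "gform mdeg ({1..r} \<times> {..N}) (mdeg (k, 0)) (block_linear N c k)"
proof -
  have v: "gform mdeg ({1..r} \<times> {..N}) (mdeg (k, 0)) (\<lambda>x. x (k, j))" if "j \<le> N" for j
    using gform.var[of "(k, j)" "{1..r} \<times> {..N}" mdeg] assms that by (simp add: mdeg_def)
  show ?thesis unfolding block_linear_def[abs_def]
    by (rule gform_sum[OF v[of 0]], simp, rule gform_cmult, rule v, simp)
qed

lemma block_linear_diag: "block_linear N c k (diag y) = (\<Sum>j\<le>N. c j * y j)"
  by (simp add: block_linear_def)

lemma pd_block_linear: "pd (k', j) (block_linear N c k) x = (if k' = k \<and> j \<le> N then c j else 0)"
proof -
  have "pd (k', j) (block_linear N c k) x = (\<Sum>i\<le>N. pd (k', j) (\<lambda>x. c i * x (k, i)) x)"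
    unfolding block_linear_def[abs_def]
    by (rule pd_sum[of _ _ UNIV], rule polyfun.mult, rule polyfun.const, rule polyfun.var) simp
  also have "\<dots> = (\<Sum>i\<le>N. if j = i then (if k' = k then c i else 0) else 0)"
    by (rule sum.cong[OF refl], subst pd_cmult[of _ UNIV], rule polyfun.var) (auto simp: pd_var)
  finally show ?thesis by (subst (asm) sum.delta') auto
qed

lemma sum_mdeg_less:
  assumes "\<And>k. k \<in> {1..r} \<Longrightarrow> 0 < d k" "a \<in> {1..r}"
  shows "(\<Sum>k=1..r. mtype r d k - mdeg (a, j) k) = (\<Sum>k=1..r. d k) - 1"
proof -
  have "(\<Sum>k=1..r. mtype r d k - mdeg (a, j) k) + 1 = (\<Sum>k=1..r. (mtype r d k - mdeg (a, j) k) + (if k = a then 1 else 0))"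
    using assms(2) by (simp add: sum.distrib)
  also have "\<dots> = (\<Sum>k=1..r. d k)" using assms(1) by (intro sum.cong) (auto simp: mtype_def mdeg_def Suc_leI)
  finally show ?thesis by simp
qed

text \<open>
  Lift \<open>F\<close> to a multiform \<open>M0\<close>. The defects \<open>\<gamma> i k\<close> of its derivatives in the factors \<open>k\<close> sum to zero over \<open>k\<close>,
  because the derivatives of \<open>F\<close> are right, and each is orthogonal to \<open>p i\<close>, by Euler's relation
  in the factor \<open>k\<close>. For linear forms \<open>l, g\<close> with \<open>l(p\<^sub>i) = 1\<close> and \<open>g(p\<^sub>i) = 0\<close> the minor
  \<open>l(x\<^sub>1) g(x\<^sub>k) - g(x\<^sub>1) l(x\<^sub>k)\<close> vanishes on the diagonal, and at \<open>p\<^sub>i\<close> it has the derivatives \<open>g\<close> in the factor \<open>k\<close> and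
  \<open>-g\<close> in the factor \<open>1\<close>. Multiplied by a form that is \<open>1\<close> at \<open>p\<^sub>i\<close> and \<open>0\<close> at the other points, it
  moves a defect from the factor \<open>k\<close> to the factor \<open>1\<close>, where the sum of all defects is zero.
\<close>

lemma diagonal_interpolation:
  fixes p :: "nat \<Rightarrow> nat \<Rightarrow> complex"
  assumes I: "finite I" and d: "\<And>k. k \<in> {1..r} \<Longrightarrow> 0 < d k" "1 \<le> r"
    and n: "\<And>k. k \<in> {1..r} \<Longrightarrow> N \<le> n k"
    and D: "(\<Sum>k=1..r. d k) = e + 3"
    and val: "jets N (e + 1) (I \<times> {Suc N}) p"
    and supp: "\<And>i j. j > N \<Longrightarrow> p i j = 0"
    and F: "form N (e + 3) F" "\<And>i j. i \<in> I \<Longrightarrow> j \<le> N \<Longrightarrow> pd j F (p i) = (\<Sum>k=1..r. \<beta> i k j)"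
    and \<beta>: "\<And>i k. i \<in> I \<Longrightarrow> k \<in> {1..r} \<Longrightarrow> (\<Sum>j\<le>N. p i j * \<beta> i k j) = of_nat (d k) * F (p i)"
  shows "\<exists>M. gform mdeg (mvars r n) (mtype r d) M \<and>
    (\<forall>y. (\<forall>j>N. y j = 0) \<longrightarrow> M (diag y) = F y) \<and>
    (\<forall>i\<in>I. \<forall>w\<in>mvars r n. pd w M (diag (p i)) = \<beta> i (fst w) (snd w))"
proof -
  let ?V = "{1..r} \<times> {..N}"
  have V: "?V \<subseteq> mvars r n" using n by (fastforce simp: mvars_def)
  have dsum: "(\<Sum>k=1..r. mtype r d k) = e + 3"
    unfolding D[symmetric] by (intro sum.cong) (auto simp: mtype_def)
  obtain M0 where M0: "gform mdeg ?V (mtype r d) M0" "\<And>y. M0 (diag y) = F y"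
  proof -
    from lift_form[OF F(1) dsum mtype_outside] show ?thesis using that by blast
  qed
  have M0p: "M0 \<in> polyfun ?V" by (rule gform_polyfun[OF M0(1)])
  define \<gamma> where "\<gamma> i k j = \<beta> i k j - pd (k, j) M0 (diag (p i))" for i k j
  have \<gamma>0: "(\<Sum>k=1..r. \<gamma> i k j) = 0" if "i \<in> I" "j \<le> N" for i j
    using F(2)[OF that] pd_diag[OF M0p, of j "p i"] by (simp add: \<gamma>_def sum_subtractf M0(2))
  have \<gamma>p: "(\<Sum>j\<le>N. \<gamma> i k j * p i j) = 0" if "i \<in> I" "k \<in> {1..r}" for i k
  proof -
    have "(\<Sum>v\<in>?V. of_nat (mdeg v k) * diag (p i) v * pd v M0 (diag (p i))) = of_nat (mtype r d k) * M0 (diag (p i))"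
      by (rule gform_euler[OF M0(1), of "\<lambda>g. g k"]) auto
    also have "(\<Sum>v\<in>?V. of_nat (mdeg v k) * diag (p i) v * pd v M0 (diag (p i)))
      = (\<Sum>k'=1..r. if k' = k then \<Sum>j\<le>N. p i j * pd (k, j) M0 (diag (p i)) else 0)"
      unfolding sum.cartesian_product' by (intro sum.cong) (auto simp: mdeg_def)
    also have "\<dots> = (\<Sum>j\<le>N. p i j * pd (k, j) M0 (diag (p i)))" using that(2) by simp
    finally have "(\<Sum>j\<le>N. p i j * pd (k, j) M0 (diag (p i))) = of_nat (d k) * F (p i)"
      using that(2) by (simp add: mtype_def M0(2))
    then show ?thesis using \<beta>[OF that] by (simp add: \<gamma>_def algebra_simps sum_subtractf)
  qed
  have "\<exists>G. form N (e + 1) G \<and> (\<forall>i'\<in>I. G (p i') = (if i' = i then 1 else 0))" for i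
  proof -
    obtain G where "form N (e + 1) G" "\<forall>m\<in>I \<times> {Suc N}. jet N p m G = (if fst m = i then 1 else 0)"
      using spec[OF val[unfolded jets_def], of "\<lambda>m. if fst m = i then 1 else 0"] by blast
    then show ?thesis by (intro exI[of _ G]) (auto simp: jet_def)
  qed
  then obtain \<Phi> where \<Phi>: "\<And>i. form N (e + 1) (\<Phi> i)" "\<And>i i'. i' \<in> I \<Longrightarrow> \<Phi> i (p i') = (if i' = i then 1 else 0)"
    by metis
  have "\<exists>c. (\<Sum>j\<le>N. c j * p i j) = 1" if i: "i \<in> I" for i
  proof -
    have "\<not> (\<forall>j\<le>N. p i j = 0)"
    proof
      assume "\<forall>j\<le>N. p i j = 0"
      then have "(\<Sum>j\<le>N. p i j * pd j (\<Phi> i) (p i)) = 0" by simp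
      then show False using form_euler[OF \<Phi>(1), of "p i" i] \<Phi>(2)[OF i, of i]
        by (simp del: of_nat_add of_nat_Suc add: of_nat_eq_0_iff flip: of_nat_Suc)
    qed
    then obtain j0 where j0: "j0 \<le> N" "p i j0 \<noteq> 0" by blast
    have "(\<Sum>j\<le>N. (if j = j0 then 1 / p i j0 else 0) * p i j) = (\<Sum>j\<le>N. if j = j0 then 1 else 0)"
      using j0 by (intro sum.cong) auto
    then show ?thesis using j0 by (intro exI[of _ "\<lambda>j. if j = j0 then 1 / p i j0 else 0"]) simp
  qed
  then obtain lam where lam: "\<And>i. i \<in> I \<Longrightarrow> (\<Sum>j\<le>N. lam i j * p i j) = 1" by metis
  \<comment> \<open>The products with minors that move the defects at \<open>p i\<close> to the first factor.\<close>
  have "\<exists>\<Gamma>. gform mdeg ?V (\<lambda>l. mtype r d l - mdeg (1, 0) l - mdeg (k, 0) l) \<Gamma> \<and> (\<forall>y. \<Gamma> (diag y) = \<Phi> i y)"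
    if k: "k \<in> {2..r}" for i k
  proof (rule lift_form[OF \<Phi>(1)])
    have "(\<Sum>l=1..r. mtype r d l - mdeg (1, 0) l - mdeg (k, 0) l) + 2
       = (\<Sum>l=1..r. (mtype r d l - mdeg (1, 0) l - mdeg (k, 0) l) + ((if l = 1 then 1 else 0) + (if l = k then 1 else 0)))"
      using k by (simp add: sum.distrib)
    also have "\<dots> = (\<Sum>l=1..r. d l)"
      using k d(1) by (intro sum.cong) (auto simp: mtype_def mdeg_def Suc_leI)
    finally show "(\<Sum>l=1..r. mtype r d l - mdeg (1, 0) l - mdeg (k, 0) l) = e + 1" using D by simp
  qed (subst mtype_outside, assumption, simp)
  then have "\<forall>i. \<forall>k\<in>{2..r}. \<exists>\<Gamma>. gform mdeg ?V (\<lambda>l. mtype r d l - mdeg (1, 0) l - mdeg (k, 0) l) \<Gamma> \<and> (\<forall>y. \<Gamma> (diag y) = \<Phi> i y)"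
    by blast
  then obtain \<Gamma> where \<Gamma>: "\<And>i k. k \<in> {2..r} \<Longrightarrow> gform mdeg ?V (\<lambda>l. mtype r d l - mdeg (1, 0) l - mdeg (k, 0) l) (\<Gamma> i k)"
    "\<And>i k y. k \<in> {2..r} \<Longrightarrow> \<Gamma> i k (diag y) = \<Phi> i y" by metis
  define S where "S i k x = \<Gamma> i k x * (block_linear N (lam i) 1 x * block_linear N (\<gamma> i k) k x
      - block_linear N (\<gamma> i k) 1 x * block_linear N (lam i) k x)" for i k x
  have S: "gform mdeg ?V (mtype r d) (S i k)" if k: "k \<in> {2..r}" for i k
  proof -
    have k1: "1 \<in> {1..r}" "k \<in> {1..r}" using k d(2) by auto
    have "gform mdeg ?V ((\<lambda>l. mtype r d l - mdeg (1, 0) l - mdeg (k, 0) l) + (mdeg (1, 0) + mdeg (k, 0))) (S i k)"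
      unfolding S_def[abs_def]
      by (intro gform.mult gform_minus \<Gamma> k block_linear_gform k1)
    moreover have "(\<lambda>l. mtype r d l - mdeg (1, 0) l - mdeg (k, 0) l) + (mdeg (1, 0) + mdeg (k, 0)) = mtype r d"
      using k k1 d(1) by (auto simp: fun_eq_iff mtype_def mdeg_def Suc_leI)
    ultimately show ?thesis by simp
  qed
  have Sdiag: "S i k (diag y) = 0" for i k y
    by (simp add: S_def block_linear_diag)
  have pdS: "pd w (S i k) (diag (p i')) = (if i' = i then
      (if fst w = k \<and> snd w \<le> N then \<gamma> i k (snd w) else 0) - (if fst w = 1 \<and> snd w \<le> N then \<gamma> i k (snd w) else 0) else 0)"
    if "i \<in> I" "i' \<in> I" and k: "k \<in> {2..r}" for i i' k w
  proof -
    have k1: "1 \<in> {1..r}" "k \<in> {1..r}" using k d(2) by auto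
    obtain a b where w: "w = (a, b)" by (cases w)
    have pl: "block_linear N c k' \<in> polyfun ?V" if "k' \<in> {1..r}" for k' c
      by (rule gform_polyfun[OF block_linear_gform[OF that]])
    let ?A = "block_linear N (lam i) 1" and ?B = "block_linear N (\<gamma> i k) k"
    let ?C = "block_linear N (\<gamma> i k) 1" and ?E = "block_linear N (lam i) k"
    have AB: "(\<lambda>x. ?A x * ?B x) \<in> polyfun ?V" "(\<lambda>x. ?C x * ?E x) \<in> polyfun ?V"
      by (intro polyfun.mult pl k1)+
    have CE: "(\<lambda>x. (-1) * (?C x * ?E x)) \<in> polyfun ?V" by (intro polyfun.mult[OF polyfun.const AB(2)])
    have SS: "S i k = (\<lambda>x. \<Gamma> i k x * (?A x * ?B x + (-1) * (?C x * ?E x)))"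
      by (simp add: S_def fun_eq_iff)
    have "pd w (S i k) (diag (p i')) = pd w (\<Gamma> i k) (diag (p i')) * (?A (diag (p i')) * ?B (diag (p i')) + (-1) * (?C (diag (p i')) * ?E (diag (p i'))))
      + \<Gamma> i k (diag (p i')) * (pd w (\<lambda>x. ?A x * ?B x) (diag (p i')) + (-1) * pd w (\<lambda>x. ?C x * ?E x) (diag (p i')))"
      unfolding SS
      by (subst pd_mult[OF gform_polyfun[OF \<Gamma>(1)[OF k]] polyfun.add[OF AB(1) CE]])
         (simp only: pd_add[OF AB(1) CE] pd_cmult[OF AB(2)])
    also have "\<dots> = (if i' = i then pd w (\<lambda>x. ?A x * ?B x) (diag (p i)) - pd w (\<lambda>x. ?C x * ?E x) (diag (p i)) else 0)"
      using \<Phi>(2)[OF that(2), of i] by (simp add: block_linear_diag \<Gamma>(2)[OF k])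
    also have "pd w (\<lambda>x. ?A x * ?B x) (diag (p i)) = (if fst w = k \<and> snd w \<le> N then \<gamma> i k (snd w) else 0)"
      using pd_mult[OF pl[OF k1(1), of "lam i"] pl[OF k1(2), of "\<gamma> i k"], of w "diag (p i)"] lam[OF that(1)] \<gamma>p[OF that(1) k1(2)]
      by (simp add: block_linear_diag pd_block_linear w)
    also have "pd w (\<lambda>x. ?C x * ?E x) (diag (p i)) = (if fst w = 1 \<and> snd w \<le> N then \<gamma> i k (snd w) else 0)"
      using pd_mult[OF pl[OF k1(1), of "\<gamma> i k"] pl[OF k1(2), of "lam i"], of w "diag (p i)"] lam[OF that(1)] \<gamma>p[OF that(1) k1(2)]
      by (simp add: block_linear_diag pd_block_linear w)
    finally show ?thesis .
  qed
  \<comment> \<open>The coordinates beyond \<open>N\<close> vanish at all points, so a derivative in such a direction is prescribed by a multiple of the coordinate itself.\<close>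
  have lin: "form N 1 (\<lambda>y. \<Sum>j\<le>N. lam i j * y j)" for i by (rule form_linear)
  define W where "W = {w \<in> mvars r n. N < snd w}"
  have finW: "finite W" using finite_mvars[of r n] by (simp add: W_def)
  have "\<exists>\<Theta>. gform mdeg ?V (\<lambda>l. mtype r d l - mdeg w l) \<Theta> \<and> (\<forall>y. \<Theta> (diag y) = \<Phi> i y * (\<Sum>j\<le>N. lam i j * y j))"
    if w: "w \<in> W" for i w
  proof (rule lift_form[OF gform.mult[OF \<Phi>(1) lin]])
    obtain a b where ab: "w = (a, b)" by (cases w)
    then have "a \<in> {1..r}" using w by (simp add: W_def mvars_def)
    then show "(\<Sum>l=1..r. mtype r d l - mdeg w l) = e + 1 + 1"
      unfolding ab using sum_mdeg_less[OF d(1)] D by simp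
  qed (subst mtype_outside, assumption, simp)
  then have "\<forall>i. \<forall>w\<in>W. \<exists>\<Theta>. gform mdeg ?V (\<lambda>l. mtype r d l - mdeg w l) \<Theta> \<and> (\<forall>y. \<Theta> (diag y) = \<Phi> i y * (\<Sum>j\<le>N. lam i j * y j))"
    by blast
  then obtain \<Theta> where \<Theta>: "\<And>i w. w \<in> W \<Longrightarrow> gform mdeg ?V (\<lambda>l. mtype r d l - mdeg w l) (\<Theta> i w)"
    "\<And>i w y. w \<in> W \<Longrightarrow> \<Theta> i w (diag y) = \<Phi> i y * (\<Sum>j\<le>N. lam i j * y j)" by metis
  define T where "T i w x = \<beta> i (fst w) (snd w) * (x w * \<Theta> i w x)" for i w x
  have xw: "gform mdeg (mvars r n) (mdeg w) (\<lambda>x. x w)" if "w \<in> W" for w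
    using that by (intro gform.var) (simp add: W_def)
  have xT: "gform mdeg (mvars r n) (mdeg w + (\<lambda>l. mtype r d l - mdeg w l)) (\<lambda>x. x w * \<Theta> i w x)" if "w \<in> W" for i w
    by (rule gform.mult[OF xw[OF that] gform_mono[OF \<Theta>(1)[OF that] V]])
  have T: "gform mdeg (mvars r n) (mtype r d) (T i w)" if w: "w \<in> W" for i w
  proof -
    have "mdeg w + (\<lambda>l. mtype r d l - mdeg w l) = mtype r d"
      using w d(1) by (auto simp: fun_eq_iff mtype_def mdeg_def W_def mvars_def Suc_leI)
    then show ?thesis using gform_cmult[OF xT[OF w]] unfolding T_def[abs_def] by simp
  qed
  have Tdiag: "T i w (diag y) = 0" if "w \<in> W" "\<forall>j>N. y j = 0" for i w y
    using that by (cases w) (simp add: T_def W_def)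
  have pdT: "pd v (T i w) (diag (p i')) = (if i' = i \<and> v = w then \<beta> i (fst w) (snd w) else 0)"
    if "i \<in> I" "i' \<in> I" and w: "w \<in> W" for i i' v w
  proof -
    have 0: "diag (p i') w = 0" using w supp by (cases w) (simp add: W_def)
    have "pd v (T i w) (diag (p i')) = \<beta> i (fst w) (snd w) * (pd v (\<lambda>x. x w) (diag (p i')) * \<Theta> i w (diag (p i'))
        + diag (p i') w * pd v (\<Theta> i w) (diag (p i')))"
      unfolding T_def[abs_def]
      by (subst pd_cmult[OF gform_polyfun[OF xT[OF w]]])
         (simp only: pd_mult[OF gform_polyfun[OF xw[OF w]] gform_polyfun[OF \<Theta>(1)[OF w]]])
    also have "\<dots> = (if i' = i \<and> v = w then \<beta> i (fst w) (snd w) else 0)"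
      using \<Phi>(2)[OF that(2), of i] lam[OF that(1)] by (simp add: 0 pd_var \<Theta>(2)[OF w])
    finally show ?thesis .
  qed
  define M where "M x = M0 x + ((\<Sum>i\<in>I. \<Sum>k=2..r. S i k x) + (\<Sum>i\<in>I. \<Sum>w\<in>W. T i w x))" for x
  have M0': "gform mdeg (mvars r n) (mtype r d) M0" by (rule gform_mono[OF M0(1) V])
  have S': "gform mdeg (mvars r n) (mtype r d) (S i k)" if "k \<in> {2..r}" for i k by (rule gform_mono[OF S[OF that] V])
  have SS: "gform mdeg (mvars r n) (mtype r d) (\<lambda>x. \<Sum>k=2..r. S i k x)" for i
    by (rule gform_sum[OF M0']) (rule S')
  have TT: "gform mdeg (mvars r n) (mtype r d) (\<lambda>x. \<Sum>w\<in>W. T i w x)" for i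
    by (rule gform_sum[OF M0']) (rule T)
  have SSS: "gform mdeg (mvars r n) (mtype r d) (\<lambda>x. \<Sum>i\<in>I. \<Sum>k=2..r. S i k x)"
    by (rule gform_sum[OF M0']) (rule SS)
  have TTT: "gform mdeg (mvars r n) (mtype r d) (\<lambda>x. \<Sum>i\<in>I. \<Sum>w\<in>W. T i w x)"
    by (rule gform_sum[OF M0']) (rule TT)
  have "gform mdeg (mvars r n) (mtype r d) M"
    unfolding M_def[abs_def] by (intro gform.add M0' SSS TTT)
  moreover have "M (diag y) = F y" if "\<forall>j>N. y j = 0" for y
    by (simp add: M_def M0(2) Sdiag Tdiag that)
  moreover have "pd v M (diag (p i)) = \<beta> i (fst v) (snd v)" if i: "i \<in> I" and v: "v \<in> mvars r n" for i v
  proof -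
    obtain k0 j0 where kj: "v = (k0, j0)" "k0 \<in> {1..r}" using v by (auto simp: mvars_def)
    have "pd v M (diag (p i)) = pd v M0 (diag (p i))
      + (pd v (\<lambda>x. \<Sum>i\<in>I. \<Sum>k=2..r. S i k x) (diag (p i)) + pd v (\<lambda>x. \<Sum>i\<in>I. \<Sum>w\<in>W. T i w x) (diag (p i)))"
      unfolding M_def[abs_def]
      by (subst pd_add[OF gform_polyfun[OF M0'] gform_polyfun[OF gform.add[OF SSS TTT]]])
         (simp only: pd_add[OF gform_polyfun[OF SSS] gform_polyfun[OF TTT]])
    also have "pd v (\<lambda>x. \<Sum>i\<in>I. \<Sum>k=2..r. S i k x) (diag (p i)) = (\<Sum>i'\<in>I. \<Sum>k=2..r. pd v (S i' k) (diag (p i)))"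
      by (subst pd_sum[OF gform_polyfun[OF SS]])
         (intro sum.cong refl pd_sum, rule gform_polyfun, rule S')
    also have "\<dots> = (\<Sum>i'\<in>I. if i' = i then (\<Sum>k=2..r. (if k0 = k \<and> j0 \<le> N then \<gamma> i k j0 else 0)
        - (if k0 = 1 \<and> j0 \<le> N then \<gamma> i k j0 else 0)) else 0)"
      by (intro sum.cong refl) (auto simp: pdS[OF _ i] kj(1) intro!: sum.cong)
    also have "\<dots> = (\<Sum>k=2..r. (if k0 = k \<and> j0 \<le> N then \<gamma> i k j0 else 0) - (if k0 = 1 \<and> j0 \<le> N then \<gamma> i k j0 else 0))"
      using I i by simp
    also have "pd v (\<lambda>x. \<Sum>i\<in>I. \<Sum>w\<in>W. T i w x) (diag (p i)) = (\<Sum>i'\<in>I. \<Sum>w\<in>W. pd v (T i' w) (diag (p i)))"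
      by (subst pd_sum[OF gform_polyfun[OF TT]])
         (intro sum.cong refl pd_sum, rule gform_polyfun, erule T)
    also have "\<dots> = (\<Sum>i'\<in>I. if i' = i then (\<Sum>w\<in>W. if v = w then \<beta> i (fst w) (snd w) else 0) else 0)"
      by (intro sum.cong refl) (auto simp: pdT[OF _ i] intro!: sum.cong)
    also have "\<dots> = (if v \<in> W then \<beta> i k0 j0 else 0)" using I i finW by (simp add: kj(1))
    finally have pd: "pd v M (diag (p i)) = pd v M0 (diag (p i))
      + ((\<Sum>k=2..r. (if k0 = k \<and> j0 \<le> N then \<gamma> i k j0 else 0) - (if k0 = 1 \<and> j0 \<le> N then \<gamma> i k j0 else 0))
        + (if v \<in> W then \<beta> i k0 j0 else 0))" .
    show ?thesis
    proof (cases "j0 \<le> N")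
      case False
      then have "v \<in> W" using v by (simp add: W_def kj(1))
      moreover have "pd v M0 (diag (p i)) = 0" using False by (intro pd_outside[OF M0p]) (simp add: kj(1))
      ultimately show ?thesis unfolding pd using False by (simp add: kj(1))
    next
      case True
      then have vW: "v \<notin> W" by (simp add: W_def kj(1))
      have "(\<Sum>k=2..r. (if k0 = k \<and> j0 \<le> N then \<gamma> i k j0 else 0) - (if k0 = 1 \<and> j0 \<le> N then \<gamma> i k j0 else 0)) = \<gamma> i k0 j0"
      proof (cases "k0 = 1")
        case k1: True
        have "(\<Sum>k=1..r. \<gamma> i k j0) = \<gamma> i 1 j0 + (\<Sum>k=2..r. \<gamma> i k j0)"
          using d(2) by (simp add: sum.atLeast_Suc_atMost numeral_2_eq_2)
        then have "\<gamma> i 1 j0 = - (\<Sum>k=2..r. \<gamma> i k j0)" using \<gamma>0[OF i True] by (simp add: eq_neg_iff_add_eq_0)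
        moreover have "(\<Sum>k=2..r. (if k0 = k \<and> j0 \<le> N then \<gamma> i k j0 else 0) - (if k0 = 1 \<and> j0 \<le> N then \<gamma> i k j0 else 0))
          = (\<Sum>k=2..r. - \<gamma> i k j0)" using True k1 by (intro sum.cong) auto
        ultimately show ?thesis using k1 by (simp add: sum_negf)
      next
        case False
        then have "k0 \<in> {2..r}" using kj(2) by auto
        then show ?thesis using False True by (simp add: sum.delta' cong: conj_cong)
      qed
      then show ?thesis unfolding pd using vW by (simp add: \<gamma>_def kj(1))
    qed
  qed
  ultimately show ?thesis by blast
qed

section \<open>Secant varieties of Segre-Veronese varieties\<close>

lemma jets_truncate:
  assumes "jets n e M p"
  shows "jets n e M (\<lambda>i j. if j \<le> n then p i j else 0)"
proof -
  let ?q = "\<lambda>i j. if j \<le> n then p i j else 0"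
  have "jet n ?q m F = jet n p m F" if "form n e F" for F m
  proof -
    have pf: "F \<in> polyfun {..n}" by (rule gform_polyfun[OF that])
    have "F (?q (fst m)) = F (p (fst m))" by (rule polyfun_local[OF pf]) simp
    moreover have "pd (snd m) F (?q (fst m)) = pd (snd m) F (p (fst m))"
      by (rule polyfun_local[OF polyfun_pd[OF pf]]) simp
    ultimately show ?thesis by (simp add: jet_def)
  qed
  then show ?thesis using assms unfolding jets_def by metis
qed

text \<open>
  Both requirements are open on lines and each of them can be met, so they can be met together. Forms only
  read the coordinates up to \<open>n\<close>, so the others can be set to zero.
\<close>

lemma general_points:
  assumes "gradients_indep n d h" "h \<le> (n + e) choose n"
  shows "\<exists>p. jets n d ({..<h} \<times> {..n}) p \<and> jets n e ({..<h} \<times> {Suc n}) p \<and> (\<forall>i j. j > n \<longrightarrow> p i j = 0)"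
proof -
  obtain p where p: "jets n d ({..<h} \<times> {..n}) p" using assms(1) unfolding gradients_indep_def by blast
  have "jets n e {} p" using form_nonempty by (simp add: jets_def)
  then obtain q where "jets n e ({} \<union> {..<h} \<times> {Suc n}) q"
    using jets_insert_values[of "{..<h}" n e "{}" p] assms(2) by auto
  then have q: "jets n e ({..<h} \<times> {Suc n}) q" by simp
  obtain s where s: "jets n d ({..<h} \<times> {..n}) s" "jets n e ({..<h} \<times> {Suc n}) s"
    using lineopen_meet[OF jets_lineopen jets_lineopen p q] by auto
  show ?thesis
    by (rule exI[of _ "\<lambda>i j. if j \<le> n then s i j else 0"]) (simp add: jets_truncate[OF s(1)] jets_truncate[OF s(2)])
qed

lemma jets_value_nonzero:
  assumes "jets n (Suc e) (I \<times> {Suc n}) p" "i \<in> I"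
  shows "\<exists>j\<le>n. p i j \<noteq> 0"
proof (rule ccontr)
  assume "\<not> (\<exists>j\<le>n. p i j \<noteq> 0)"
  then have p0: "\<forall>j\<le>n. p i j = 0" by blast
  obtain F where F: "form n (Suc e) F" "\<forall>m\<in>I \<times> {Suc n}. jet n p m F = 1"
    using spec[OF assms(1)[unfolded jets_def], of "\<lambda>_. 1"] by blast
  have "F (p i) = 1" using bspec[OF F(2), of "(i, Suc n)"] assms(2) by (simp add: jet_def)
  moreover have "(\<Sum>j\<le>n. p i j * pd j F (p i)) = 0" using p0 by simp
  then have "of_nat (Suc e) * F (p i) = 0" using form_euler[OF F(1), of "p i"] by simp
  then have "F (p i) = 0" by (simp del: of_nat_Suc)
  ultimately show False by simp
qed

lemma sum_block_degrees:
  fixes F :: "(nat \<Rightarrow> complex) \<Rightarrow> complex"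
  assumes F: "form N D F" "D > 0" "(\<Sum>k=1..r. d k) = D"
    and pd: "\<And>j. j \<le> N \<Longrightarrow> pd j F y = (\<Sum>k=1..r. \<beta> k j)"
    and \<beta>: "\<And>k. k \<in> {1..r} \<Longrightarrow> (\<Sum>j\<le>N. y j * \<beta> k j) = of_nat (d k) * v"
  shows "F y = v"
proof -
  have "of_nat D * F y = (\<Sum>j\<le>N. y j * pd j F y)" using form_euler[OF F(1)] by simp
  also have "\<dots> = (\<Sum>j\<le>N. \<Sum>k=1..r. y j * \<beta> k j)"
    unfolding sum_distrib_left[symmetric] by (intro sum.cong) (simp_all add: pd)
  also have "\<dots> = (\<Sum>k=1..r. \<Sum>j\<le>N. y j * \<beta> k j)" by (rule sum.swap)
  also have "\<dots> = (\<Sum>k=1..r. of_nat (d k) * v)" by (intro sum.cong) (simp_all add: \<beta>)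
  also have "\<dots> = of_nat D * v" using F(3) by (simp flip: sum_distrib_right of_nat_sum)
  finally show ?thesis using F(2) by simp
qed

text \<open>
  Euler's relation can be satisfied by adjusting the derivative in one direction \<open>j0\<close> with \<open>y j0 \<noteq> 0\<close>.
\<close>

lemma sum_punctured:
  fixes y :: "nat \<Rightarrow> complex"
  assumes "j0 \<le> N" "y j0 \<noteq> 0"
  shows "(\<Sum>j\<le>N. y j * (if j = j0 then (s - (\<Sum>j\<in>{..N} - {j0}. y j * b j)) / y j0 else b j)) = s"
proof -
  have "(\<Sum>j\<le>N. y j * (if j = j0 then (s - (\<Sum>j\<in>{..N} - {j0}. y j * b j)) / y j0 else b j))
    = (s - (\<Sum>j\<in>{..N} - {j0}. y j * b j)) + (\<Sum>j\<in>{..N} - {j0}. y j * (if j = j0 then (s - (\<Sum>j\<in>{..N} - {j0}. y j * b j)) / y j0 else b j))"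
    using assms by (subst sum.remove[of _ j0]) simp_all
  also have "(\<Sum>j\<in>{..N} - {j0}. y j * (if j = j0 then (s - (\<Sum>j\<in>{..N} - {j0}. y j * b j)) / y j0 else b j))
    = (\<Sum>j\<in>{..N} - {j0}. y j * b j)" by (intro sum.cong) auto
  finally show ?thesis by simp
qed

text \<open>
  In each factor the derivative in the direction \<open>j0 i\<close> is determined by Euler's relation from the value and the
  other derivatives; \<open>\<beta>\<close> completes the prescribed data accordingly. The sum over the factors is the
  gradient that the form on the diagonal has to have.
\<close>

lemma diagonal_tangents:
  fixes p :: "nat \<Rightarrow> nat \<Rightarrow> complex"
  assumes d: "\<And>k. k \<in> {1..r} \<Longrightarrow> 0 < d k" "1 \<le> r"
    and n: "\<And>k. k \<in> {1..r} \<Longrightarrow> N \<le> n k"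
    and D: "(\<Sum>k=1..r. d k) = e + 3"
    and p: "jets N (e + 3) ({..<h} \<times> {..N}) p" "jets N (e + 1) ({..<h} \<times> {Suc N}) p" "\<And>i j. j > N \<Longrightarrow> p i j = 0"
    and j0: "\<And>i. i < h \<Longrightarrow> j0 i \<le> N" "\<And>i. i < h \<Longrightarrow> p i (j0 i) \<noteq> 0"
  shows "\<exists>M. gform mdeg (mvars r n) (mtype r d) M \<and> (\<forall>i<h. M (diag (p i)) = v i) \<and>
    (\<forall>i<h. \<forall>w\<in>mvars r n. snd w \<noteq> j0 i \<longrightarrow> pd w M (diag (p i)) = b i w)"
proof -
  define \<beta> where "\<beta> i k j = (if j = j0 i then (of_nat (d k) * v i - (\<Sum>j\<in>{..N} - {j0 i}. p i j * b i (k, j))) / p i (j0 i)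
     else b i (k, j))" for i k j
  have \<beta>: "(\<Sum>j\<le>N. p i j * \<beta> i k j) = of_nat (d k) * v i" if "i < h" for i k
    unfolding \<beta>_def using sum_punctured[OF j0(1)[OF that], of "p i" "of_nat (d k) * v i" "\<lambda>j. b i (k, j)"] j0(2)[OF that] by simp
  obtain F where F: "form N (e + 3) F" "\<forall>m\<in>{..<h} \<times> {..N}. jet N p m F = (\<Sum>k=1..r. \<beta> (fst m) k (snd m))"
    using spec[OF p(1)[unfolded jets_def], of "\<lambda>m. \<Sum>k=1..r. \<beta> (fst m) k (snd m)"] by blast
  have pdF: "pd j F (p i) = (\<Sum>k=1..r. \<beta> i k j)" if "i < h" "j \<le> N" for i j
    using bspec[OF F(2), of "(i, j)"] that by (simp add: jet_def)
  have Fv: "F (p i) = v i" if "i < h" for i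
    by (rule sum_block_degrees[OF F(1) _ D pdF[OF that] \<beta>[OF that]]) simp_all
  have "\<exists>M. gform mdeg (mvars r n) (mtype r d) M \<and>
    (\<forall>y. (\<forall>j>N. y j = 0) \<longrightarrow> M (diag y) = F y) \<and>
    (\<forall>i\<in>{..<h}. \<forall>w\<in>mvars r n. pd w M (diag (p i)) = \<beta> i (fst w) (snd w))"
    by (rule diagonal_interpolation[OF _ d n D p(2,3) F(1)]) (simp_all add: pdF \<beta> Fv)
  then obtain M where M: "gform mdeg (mvars r n) (mtype r d) M" "\<And>y. \<forall>j>N. y j = 0 \<Longrightarrow> M (diag y) = F y"
    "\<And>i w. i < h \<Longrightarrow> w \<in> mvars r n \<Longrightarrow> pd w M (diag (p i)) = \<beta> i (fst w) (snd w)" by auto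
  show ?thesis
    using M(1) M(2)[of "p _"] M(3) p(3) Fv by (intro exI[of _ M] conjI allI impI ballI) (simp_all add: \<beta>_def)
qed

text \<open>
  The directions that are free at each point: in every factor all coordinates but one, as in affine charts.
\<close>

definition directions :: "nat \<Rightarrow> (nat \<Rightarrow> nat) \<Rightarrow> nat \<Rightarrow> (nat \<Rightarrow> nat) \<Rightarrow> (nat \<times> (nat \<times> nat)) set" where
  "directions r n h j0 = (SIGMA i:{..<h}. {w \<in> mvars r n. snd w \<noteq> j0 i})"

lemma directions:
  assumes "\<And>i k. i < h \<Longrightarrow> k \<in> {1..r} \<Longrightarrow> j0 i \<le> n k"
  shows "finite (directions r n h j0)" "directions r n h j0 \<subseteq> {..<h} \<times> mvars r n"
    "card (directions r n h j0) = h * (\<Sum>k=1..r. n k)"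
proof -
  have c: "card {w \<in> mvars r n. snd w \<noteq> j0 i} = (\<Sum>k=1..r. n k)" if "i < h" for i
  proof -
    have "{w \<in> mvars r n. snd w \<noteq> j0 i} = (SIGMA k:{1..r}. {0..n k} - {j0 i})" by (auto simp: mvars_def)
    then have "card {w \<in> mvars r n. snd w \<noteq> j0 i} = (\<Sum>k=1..r. card ({0..n k} - {j0 i}))" by simp
    also have "\<dots> = (\<Sum>k=1..r. n k)" using assms[OF that] by (intro sum.cong) simp_all
    finally show ?thesis .
  qed
  have fin: "finite {w \<in> mvars r n. snd w \<noteq> j0 i}" for i using finite_mvars by simp
  show "finite (directions r n h j0)" "directions r n h j0 \<subseteq> {..<h} \<times> mvars r n"
    unfolding directions_def using fin by auto
  have "card (directions r n h j0) = (\<Sum>i<h. card {w \<in> mvars r n. snd w \<noteq> j0 i})"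
    unfolding directions_def using fin by (subst card_SigmaI) auto
  then show "card (directions r n h j0) = h * (\<Sum>k=1..r. n k)" using c by simp
qed

lemma secant_dim_of_Ind:
  assumes d: "\<And>k. k \<in> {1..r} \<Longrightarrow> 0 < d k" "1 \<le> r"
    and n: "\<And>k. k \<in> {1..r} \<Longrightarrow> N \<le> n k" "0 < N"
    and D: "(\<Sum>k=1..r. d k) = e + 3"
    and h: "gradients_indep N (e + 3) h" "h \<le> (N + (e + 1)) choose N" "1 \<le> h"
  shows "enat (h - 1 + h * (\<Sum>k=1..r. n k)) \<le> proj_dim (multi_exps r n d) (secant (multi_exps r n d) h (segre_veronese r n d))"
proof -
  obtain p where p: "jets N (e + 3) ({..<h} \<times> {..N}) p" "jets N (e + 1) ({..<h} \<times> {Suc N}) p" "\<And>i j. j > N \<Longrightarrow> p i j = 0"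
    using general_points[OF h(1,2)] by blast
  have "\<exists>j\<le>N. p i j \<noteq> 0" if "i < h" for i
    using jets_value_nonzero[of N e "{..<h}" p i] p(2) that by simp
  then obtain j0 where j0: "\<And>i. i < h \<Longrightarrow> j0 i \<le> N" "\<And>i. i < h \<Longrightarrow> p i (j0 i) \<noteq> 0" by metis
  have j0n: "j0 i \<le> n k" if "i < h" "k \<in> {1..r}" for i k using j0(1)[OF that(1)] n(1)[OF that(2)] by simp
  note U = directions[of h r j0 n, OF j0n]
  have "n 1 > 0" using n(1)[of 1] n(2) d(2) by simp
  have "enat (h - 1 + card (directions r n h j0)) \<le> proj_dim (multi_exps r n d) (secant (multi_exps r n d) h (segre_veronese r n d))"
  proof (rule secant_dim_ge[where P = "\<lambda>i. diag (p i)"])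
    fix v :: "nat \<Rightarrow> complex" and \<beta> :: "nat \<Rightarrow> nat \<times> nat \<Rightarrow> complex"
    obtain M where "gform mdeg (mvars r n) (mtype r d) M" "\<forall>i<h. M (diag (p i)) = v i"
      "\<forall>i<h. \<forall>w\<in>mvars r n. snd w \<noteq> j0 i \<longrightarrow> pd w M (diag (p i)) = \<beta> i w"
      using diagonal_tangents[where r = r and N = N and n = n and d = d and v = v and b = \<beta>, OF d n(1) D p j0] by blast
    then show "\<exists>M. gform mdeg (mvars r n) (mtype r d) M \<and> (\<forall>i<h. M (diag (p i)) = v i) \<and>
      (\<forall>(i, w)\<in>directions r n h j0. pd w M (diag (p i)) = \<beta> i w)"
      by (intro exI[of _ M]) (auto simp: directions_def)
  qed (use d U(1,2) h(3) \<open>n 1 > 0\<close> in auto)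
  then show ?thesis by (simp only: U(3))
qed

text \<open>
  The bound \<open>proj_dim_segre_veronese_le\<close> turns a dimension that is expected for a variety of dimension
  \<open>n\<^sub>1 + \<dots> + n\<^sub>r\<close> into one that is expected for the variety itself.
\<close>

lemma not_defectiveI:
  assumes "enat (h - 1 + h * (\<Sum>k=1..r. n k)) \<le> proj_dim (multi_exps r n d) (secant (multi_exps r n d) h (segre_veronese r n d))"
  shows "\<not> defective (multi_exps r n d) (segre_veronese r n d) h"
proof -
  let ?X = "proj_dim (multi_exps r n d) (segre_veronese r n d)" and ?s = "\<Sum>k=1..r. n k"
  obtain x where x: "?X = enat x" "x \<le> ?s"
    using proj_dim_segre_veronese_le[of r n d] by (cases ?X) auto
  have "enat h * ?X + enat h - 1 = enat (h * x + h - 1)"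
    unfolding x(1) by (simp add: one_enat_def)
  also have "\<dots> \<le> enat (h - 1 + h * ?s)"
  proof -
    have "h * x \<le> h * ?s" using x(2) by (rule mult_left_mono) simp
    then have "h * x + h - 1 \<le> h - 1 + h * ?s" by linarith
    then show ?thesis by (simp only: enat_ord_simps)
  qed
  finally show ?thesis using assms unfolding defective_def by (auto simp: not_less min_le_iff_disj intro: order_trans)
qed

lemma not_defective_of_filling:
  assumes "enat (card (multi_exps r n d) - 1) \<le> proj_dim (multi_exps r n d) (secant (multi_exps r n d) h (segre_veronese r n d))"
  shows "\<not> defective (multi_exps r n d) (segre_veronese r n d) h"
  using assms unfolding defective_def by (auto simp: not_less min_le_iff_disj)

lemma not_defective_0: "\<not> defective I X 0"
  by (simp add: defective_def one_enat_def flip: zero_enat_def)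

section \<open>The nineteenth point\<close>

lemma polyfun_all_nonzero:
  assumes "finite J" "\<And>j. j \<in> J \<Longrightarrow> F j \<in> polyfun V" "\<And>j. j \<in> J \<Longrightarrow> \<exists>x. F j x \<noteq> 0"
  shows "\<exists>x. \<forall>j\<in>J. F j x \<noteq> 0"
  using assms
proof (induction J rule: finite_induct)
  case (insert j J)
  then obtain x where x: "\<forall>j\<in>J. F j x \<noteq> 0" by auto
  obtain y where y: "F j y \<noteq> 0" using insert.prems(2) by blast
  have 1: "(\<lambda>x. \<Prod>j\<in>J. F j x) \<in> polyfun V" using insert.prems(1) by (intro polyfun_prod) simp
  have 2: "F j \<in> polyfun V" using insert.prems(1) by simp
  have 3: "(\<Prod>j\<in>J. F j x) \<noteq> 0" using x insert.hyps by simp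
  obtain t where "(\<Prod>j'\<in>J. F j' (\<lambda>v. x v + t * (y v - x v))) \<noteq> 0" "F j (\<lambda>v. x v + t * (y v - x v)) \<noteq> 0"
    using polyfun_common_nonzero[of "\<lambda>x. \<Prod>j\<in>J. F j x" V "F j" V x y, OF 1 2 3 y] by blast
  then show ?case using insert.hyps by (intro exI[of _ "\<lambda>v. x v + t * (y v - x v)"]) simp
qed simp

lemma gform_block_free:
  "gform mdeg V g M \<Longrightarrow> g k = 0 \<Longrightarrow> M \<in> polyfun {v \<in> V. fst v \<noteq> k}"
proof (induction rule: gform.induct)
  case (var v)
  then show ?case by (intro polyfun.var) (auto simp: mdeg_def split: if_splits)
qed (auto intro: polyfun.intros)

text \<open>
  A multiform that is linear in the coordinates of the factor \<open>k\<close> has derivatives along this factor that do not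
  depend on the factor.
\<close>

lemma pd_block_free:
  "gform mdeg V g M \<Longrightarrow> g k \<le> 1 \<Longrightarrow> pd (k, j) M \<in> polyfun {v \<in> V. fst v \<noteq> k}"
proof (induction rule: gform.induct)
  case (const c)
  have "pd (k, j) (\<lambda>x. c) = (\<lambda>x. 0)" by (rule ext) simp
  then show ?case by (simp add: polyfun.const)
next
  case (var v)
  have "pd (k, j) (\<lambda>x. x v) = (\<lambda>x. if (k, j) = v then 1 else 0)" by (rule ext) (simp add: pd_var)
  then show ?case by (simp add: polyfun.const)
next
  case (add g F G)
  have "pd (k, j) (\<lambda>x. F x + G x) = (\<lambda>x. pd (k, j) F x + pd (k, j) G x)"
    by (rule ext) (rule pd_add[OF gform_polyfun[OF add.hyps(1)] gform_polyfun[OF add.hyps(2)]])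
  then show ?case using add by (simp add: polyfun.add)
next
  case (mult g F h G)
  have e: "pd (k, j) (\<lambda>x. F x * G x) = (\<lambda>x. pd (k, j) F x * G x + F x * pd (k, j) G x)"
    by (rule ext) (rule pd_mult[OF gform_polyfun[OF mult.hyps(1)] gform_polyfun[OF mult.hyps(2)]])
  have *: "pd (k, j) A = (\<lambda>x. 0)" if "gform mdeg V a A" "a k = 0" for a A
    by (rule ext) (rule pd_outside[OF gform_block_free[of V a A k]], simp_all add: that)
  show ?case
  proof (cases "g k = 0")
    case True
    then show ?thesis unfolding e *[OF mult.hyps(1) True]
      using gform_block_free[OF mult.hyps(1) True] mult.IH(2) mult.prems
      by (simp add: polyfun.mult)
  next
    case False
    then have h: "h k = 0" "g k \<le> 1" using mult.prems by auto
    then show ?thesis unfolding e *[OF mult.hyps(2) h(1)]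
      using gform_block_free[OF mult.hyps(2) h(1)] mult.IH(1)
      by (simp add: polyfun.mult)
  qed
qed

text \<open>
  Multiforms that are singular at the diagonal points: they can be used at a further point without any
  effect on the conditions at the diagonal points.
\<close>

definition double_vanishing :: "nat \<Rightarrow> (nat \<Rightarrow> nat) \<Rightarrow> (nat \<Rightarrow> nat) \<Rightarrow> nat \<Rightarrow> (nat \<Rightarrow> nat \<Rightarrow> complex) \<Rightarrow>
    ((nat \<times> nat \<Rightarrow> complex) \<Rightarrow> complex) \<Rightarrow> bool" where
  "double_vanishing r n d h p M \<longleftrightarrow> gform mdeg (mvars r n) (mtype r d) M \<and>
     (\<forall>i<h. M (diag (p i)) = 0 \<and> (\<forall>w\<in>mvars r n. pd w M (diag (p i)) = 0))"

lemma double_vanishing_cmult: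
  assumes "double_vanishing r n d h p M"
  shows "double_vanishing r n d h p (\<lambda>x. c * M x)"
proof -
  have M: "gform mdeg (mvars r n) (mtype r d) M" using assms by (simp add: double_vanishing_def)
  show ?thesis using assms unfolding double_vanishing_def
    by (simp add: gform_cmult pd_cmult[OF gform_polyfun[OF M]])
qed

lemma double_vanishing_add:
  assumes "double_vanishing r n d h p M" "double_vanishing r n d h p M'"
  shows "double_vanishing r n d h p (\<lambda>x. M x + M' x)"
proof -
  have M: "gform mdeg (mvars r n) (mtype r d) M" "gform mdeg (mvars r n) (mtype r d) M'"
    using assms by (simp_all add: double_vanishing_def)
  show ?thesis using assms unfolding double_vanishing_def
    by (simp add: gform.add pd_add[OF gform_polyfun[OF M(1)] gform_polyfun[OF M(2)]])
qed

lemma double_vanishing_sum: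
  assumes "double_vanishing r n d h p M" "\<And>a. a \<in> A \<Longrightarrow> double_vanishing r n d h p (f a)"
  shows "double_vanishing r n d h p (\<lambda>x. M x + (\<Sum>a\<in>A. f a x))"
  using assms(2)
proof (induction A rule: infinite_finite_induct)
  case (insert a A)
  have "double_vanishing r n d h p (\<lambda>x. (M x + (\<Sum>a\<in>A. f a x)) + f a x)"
    by (rule double_vanishing_add[OF insert.IH]) (simp_all add: insert.prems)
  then show ?case using insert.hyps by (simp add: add_ac)
qed (simp_all add: assms(1))

text \<open>
  A product of two multiforms that vanish at the points is singular at them. One factor is the minor of the
  factors \<open>a\<close> and \<open>b\<close>, which vanishes on the whole diagonal, and the other is a lift of a form of degree \<open>e\<close>
  through the points. The degree left over is one in the factor \<open>k\<close>, so that the result can be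
  multiplied by linear forms in the coordinates of this factor.
\<close>

lemma double_vanishing_multiplier:
  assumes d: "\<And>k. k \<in> {1..r} \<Longrightarrow> 0 < d k" and D: "(\<Sum>k=1..r. d k) = e + 3"
    and kab: "k \<in> {1..r}" "a \<in> {1..r}" "b \<in> {1..r}" "a \<noteq> b"
    and le: "\<And>l. l \<in> {1..r} \<Longrightarrow> mdeg (k, 0) l + mdeg (a, 0) l + mdeg (b, 0) l \<le> d l"
    and h: "h < (2 + e) choose 2"
  shows "\<exists>G. gform mdeg ({1..r} \<times> {..2}) (\<lambda>l. mtype r d l - mdeg (k, 0) l) G \<and> (\<exists>x. G x \<noteq> 0) \<and>
    (\<forall>i<h. G (diag (p i)) = 0 \<and> (\<forall>w. pd w G (diag (p i)) = 0))"
proof -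
  let ?V = "{1..r} \<times> {..2::nat}"
  have "card ({..<h} \<times> {Suc 2}) < (2 + e) choose 2" using h by (simp add: card_cartesian_product)
  then obtain F y where F: "form 2 e F" "F y \<noteq> 0" "\<forall>m\<in>{..<h} \<times> {Suc 2}. jet 2 p m F = 0"
    using form_vanishing_jets[of "{..<h} \<times> {Suc 2}" 2 e p] by auto
  have Fp: "F (p i) = 0" if "i < h" for i using bspec[OF F(3), of "(i, Suc 2)"] that by (simp add: jet_def)
  let ?g = "\<lambda>l. mtype r d l - mdeg (k, 0) l - mdeg (a, 0) l - mdeg (b, 0) l"
  have gs: "?g l + (mdeg (k, 0) l + mdeg (a, 0) l + mdeg (b, 0) l) = mtype r d l" for l
  proof (cases "l \<in> {1..r}")
    case True
    then show ?thesis using le[OF True] by (simp add: mtype_def)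
  next
    case False
    then have "l \<noteq> k" "l \<noteq> a" "l \<noteq> b" using kab by auto
    then show ?thesis by (simp add: mdeg_def)
  qed
  have "\<exists>M. gform mdeg ?V ?g M \<and> (\<forall>y. M (diag y) = F y)"
  proof (rule lift_form[OF F(1)])
    have one: "(\<Sum>l=1..r. mdeg (c, 0) l) = 1" if "c \<in> {1..r}" for c
      using that by (simp add: mdeg_def)
    have "(\<Sum>l=1..r. ?g l) + 3 = (\<Sum>l=1..r. ?g l + (mdeg (k, 0) l + mdeg (a, 0) l + mdeg (b, 0) l))"
      using kab by (simp only: sum.distrib one)
    also have "\<dots> = e + 3" unfolding gs D[symmetric] by (intro sum.cong) (auto simp: mtype_def)
    finally show "(\<Sum>l=1..r. ?g l) = e" by simp
  qed (subst mtype_outside, assumption, simp)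
  then obtain M where M: "gform mdeg ?V ?g M" "\<And>y. M (diag y) = F y" by auto
  define S where "S x = x (a, 0) * x (b, 1) - x (a, 1) * x (b, 0)" for x :: "nat \<times> nat \<Rightarrow> complex"
  have x: "gform mdeg ?V (mdeg (c, 0)) (\<lambda>x. x (c, j))" if "c \<in> {1..r}" "j \<le> 2" for c j
    using gform.var[of "(c, j)" ?V mdeg] that by (simp add: mdeg_def)
  have S: "gform mdeg ?V (mdeg (a, 0) + mdeg (b, 0)) S"
    unfolding S_def[abs_def] by (intro gform_minus gform.mult x kab) simp_all
  define G where "G x = M x * S x" for x
  have "gform mdeg ?V (?g + (mdeg (a, 0) + mdeg (b, 0))) G"
    unfolding G_def[abs_def] by (rule gform.mult[OF M(1) S])
  moreover have "?g + (mdeg (a, 0) + mdeg (b, 0)) = (\<lambda>l. mtype r d l - mdeg (k, 0) l)"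
  proof
    fix l show "(?g + (mdeg (a, 0) + mdeg (b, 0))) l = mtype r d l - mdeg (k, 0) l"
      using gs[of l] by (simp only: plus_fun_apply)
  qed
  ultimately have "gform mdeg ?V (\<lambda>l. mtype r d l - mdeg (k, 0) l) G" by (simp only:)
  moreover have "\<exists>x. G x \<noteq> 0"
  proof -
    have "S (\<lambda>v. if v = (a, 0) \<or> v = (b, 1) then 1 else 0) \<noteq> 0" using kab(4) by (simp add: S_def)
    moreover have "M (diag y) \<noteq> 0" using M(2) F(2) by simp
    ultimately show ?thesis
      using polyfun_common_nonzero[OF gform_polyfun[OF M(1)] gform_polyfun[OF S], of "diag y"]
      unfolding G_def by auto
  qed
  moreover have "G (diag (p i)) = 0 \<and> (\<forall>w. pd w G (diag (p i)) = 0)" if "i < h" for i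
    unfolding G_def[abs_def]
    using pd_mult[OF gform_polyfun[OF M(1)] gform_polyfun[OF S]] Fp[OF that] M(2)[of "p i"]
    by (simp add: S_def)
  ultimately show ?thesis by blast
qed

text \<open>
  Eighteen points lie on the diagonal; the nineteenth is a point \<open>Q\<close> outside it, at which multiforms that are
  singular at the eighteen points take care of all conditions. For a factor \<open>k\<close> with a multiplier \<open>G k\<close> as in
  \<open>double_vanishing_multiplier\<close>, the products of \<open>G k\<close> with linear forms in this factor that vanish at
  \<open>Q\<close> realise all derivatives along it that Euler's relation leaves free. A multiplier is missing only for \<open>r = 2\<close> and the factor \<open>k0\<close> of
  degree \<open>1\<close>. In this case multiforms are linear in that factor, so their derivatives along it at
  \<open>Q\<close> are those at the diagonal point \<open>y\<close> given by the other factor, and \<open>diagonal_interpolation\<close> at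
  \<open>19\<close> diagonal points prescribes them. It is applied to a multiple of the form \<open>H\<close> of degree \<open>9\<close> that is
  singular at the eighteen points, with the scalar determined by Euler's relation at \<open>y\<close>.
\<close>

lemma nineteen_points:
  assumes d: "\<And>k. k \<in> {1..r} \<Longrightarrow> 0 < d k" "2 \<le> r"
    and n: "\<And>k. k \<in> {1..r} \<Longrightarrow> 2 \<le> n k"
    and D: "(\<Sum>k=1..r. d k) = 6 + 3"
  shows "enat (19 - 1 + 19 * (\<Sum>k=1..r. n k)) \<le> proj_dim (multi_exps r n d) (secant (multi_exps r n d) 19 (segre_veronese r n d))"
proof -
  let ?V = "{1..r} \<times> {..2::nat}"
  have r1: "1 \<le> r" using d(2) by simp
  have V: "?V \<subseteq> mvars r n" using n by (fastforce simp: mvars_def)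
  have "gradients_indep 2 (6 + 3) 18" using gradients_indep_2_9 by simp
  then obtain p :: "nat \<Rightarrow> nat \<Rightarrow> complex" where p: "jets 2 (6 + 3) ({..<18} \<times> {..2}) p" "jets 2 (6 + 1) ({..<18} \<times> {Suc 2}) p"
    "\<And>i j :: nat. j > 2 \<Longrightarrow> p i j = 0"
    using general_points[of 2 "6 + 3" 18 "6 + 1"] by (auto simp: choose_two)
  have "\<exists>j\<le>2. p i j \<noteq> 0" if "i < 18" for i
    using jets_value_nonzero[of 2 6 "{..<18}" p i] p(2) that by simp
  then obtain j0 where j0: "\<And>i. i < 18 \<Longrightarrow> j0 i \<le> 2" "\<And>i. i < 18 \<Longrightarrow> p i (j0 i) \<noteq> 0" by metis
  have "card ({..<18::nat} \<times> {..2::nat}) < (2 + (6 + 3)) choose 2" by (simp add: card_cartesian_product choose_two)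
  then obtain H y1 where H: "form 2 (6 + 3) H" "H y1 \<noteq> 0" "\<forall>m\<in>{..<18} \<times> {..2}. jet 2 p m H = 0"
    using form_vanishing_jets[of "{..<18} \<times> {..2}" 2 "6 + 3" p] by auto
  have Hp: "pd j H (p i) = 0" if "i < 18" "j \<le> 2" for i j
    using bspec[OF H(3), of "(i, j)"] that by (simp add: jet_def)
  have Hv: "H (p i) = 0" if "i < 18" for i using form_euler[OF H(1), of "p i"] Hp[OF that] by simp
  have "card ({..<18::nat} \<times> {Suc 2}) < (2 + (6 + 1)) choose 2" by (simp add: card_cartesian_product choose_two)
  then obtain \<Phi> y2 where \<Phi>: "form 2 (6 + 1) \<Phi>" "\<Phi> y2 \<noteq> 0" "\<And>m. m \<in> {..<18} \<times> {Suc 2} \<Longrightarrow> jet 2 p m \<Phi> = 0"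
    using form_vanishing_jets[of "{..<18} \<times> {Suc 2}" 2 "6 + 1" p] by auto
  \<comment> \<open>The degree leaves room for a multiplier of the factor \<open>k\<close>.\<close>
  define ok where "ok k \<longleftrightarrow> (\<exists>a\<in>{1..r}. \<exists>b\<in>{1..r}. a \<noteq> b \<and>
    (\<forall>l\<in>{1..r}. mdeg (k, 0) l + mdeg (a, 0) l + mdeg (b, 0) l \<le> d l))" for k
  have bad: "r = 2 \<and> d k = 1" if k: "k \<in> {1..r}" "\<not> ok k" for k
  proof (rule ccontr)
    assume neg: "\<not> (r = 2 \<and> d k = 1)"
    have "ok k"
    proof (cases "r = 2")
      case True
      then have "d k \<ge> 2" using neg d(1)[OF k(1)] by simp
      moreover have "d l \<ge> 1" if "l \<in> {1..r}" for l using d(1)[OF that] by simp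
      ultimately show ?thesis unfolding ok_def using True
        by (intro bexI[of _ 1] bexI[of _ 2]) (auto simp: mdeg_def)
    next
      case False
      define a where "a = (if k = 1 then 2 else (1::nat))"
      define b where "b = (if k = 3 then 2 else (3::nat))"
      have ab: "a \<in> {1..r}" "b \<in> {1..r}" "a \<noteq> b" "a \<noteq> k" "b \<noteq> k" using False d(2) by (auto simp: a_def b_def)
      have "d l \<ge> 1" if "l \<in> {1..r}" for l using d(1)[OF that] by simp
      then show ?thesis unfolding ok_def using ab
        by (intro bexI[of _ a] bexI[of _ b]) (auto simp: mdeg_def)
    qed
    then show False using k(2) by simp
  qed
  have "\<exists>G. G \<in> polyfun ?V \<and> (\<exists>x. G x \<noteq> 0) \<and> (ok k \<longrightarrow> gform mdeg ?V (\<lambda>l. mtype r d l - mdeg (k, 0) l) G \<and>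
    (\<forall>i<18. G (diag (p i)) = 0 \<and> (\<forall>w. pd w G (diag (p i)) = 0)))" if k: "k \<in> {1..r}" for k
  proof (cases "ok k")
    case True
    then obtain a b where ab: "a \<in> {1..r}" "b \<in> {1..r}" "a \<noteq> b"
      "\<And>l. l \<in> {1..r} \<Longrightarrow> mdeg (k, 0) l + mdeg (a, 0) l + mdeg (b, 0) l \<le> d l" unfolding ok_def by blast
    have "\<exists>G. gform mdeg ?V (\<lambda>l. mtype r d l - mdeg (k, 0) l) G \<and> (\<exists>x. G x \<noteq> 0) \<and>
      (\<forall>i<18. G (diag (p i)) = 0 \<and> (\<forall>w. pd w G (diag (p i)) = 0))"
      by (rule double_vanishing_multiplier[OF d(1) D k ab]) (simp_all add: choose_two)
    then show ?thesis using gform_polyfun by blast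
  next
    case False
    have "(\<lambda>x. 1) \<in> polyfun ?V" by (rule polyfun.const)
    then show ?thesis using False by (intro exI[of _ "\<lambda>x. 1"]) simp
  qed
  then have "\<forall>k\<in>{1..r}. \<exists>G. G \<in> polyfun ?V \<and> (\<exists>x. G x \<noteq> 0) \<and> (ok k \<longrightarrow> gform mdeg ?V (\<lambda>l. mtype r d l - mdeg (k, 0) l) G \<and>
    (\<forall>i<18. G (diag (p i)) = 0 \<and> (\<forall>w. pd w G (diag (p i)) = 0)))" by blast
  from bchoice[OF this] obtain G where G: "\<forall>k\<in>{1..r}. G k \<in> polyfun ?V \<and> (\<exists>x. G k x \<noteq> 0) \<and>
    (ok k \<longrightarrow> gform mdeg ?V (\<lambda>l. mtype r d l - mdeg (k, 0) l) (G k) \<and>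
    (\<forall>i<18. G k (diag (p i)) = 0 \<and> (\<forall>w. pd w (G k) (diag (p i)) = 0)))" by blast
  \<comment> \<open>The functions that have to be nonzero at \<open>Q\<close>: the zeroth coordinates, the multipliers, and the forms \<open>H\<close> and \<open>\<Phi>\<close> on each factor.\<close>
  define C where "C = (\<lambda>(k, s) x. if s = (0::nat) then x (k, 0::nat) else if s = 1 then G k x
     else if s = 2 then H (\<lambda>j. x (k, j)) else \<Phi> (\<lambda>j. x (k, j)))"
  have block: "(\<lambda>x. F (\<lambda>j. x (k, j))) \<in> polyfun UNIV" if "form 2 m F" for F m and k :: nat
    by (rule polyfun_comp[OF gform_polyfun[OF that]]) (rule polyfun.var, simp)
  have "\<exists>x. \<forall>c\<in>{1..r} \<times> {..3}. C c x \<noteq> 0"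
  proof (rule polyfun_all_nonzero[of _ _ UNIV])
    fix c assume "c \<in> {1..r} \<times> {..3::nat}"
    then obtain k s where c: "c = (k, s)" "k \<in> {1..r}" by auto
    have Gk: "G k \<in> polyfun UNIV" "\<exists>x. G k x \<noteq> 0"
      using bspec[OF G c(2)] polyfun_mono[of "G k" ?V UNIV] by auto
    have CC: "C c = (if s = 0 then (\<lambda>x. x (k, 0)) else if s = 1 then G k
      else if s = 2 then (\<lambda>x. H (\<lambda>j. x (k, j))) else (\<lambda>x. \<Phi> (\<lambda>j. x (k, j))))"
      by (rule ext) (simp add: C_def c(1))
    show "C c \<in> polyfun UNIV"
      unfolding CC using polyfun.var[of "(k, 0::nat)" UNIV] Gk(1) block[OF H(1), of k] block[OF \<Phi>(1), of k] by simp
    have nz: "\<exists>x. F (\<lambda>j. x (k, j)) \<noteq> 0" if "F y \<noteq> 0" for F :: "(nat \<Rightarrow> complex) \<Rightarrow> complex" and y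
      using that by (intro exI[of _ "diag y"]) simp
    have "\<exists>x. x (k, 0::nat) \<noteq> (0::complex)" by (rule exI[of _ "\<lambda>_. 1"]) simp
    then show "\<exists>x. C c x \<noteq> 0"
      unfolding CC using Gk(2) nz[of H, OF H(2)] nz[of \<Phi>, OF \<Phi>(2)] by simp
  qed simp
  then obtain Q' where Q': "\<forall>c\<in>{1..r} \<times> {..3}. C c Q' \<noteq> 0" by blast
  \<comment> \<open>Coordinates beyond \<open>2\<close> are cleared to make each factor of \<open>Q\<close> a point of the plane.\<close>
  define Q where "Q = (\<lambda>(k::nat, j). if j \<le> 2 then Q' (k, j) else 0)"
  have Q0: "Q (k, 0) \<noteq> 0" if "k \<in> {1..r}" for k
    using bspec[OF Q', of "(k, 0)"] that by (simp add: C_def Q_def)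
  have QG: "G k Q \<noteq> 0" if "k \<in> {1..r}" for k
  proof -
    have "G k Q' \<noteq> 0" using bspec[OF Q', of "(k, 1)"] that by (simp add: C_def)
    moreover have "G k Q = G k Q'"
      by (rule polyfun_local[of _ ?V]) (use bspec[OF G that] in \<open>auto simp: Q_def\<close>)
    ultimately show ?thesis by simp
  qed
  have Qb: "F (\<lambda>j. Q (k, j)) = F (\<lambda>j. Q' (k, j))" if "form 2 m F" for F m k
    by (rule polyfun_local[OF gform_polyfun[OF that]]) (simp add: Q_def)
  have QH: "H (\<lambda>j. Q (k, j)) \<noteq> 0" "\<Phi> (\<lambda>j. Q (k, j)) \<noteq> 0" if "k \<in> {1..r}" for k
    using bspec[OF Q', of "(k, 2)"] bspec[OF Q', of "(k, 3)"] that by (simp_all add: C_def Qb[OF H(1)] Qb[OF \<Phi>(1)])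
  have Q2: "Q (k, j) = 0" if "j > 2" for k j using that by (simp add: Q_def)
  let ?W = "double_vanishing r n d 18 p"
  have G0: "G k (diag (p i)) = 0" "pd w (G k) (diag (p i)) = 0" if "k \<in> {1..r}" "ok k" "i < 18" for k i w
    using bspec[OF G that(1)] that(2,3) by blast+
  have GW: "?W (\<lambda>x. G k x * L x)" and pdGL: "pd w (\<lambda>x. G k x * L x) z = pd w (G k) z * L z + G k z * pd w L z"
    if k: "k \<in> {1..r}" "ok k" and L: "gform mdeg (mvars r n) (mdeg (k, 0)) L" for k L w z
  proof -
    have Gk: "gform mdeg (mvars r n) (\<lambda>l. mtype r d l - mdeg (k, 0) l) (G k)"
      using bspec[OF G k(1)] k(2) gform_mono[OF _ V] by blast
    show pd: "pd w (\<lambda>x. G k x * L x) z = pd w (G k) z * L z + G k z * pd w L z" for w z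
      by (rule pd_mult[OF gform_polyfun[OF Gk] gform_polyfun[OF L]])
    have "(\<lambda>l. mtype r d l - mdeg (k, 0) l) + mdeg (k, 0) = mtype r d"
      using k(1) d(1) by (auto simp: fun_eq_iff mtype_def mdeg_def Suc_leI)
    then have "gform mdeg (mvars r n) (mtype r d) (\<lambda>x. G k x * L x)" using gform.mult[OF Gk L] by simp
    then show "?W (\<lambda>x. G k x * L x)"
      using G0[of k] k by (simp add: double_vanishing_def pd)
  qed
  have xv: "gform mdeg (mvars r n) (mdeg (k, 0)) (\<lambda>x. x (k, j))" if "(k, j) \<in> mvars r n" for k j
    using gform.var[OF that, of mdeg] by (simp add: mdeg_def)
  \<comment> \<open>A dual basis for the derivatives along the factors with a multiplier; their value at \<open>Q\<close> is zero.\<close>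
  have B: "\<exists>B. ?W B \<and> B Q = 0 \<and> (\<forall>w. snd w \<noteq> 0 \<longrightarrow> pd w B Q = (if w = v then 1 else 0))"
    if v: "v \<in> mvars r n" "ok (fst v)" "snd v \<noteq> 0" for v
  proof -
    obtain k j where kj: "v = (k, j)" by (cases v)
    have k: "k \<in> {1..r}" "(k, 0) \<in> mvars r n" using v(1) by (auto simp: kj mvars_def)
    define s where "s = 1 / G k Q"
    define t where "t = - Q (k, j) / (Q (k, 0) * G k Q)"
    have s: "G k Q * s = 1" using QG[OF k(1)] by (simp add: s_def)
    define L where "L x = s * x (k, j) + t * x (k, 0)" for x
    have 1: "gform mdeg (mvars r n) (mdeg (k, 0)) (\<lambda>x. s * x (k, j))"
      "gform mdeg (mvars r n) (mdeg (k, 0)) (\<lambda>x. t * x (k, 0))"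
      using v(1) k(2) by (auto intro!: gform_cmult xv simp: kj)
    have L: "gform mdeg (mvars r n) (mdeg (k, 0)) L" unfolding L_def[abs_def] by (rule gform.add[OF 1])
    have LQ: "L Q = 0" using Q0[OF k(1)] QG[OF k(1)] by (simp add: L_def s_def t_def field_simps)
    have pv: "(\<lambda>x. x (k, i)) \<in> polyfun UNIV" for i by (rule polyfun.var) simp
    have pdL: "pd w L Q = (if w = v then s else 0)" if "snd w \<noteq> 0" for w
      unfolding L_def[abs_def] using that v(3)
      by (subst pd_add[OF gform_polyfun[OF 1(1)] gform_polyfun[OF 1(2)]])
         (auto simp: pd_cmult[OF pv] pd_var kj)
    have okk: "ok k" using v(2) by (simp add: kj)
    have "pd w (\<lambda>x. G k x * L x) Q = (if w = v then 1 else 0)" if "snd w \<noteq> 0" for w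
      unfolding pdGL[OF k(1) okk L] by (simp add: LQ pdL[OF that] s)
    then show ?thesis
      using GW[OF k(1) okk L] LQ by (intro exI[of _ "\<lambda>x. G k x * L x"]) simp
  qed
  \<comment> \<open>The value at \<open>Q\<close>, together with the derivatives along a factor without a multiplier, if there is one.\<close>
  have base: "\<exists>M. ?W M \<and> M Q = v \<and> (\<forall>w\<in>mvars r n. snd w \<noteq> 0 \<longrightarrow> \<not> ok (fst w) \<longrightarrow> pd w M Q = b w)" for v b
  proof (cases "\<forall>k\<in>{1..r}. ok k")
    case True
    have k: "1 \<in> {1..r}" "(1, 0) \<in> mvars r n" using r1 by (auto simp: mvars_def)
    have "?W (\<lambda>x. G 1 x * x (1, 0))" by (rule GW[OF k(1) _ xv[OF k(2)]]) (use True k(1) in blast)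
    then have "?W (\<lambda>x. v / (G 1 Q * Q (1, 0)) * (G 1 x * x (1, 0)))" by (rule double_vanishing_cmult)
    moreover have "v / (G 1 Q * Q (1, 0)) * (G 1 Q * Q (1, 0)) = v" using Q0[OF k(1)] QG[OF k(1)] by simp
    moreover have "ok (fst w)" if "w \<in> mvars r n" for w using that True by (auto simp: mvars_def)
    ultimately show ?thesis by (intro exI[of _ "\<lambda>x. v / (G 1 Q * Q (1, 0)) * (G 1 x * x (1, 0))"]) auto
  next
    case False
    then obtain k0 where k0: "k0 \<in> {1..r}" "\<not> ok k0" by blast
    have r: "r = 2" "d k0 = 1" using bad[OF k0] by auto
    define k1 where "k1 = 3 - k0"
    have "k0 = 1 \<or> k0 = 2" using k0(1) r(1) by auto
    then have k1: "k1 \<in> {1..r}" "k1 \<noteq> k0" "{1..r} = {k0, k1}" by (auto simp: k1_def r(1))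
    have d1: "d k1 = 8" using D k1 r(2) by simp
    have okk: "k = k0" if "k \<in> {1..r}" "\<not> ok k" for k
      using bad[OF that] that k1 d1 by auto
    define y where "y = (\<lambda>j. Q (k1, j))"
    have y2: "y j = 0" if "j > 2" for j using Q2[OF that] by (simp add: y_def)
    \<comment> \<open>Since the degree in the factor \<open>k0\<close> is \<open>1\<close>, its derivatives determine the value at \<open>Q\<close>; the entry \<open>c 0\<close> makes this value \<open>v\<close>.\<close>
    define c where "c j = (if j = 0 then (v - (\<Sum>j\<in>{..2} - {0}. Q (k0, j) * b (k0, j))) / Q (k0, 0) else b (k0, j))" for j
    have c: "(\<Sum>j\<le>2. Q (k0, j) * c j) = v"
      unfolding c_def by (rule sum_punctured[of 0 2 "\<lambda>j. Q (k0, j)"]) (use Q0[OF k0(1)] in simp_all)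
    define \<alpha> where "\<alpha> = (\<Sum>j\<le>2. y j * c j) / H y"
    define F where "F x = \<alpha> * H x" for x
    have F: "form 2 (6 + 3) F" unfolding F_def[abs_def] by (rule gform_cmult[OF H(1)])
    have pdF: "pd j F x = \<alpha> * pd j H x" for j x unfolding F_def[abs_def] by (rule pd_cmult[OF gform_polyfun[OF H(1)]])
    have Fy: "F y = (\<Sum>j\<le>2. y j * c j)" using QH(1)[OF k1(1)] by (simp add: F_def \<alpha>_def y_def)
    define p' where "p' = p(18 := y)"
    define \<beta> where "\<beta> i k j = (if i = 18 then if k = k0 then c j else if j \<le> 2 then pd j F y - c j else 0 else 0)"
      for i k j :: nat
    \<comment> \<open>The form \<open>\<Phi>\<close> vanishes at the eighteen points but not at \<open>y\<close>, so the value at \<open>y\<close> is a further independent condition.\<close>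
    have "jets 2 (6 + 1) (insert (18, Suc 2) ({..<18::nat} \<times> {Suc 2})) p'"
      unfolding p'_def by (rule jets_insert_value_at[OF p(2) _ \<Phi>(1) _ \<Phi>(3)]) (use QH(2)[OF k1(1)] in \<open>auto simp: y_def\<close>)
    moreover have "insert (18, Suc 2) ({..<18::nat} \<times> {Suc 2}) = {..<19} \<times> {Suc 2}" by auto
    ultimately have val: "jets 2 (6 + 1) ({..<19} \<times> {Suc 2}) p'" by (simp only:)
    have sum2: "(\<Sum>k=1..r. f k) = f k0 + f k1" for f :: "nat \<Rightarrow> complex"
      using k1(2) unfolding k1(3) by simp
    have "\<exists>M. gform mdeg (mvars r n) (mtype r d) M \<and> (\<forall>y. (\<forall>j>2. y j = 0) \<longrightarrow> M (diag y) = F y) \<and>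
      (\<forall>i\<in>{..<19}. \<forall>w\<in>mvars r n. pd w M (diag (p' i)) = \<beta> i (fst w) (snd w))"
    proof (rule diagonal_interpolation[OF _ d(1) r1 n D val _ F])
      show "p' i j = 0" if "j > 2" for i j using p(3)[OF that] y2[OF that] by (simp add: p'_def)
      show "pd j F (p' i) = (\<Sum>k=1..r. \<beta> i k j)" if "i \<in> {..<19}" "j \<le> 2" for i j
        using that Hp[of i j] k1(2) unfolding sum2 by (cases "i = 18") (auto simp: p'_def \<beta>_def pdF)
      show "(\<Sum>j\<le>2. p' i j * \<beta> i k j) = of_nat (d k) * F (p' i)" if "i \<in> {..<19}" "k \<in> {1..r}" for i k
      proof (cases "i = 18")
        case False
        then show ?thesis using that Hv[of i] by (simp add: p'_def \<beta>_def F_def)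
      next
        case True
        show ?thesis
        proof (cases "k = k0")
          case k: True
          then show ?thesis using True Fy r(2) by (simp add: p'_def \<beta>_def)
        next
          case k: False
          then have kk: "k = k1" using that(2) k1(3) by blast
          have "(\<Sum>j\<le>2. y j * pd j F y) = of_nat (6 + 3) * F y" by (rule form_euler[OF F])
          then have "(\<Sum>j\<le>2. y j * (pd j F y - c j)) = 8 * F y"
            using Fy by (simp add: algebra_simps sum_subtractf)
          then show ?thesis using True k d1 by (simp add: p'_def \<beta>_def kk)
        qed
      qed
    qed simp_all
    then obtain M where M: "gform mdeg (mvars r n) (mtype r d) M" "\<And>y. \<forall>j>2. y j = 0 \<Longrightarrow> M (diag y) = F y"
      "\<And>i w. i < 19 \<Longrightarrow> w \<in> mvars r n \<Longrightarrow> pd w M (diag (p' i)) = \<beta> i (fst w) (snd w)" by auto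
    have WM: "?W M"
      unfolding double_vanishing_def
    proof (intro conjI allI impI ballI)
      fix i :: nat assume i: "i < 18"
      show "M (diag (p i)) = 0" using M(2)[of "p i"] p(3) Hv[OF i] by (simp add: F_def)
      show "pd w M (diag (p i)) = 0" if "w \<in> mvars r n" for w
        using M(3)[of i w] i that by (simp add: p'_def \<beta>_def)
    qed (rule M(1))
    have pdQ: "pd (k0, j) M Q = c j" if j: "(k0, j) \<in> mvars r n" for j
    proof -
      have "pd (k0, j) M Q = pd (k0, j) M (diag y)"
      proof (rule polyfun_local[OF pd_block_free[OF M(1)]])
        show "mtype r d k0 \<le> 1" using r(2) by (simp add: mtype_def)
        fix v assume v: "v \<in> {v \<in> mvars r n. fst v \<noteq> k0}"
        then have "fst v \<in> {1..r}" "fst v \<noteq> k0" by (auto simp: mvars_def)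
        then have "fst v = k1" using k1(3) by blast
        then show "Q v = diag y v" by (cases v) (simp add: y_def)
      qed
      also have "\<dots> = c j" using M(3)[of 18, OF _ j] by (simp add: p'_def \<beta>_def)
      finally show ?thesis .
    qed
    have "(\<Sum>v\<in>mvars r n. of_nat (mdeg v k0) * Q v * pd v M Q) = of_nat (mtype r d k0) * M Q"
      by (rule gform_euler[OF M(1) finite_mvars, of "\<lambda>g. g k0"]) auto
    moreover have "(\<Sum>v\<in>mvars r n. of_nat (mdeg v k0) * Q v * pd v M Q) = (\<Sum>j=0..n k0. Q (k0, j) * c j)"
    proof -
      have "(\<Sum>v\<in>mvars r n. of_nat (mdeg v k0) * Q v * pd v M Q)
        = (\<Sum>k=1..r. if k = k0 then \<Sum>j=0..n k0. Q (k0, j) * pd (k0, j) M Q else 0)"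
        unfolding sum_mvars by (intro sum.cong) (auto simp: mdeg_def)
      also have "\<dots> = (\<Sum>j=0..n k0. Q (k0, j) * pd (k0, j) M Q)" using k0(1) by simp
      also have "\<dots> = (\<Sum>j=0..n k0. Q (k0, j) * c j)"
        using k0(1) by (intro sum.cong refl) (simp add: pdQ mvars_def)
      finally show ?thesis .
    qed
    moreover have "(\<Sum>j=0..n k0. Q (k0, j) * c j) = (\<Sum>j\<le>2. Q (k0, j) * c j)"
      using n[OF k0(1)] Q2 by (intro sum.mono_neutral_right) auto
    moreover have "mtype r d k0 = 1" using k0(1) r(2) by (simp add: mtype_def)
    ultimately have "M Q = v" using c by simp
    moreover have "pd w M Q = b w" if w: "w \<in> mvars r n" "snd w \<noteq> 0" "\<not> ok (fst w)" for w
    proof -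
      have "fst w = k0" using okk[OF _ w(3)] w(1) by (auto simp: mvars_def)
      then have "w = (k0, snd w)" by (cases w) simp
      then show ?thesis using pdQ[of "snd w"] w by (simp add: c_def)
    qed
    ultimately show ?thesis using WM by blast
  qed
  have atQ: "\<exists>M. ?W M \<and> M Q = v \<and> (\<forall>w\<in>mvars r n. snd w \<noteq> 0 \<longrightarrow> pd w M Q = b w)" for v b
  proof -
    obtain M1 where M1: "?W M1" "M1 Q = v" "\<And>w. w \<in> mvars r n \<Longrightarrow> snd w \<noteq> 0 \<Longrightarrow> \<not> ok (fst w) \<Longrightarrow> pd w M1 Q = b w"
      using base[of v b] by blast
    define U where "U = {w \<in> mvars r n. snd w \<noteq> 0 \<and> ok (fst w)}"
    have finU: "finite U" using finite_mvars[of r n] by (simp add: U_def)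
    have "\<forall>u\<in>U. \<exists>B. ?W B \<and> B Q = 0 \<and> (\<forall>w. snd w \<noteq> 0 \<longrightarrow> pd w B Q = (if w = u then 1 else 0))"
      using B by (auto simp: U_def)
    from bchoice[OF this] obtain E where E: "\<forall>u\<in>U. ?W (E u) \<and> E u Q = 0 \<and>
      (\<forall>w. snd w \<noteq> 0 \<longrightarrow> pd w (E u) Q = (if w = u then 1 else 0))" by blast
    define M where "M x = M1 x + (\<Sum>u\<in>U. (b u - pd u M1 Q) * E u x)" for x
    have cE: "?W (\<lambda>x. (b u - pd u M1 Q) * E u x)" if "u \<in> U" for u
      using bspec[OF E that] by (intro double_vanishing_cmult) blast
    have "?W M" unfolding M_def[abs_def] by (rule double_vanishing_sum[OF M1(1) cE])
    moreover have "M Q = v" using M1(2) E by (simp add: M_def)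
    moreover have "pd w M Q = b w" if w: "w \<in> mvars r n" "snd w \<noteq> 0" for w
    proof -
      have pE: "E u \<in> polyfun (mvars r n)" if "u \<in> U" for u
        using bspec[OF E that] gform_polyfun by (auto simp: double_vanishing_def)
      have pM1: "M1 \<in> polyfun (mvars r n)" using M1(1) gform_polyfun by (auto simp: double_vanishing_def)
      have pc: "(\<lambda>x. (b u - pd u M1 Q) * E u x) \<in> polyfun (mvars r n)" if "u \<in> U" for u
        by (rule polyfun.mult[OF polyfun.const pE[OF that]])
      have "pd w M Q = pd w M1 Q + pd w (\<lambda>x. \<Sum>u\<in>U. (b u - pd u M1 Q) * E u x) Q"
        unfolding M_def[abs_def] by (rule pd_add[OF pM1 polyfun_sum[OF pc]])
      also have "pd w (\<lambda>x. \<Sum>u\<in>U. (b u - pd u M1 Q) * E u x) Q = (\<Sum>u\<in>U. (b u - pd u M1 Q) * pd w (E u) Q)"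
        by (subst pd_sum[OF pc]) (auto intro!: sum.cong pd_cmult pE)
      also have "\<dots> = (\<Sum>u\<in>U. if w = u then b w - pd w M1 Q else 0)"
      proof (rule sum.cong[OF refl])
        fix u assume "u \<in> U"
        then have "pd w (E u) Q = (if w = u then 1 else 0)" using bspec[OF E] w(2) by blast
        then show "(b u - pd u M1 Q) * pd w (E u) Q = (if w = u then b w - pd w M1 Q else 0)" by simp
      qed
      also have "\<dots> = (if w \<in> U then b w - pd w M1 Q else 0)" using finU by simp
      finally show ?thesis using M1(3)[OF w] w by (auto simp: U_def)
    qed
    ultimately show ?thesis by blast
  qed
  define j1 where "j1 i = (if i < 18 then j0 i else 0)" for i
  define P where "P i = (if i < 18 then diag (p i) else Q)" for i
  have j1n: "j1 i \<le> n k" if "i < 19" "k \<in> {1..r}" for i k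
    by (cases "i < 18") (auto simp: j1_def intro: order_trans[OF j0(1) n[OF that(2)]])
  note U = directions[of 19 r j1 n, OF j1n]
  have "enat (19 - 1 + card (directions r n 19 j1)) \<le> proj_dim (multi_exps r n d) (secant (multi_exps r n d) 19 (segre_veronese r n d))"
  proof (rule secant_dim_ge[where P = P])
    fix v :: "nat \<Rightarrow> complex" and \<beta> :: "nat \<Rightarrow> nat \<times> nat \<Rightarrow> complex"
    obtain Ma where Ma: "gform mdeg (mvars r n) (mtype r d) Ma" "\<forall>i<18. Ma (diag (p i)) = v i"
      "\<forall>i<18. \<forall>w\<in>mvars r n. snd w \<noteq> j0 i \<longrightarrow> pd w Ma (diag (p i)) = \<beta> i w"
      using diagonal_tangents[where r = r and N = 2 and n = n and d = d and v = v and b = \<beta>, OF d(1) r1 n D p j0] by blast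
    obtain Mb where Mb: "?W Mb" "Mb Q = v 18 - Ma Q"
      "\<forall>w\<in>mvars r n. snd w \<noteq> 0 \<longrightarrow> pd w Mb Q = \<beta> 18 w - pd w Ma Q"
      using atQ[of "v 18 - Ma Q" "\<lambda>w. \<beta> 18 w - pd w Ma Q"] by blast
    have Mb': "gform mdeg (mvars r n) (mtype r d) Mb" using Mb(1) by (simp add: double_vanishing_def)
    let ?M = "\<lambda>x. Ma x + Mb x"
    have pdM: "pd w ?M x = pd w Ma x + pd w Mb x" for w x
      by (rule pd_add[OF gform_polyfun[OF Ma(1)] gform_polyfun[OF Mb']])
    have "gform mdeg (mvars r n) (mtype r d) ?M" by (rule gform.add[OF Ma(1) Mb'])
    moreover have "?M (P i) = v i" if "i < 19" for i
    proof (cases "i < 18")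
      case True
      then show ?thesis using Ma(2) Mb(1) by (simp add: P_def double_vanishing_def)
    next
      case False
      then have "i = 18" using that by simp
      then show ?thesis using Mb(2) by (simp add: P_def)
    qed
    moreover have "pd w ?M (P i) = \<beta> i w" if iw: "(i, w) \<in> directions r n 19 j1" for i w
    proof (cases "i < 18")
      case True
      then show ?thesis using Ma(3) Mb(1) iw by (simp add: P_def double_vanishing_def pdM directions_def j1_def)
    next
      case False
      then have "i = 18" using iw by (simp add: directions_def)
      then show ?thesis using Mb(3) iw by (simp add: P_def pdM directions_def j1_def)
    qed
    ultimately show "\<exists>M. gform mdeg (mvars r n) (mtype r d) M \<and> (\<forall>i<19. M (P i) = v i) \<and>
      (\<forall>(i, w)\<in>directions r n 19 j1. pd w M (P i) = \<beta> i w)"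
      by (intro exI[of _ ?M]) auto
  qed (use d r1 n[of 1] U(1,2) in auto)
  then show ?thesis by (simp only: U(3))
qed

text \<open>
  The \<open>18\<close> points contribute \<open>18 \<cdot> 3 = 54\<close> conditions. A form of degree \<open>9\<close> that is singular at them and nonzero at a further
  point \<open>y\<close> adds the value at \<open>y\<close>, and \<open>55\<close> is the number of all monomials.
\<close>

lemma nineteen_points_plane:
  assumes "d 1 = 6 + 3" "n 1 = 2"
  shows "enat (card (multi_exps 1 n d) - 1) \<le> proj_dim (multi_exps 1 n d) (secant (multi_exps 1 n d) 19 (segre_veronese 1 n d))"
proof -
  have d: "\<And>k. k \<in> {1..1} \<Longrightarrow> 0 < d k" and D: "(\<Sum>k=1..1. d k) = 6 + 3" and n: "\<And>k. k \<in> {1..1} \<Longrightarrow> 2 \<le> n k"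
    using assms by auto
  have "gradients_indep 2 (6 + 3) 18" using gradients_indep_2_9 by simp
  then obtain p :: "nat \<Rightarrow> nat \<Rightarrow> complex" where p: "jets 2 (6 + 3) ({..<18} \<times> {..2}) p" "jets 2 (6 + 1) ({..<18} \<times> {Suc 2}) p"
    "\<And>i j :: nat. j > 2 \<Longrightarrow> p i j = 0"
    using general_points[of 2 "6 + 3" 18 "6 + 1"] by (auto simp: choose_two)
  have "\<exists>j\<le>2. p i j \<noteq> 0" if "i < 18" for i
    using jets_value_nonzero[of 2 6 "{..<18}" p i] p(2) that by simp
  then obtain j0 where j0: "\<And>i. i < 18 \<Longrightarrow> j0 i \<le> 2" "\<And>i. i < 18 \<Longrightarrow> p i (j0 i) \<noteq> 0" by metis
  have "card ({..<18::nat} \<times> {..2::nat}) < (2 + (6 + 3)) choose 2" by (simp add: card_cartesian_product choose_two)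
  then obtain H y1 where H: "form 2 (6 + 3) H" "H y1 \<noteq> 0" "\<forall>m\<in>{..<18} \<times> {..2}. jet 2 p m H = 0"
    using form_vanishing_jets[of "{..<18} \<times> {..2}" 2 "6 + 3" p] by auto
  have Hp: "pd j H (p i) = 0" if "i < 18" "j \<le> 2" for i j
    using bspec[OF H(3), of "(i, j)"] that by (simp add: jet_def)
  have Hv: "H (p i) = 0" if "i < 18" for i using form_euler[OF H(1), of "p i"] Hp[OF that] by simp
  define y where "y j = (if j \<le> 2 then y1 j else 0)" for j
  have "H y = H y1" by (rule polyfun_local[OF gform_polyfun[OF H(1)]]) (simp add: y_def)
  then have Hy: "H y \<noteq> 0" using H(2) by simp
  have "\<exists>M. gform mdeg (mvars 1 n) (mtype 1 d) M \<and> (\<forall>y. (\<forall>j>2. y j = 0) \<longrightarrow> M (diag y) = H y) \<and>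
    (\<forall>i\<in>{..<18}. \<forall>w\<in>mvars 1 n. pd w M (diag (p i)) = (\<lambda>_ _ _. 0) i (fst w) (snd w))"
    by (rule diagonal_interpolation[OF _ d _ n D p(2,3) H(1)]) (simp_all add: Hp Hv)
  then obtain E where E: "gform mdeg (mvars 1 n) (mtype 1 d) E" "\<And>y. \<forall>j>2. y j = 0 \<Longrightarrow> E (diag y) = H y"
    "\<And>i w. i < 18 \<Longrightarrow> w \<in> mvars 1 n \<Longrightarrow> pd w E (diag (p i)) = 0" by auto
  have Ep: "E (diag (p i)) = 0" if "i < 18" for i using E(2)[of "p i"] p(3) Hv[OF that] by simp
  have Ey: "E (diag y) \<noteq> 0" using E(2)[of y] Hy by (simp add: y_def)
  have j0n: "j0 i \<le> n k" if "i < 18" "k \<in> {1..1}" for i k using j0(1)[OF that(1)] n[OF that(2)] by simp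
  note U = directions[of 18 1 j0 n, OF j0n]
  define P where "P i = diag (if i < 18 then p i else y)" for i
  have "enat (19 - 1 + card (directions 1 n 18 j0)) \<le> proj_dim (multi_exps 1 n d) (secant (multi_exps 1 n d) 19 (segre_veronese 1 n d))"
  proof (rule secant_dim_ge[where P = P])
    show "directions 1 n 18 j0 \<subseteq> {..<19} \<times> mvars 1 n" using U(2) by auto
    fix v :: "nat \<Rightarrow> complex" and \<beta> :: "nat \<Rightarrow> nat \<times> nat \<Rightarrow> complex"
    obtain Ma where Ma: "gform mdeg (mvars 1 n) (mtype 1 d) Ma" "\<forall>i<18. Ma (diag (p i)) = v i"
      "\<forall>i<18. \<forall>w\<in>mvars 1 n. snd w \<noteq> j0 i \<longrightarrow> pd w Ma (diag (p i)) = \<beta> i w"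
      using diagonal_tangents[where r = 1 and N = 2 and n = n and d = d and v = v and b = \<beta>, OF d _ n D p j0] by auto
    define c where "c = (v 18 - Ma (diag y)) / E (diag y)"
    let ?M = "\<lambda>x. Ma x + c * E x"
    have cE: "gform mdeg (mvars 1 n) (mtype 1 d) (\<lambda>x. c * E x)" by (rule gform_cmult[OF E(1)])
    have pdM: "pd w ?M x = pd w Ma x + c * pd w E x" for w x
      using pd_add[OF gform_polyfun[OF Ma(1)] gform_polyfun[OF cE], of w x] pd_cmult[OF gform_polyfun[OF E(1)], of w c x] by simp
    have "gform mdeg (mvars 1 n) (mtype 1 d) ?M" by (rule gform.add[OF Ma(1) cE])
    moreover have "?M (P i) = v i" if "i < 19" for i
    proof (cases "i < 18")
      case True
      then show ?thesis using Ma(2) Ep by (simp add: P_def)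
    next
      case False
      then have "i = 18" using that by simp
      then show ?thesis using Ey by (simp add: P_def c_def)
    qed
    moreover have "pd w ?M (P i) = \<beta> i w" if "(i, w) \<in> directions 1 n 18 j0" for i w
      using that Ma(3) E(3) by (simp add: directions_def pdM P_def)
    ultimately show "\<exists>M. gform mdeg (mvars 1 n) (mtype 1 d) M \<and> (\<forall>i<19. M (P i) = v i) \<and>
      (\<forall>(i, w)\<in>directions 1 n 18 j0. pd w M (P i) = \<beta> i w)"
      by (intro exI[of _ ?M]) auto
  qed (use d assms U(1) in auto)
  moreover have "card (directions 1 n 18 j0) = 36" using U(3) assms by simp
  moreover have "card (multi_exps 1 n d) \<le> 55"
  proof -
    have "inj_on (\<lambda>a. a 1) (multi_exps 1 n d)"
    proof (rule inj_onI)
      fix a b assume ab: "a \<in> multi_exps 1 n d" "b \<in> multi_exps 1 n d" "a 1 = b 1"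
      have "a i = b i" for i using ab by (cases "i = 1") (auto simp: multi_exps_def fun_eq_iff)
      then show "a = b" by blast
    qed
    moreover have "(\<lambda>a. a 1) ` multi_exps 1 n d \<subseteq> exps 2 9"
      using assms by (auto simp: multi_exps_def exps_def atLeast0AtMost)
    ultimately have "card (multi_exps 1 n d) \<le> card (exps 2 9)" by (rule card_inj_on_le) (rule finite_exps)
    then show ?thesis by (simp add: card_exps choose_two)
  qed
  ultimately show ?thesis by (auto elim!: order_trans[rotated])
qed

theorem theorem1p0p4:
  fixes r s h eps :: nat and n d lam :: "nat \<Rightarrow> nat"
  assumes "\<forall>i\<in>{1..r}. 0 < n i"
    and "\<forall>i\<in>{1..r}. 0 < d i"
    and "mono_on {1..r} n"
    and "(\<Sum>i=1..r. d i) \<ge> 3"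
    and "(\<Sum>i=1..r. d i) - 1 = (\<Sum>j=1..s. 2 ^ lam j) + eps"
    and "strict_antimono_on {1..s} lam"
    and "\<forall>j\<in>{1..s}. 1 \<le> lam j"
    and "eps \<in> {0, 1}"
    and "h \<le> n 1 * (\<Sum>j=1..s. (n 1 + 1) ^ (lam j - 1)) + 1"
  shows "\<not> defective (multi_exps r n d) (segre_veronese r n d) h"
proof (cases "h = 0")
  case True
  then show ?thesis by (simp add: not_defective_0)
next
  case False
  then have h1: "1 \<le> h" by simp
  define N where "N = n 1"
  define D where "D = (\<Sum>i=1..r. d i)"
  define e where "e = D - 3"
  have De: "(\<Sum>i=1..r. d i) = e + 3" using assms(4) by (simp add: e_def D_def)
  have r1: "1 \<le> r" using assms(4) by (cases r) auto
  have d: "0 < d k" if "k \<in> {1..r}" for k using assms(2) that by blast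
  have N0: "0 < N" using assms(1) r1 by (simp add: N_def)
  have n: "N \<le> n k" if "k \<in> {1..r}" for k
    unfolding N_def using assms(3) that r1 by (intro mono_onD[of "{1..r}" n]) auto
  define K where "K = (\<lambda>j. lam j - 1) ` {1..s}"
  have inj: "inj_on (\<lambda>j. lam j - 1) {1..s}"
  proof (rule inj_onI)
    fix i j assume ij: "i \<in> {1..s}" "j \<in> {1..s}" "lam i - 1 = lam j - 1"
    have "1 \<le> lam i" "1 \<le> lam j" using assms(7) ij by blast+
    then have "lam i = lam j" using ij(3) by linarith
    moreover have "lam j < lam i" if "i < j" using monotone_onD[OF assms(6) ij(1,2) that] .
    moreover have "lam i < lam j" if "j < i" using monotone_onD[OF assms(6) ij(2,1) that] .
    ultimately show "i = j" by (metis nat_neq_iff)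
  qed
  define m :: nat where "m = (\<Sum>k\<in>K. 2 ^ k)"
  have "(2::nat) ^ lam j = 2 * 2 ^ (lam j - 1)" if "j \<in> {1..s}" for j
    using bspec[OF assms(7) that] by (cases "lam j") auto
  then have "(\<Sum>j=1..s. 2 ^ lam j) = (\<Sum>j=1..s. 2 * 2 ^ (lam j - 1) :: nat)"
    by (rule sum.cong[OF refl])
  then have m: "(\<Sum>j=1..s. 2 ^ lam j) = 2 * m"
    by (simp only: m_def K_def sum.reindex[OF inj] o_def sum_distrib_left)
  have "(\<Sum>j=1..s. (N + 1) ^ (lam j - 1)) = (\<Sum>k\<in>K. (N + 1) ^ k)"
    by (simp only: K_def sum.reindex[OF inj] o_def)
  also have "\<dots> = rebase (N + 1) m" unfolding m_def by (rule rebase_sum[symmetric]) (simp add: K_def)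
  finally have h: "h \<le> N * rebase (N + 1) m + 1" using assms(9) by (simp add: N_def)
  have e: "e + 2 = 2 * m + eps" using assms(5) unfolding De m by simp
  then have m1: "1 \<le> m" using assms(8) by (cases m) auto
  have ed: "e + 3 = 2 * m + 1 \<or> e + 3 = 2 * m + 2" using e assms(8) by auto
  have "N * rebase (N + 1) m + 1 \<le> (N + (2 * m - 1)) choose N"
    using rebase_le_binomial[of N m] N0 m1 by simp
  also have "\<dots> \<le> (N + (e + 1)) choose N" using ed by (intro binomial_right_mono) auto
  finally have hb: "h \<le> (N + (e + 1)) choose N" using h by simp
  show ?thesis
  proof (cases "N = 2 \<and> e + 3 = 9 \<and> 18 < h")
    case False
    have "gradients_indep N (e + 3) h"
    proof (cases "N = 2 \<and> e + 3 = 9")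
      case True
      then show ?thesis using False gradients_indep_mono[OF gradients_indep_2_9, of h] by simp
    next
      case F: False
      have "gradients_indep N (e + 3) (N * rebase (N + 1) m + 1)"
        by (rule gradients_indep_veronese) (use N0 m1 ed F in auto)
      then show ?thesis using h by (rule gradients_indep_mono)
    qed
    then show ?thesis
      by (intro not_defectiveI secant_dim_of_Ind[OF d r1 n N0 De _ hb h1])
  next
    case True
    then have "m = 4" using ed by auto
    then have h19: "h = 19" using h True by (simp add: rebase_numeral)
    have e6: "e = 6" using True by simp
    have N2: "2 \<le> n k" if "k \<in> {1..r}" for k using n[OF that] True by simp
    show ?thesis
    proof (cases "r = 1")
      case True
      have "d 1 = 6 + 3" "n 1 = 2" using De e6 True \<open>N = 2 \<and> _\<close> by (simp_all add: N_def)
      then show ?thesis unfolding h19 True by (intro not_defective_of_filling nineteen_points_plane)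
    next
      case False
      then have "2 \<le> r" using r1 by simp
      then show ?thesis unfolding h19
        using De e6 by (intro not_defectiveI nineteen_points[OF d _ N2]) simp_all
    qed
  qed
qed

end
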